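(* Let $d\in\{1,2\}$ and let $J:[0,\infty)\to\mathbb R$ be such that $kJ^2(k)\to0$ as $k\to\infty$. Let $M\ge0$ and $\delta>0$. Then there exists $T_\delta>0$ such that for any $\epsilon>0$, any $\mu\ge1$, any $s\ge3/4$ and any initial data $(\zeta_0,\psi_0)\in H^s((2\pi\mathbb T)^d)\times H^{s+\frac12}((2\pi\mathbb T)^d)$ such that $$\epsilon|\zeta_0|_{H^{\frac12}}+\epsilon|\nabla\psi_0|_{L^2}\le M,$$ there exists a unique $(\zeta,\psi)\in\mathcal C([-T,T];H^s((2\pi\mathbb T)^d)\times H^{s+\frac12}((2\pi\mathbb T)^d))$ solution to the toy model with $\mathsf J^\delta=J(\delta|D|)$ and satisfying $(\zeta,\psi)|_{t=0}=(\zeta_0,\psi_0)$, where $$T=\frac{T_\delta}{\big(\epsilon|\zeta_0|_{H^{\frac34}}+\epsilon|\nabla\psi_0|_{H^{\frac14}}\big)^2}.$$ Moreover, if we assume $\sup_{k\ge0}k^{3/2}J^2(k)<\infty$, then there exists $T_0>0$, depending uniquely on $M$ and $\sup_{k\ge0}k^{3/2}J^2(k)$, such that for any $\epsilon>0$, any $\mu\ge1$, any $s\ge1/2$ and any initial data $(\zeta_0,\psi_0)\in H^s((2\pi\mathbb T)^d)\times H^{s+\frac12}((2\pi\mathbb T)^d)$ such that $$\epsilon|\zeta_0|_{H^{\frac12}}+\epsilon|\nabla\psi_0|_{L^2}\le M,$$ there exists a unique $(\zeta,\psi)\in\mathcal C([-T,T];H^s((2\pi\mathbb T)^d)\times H^{s+\frac12}((2\pi\mathbb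 T)^d))$ solution to the toy model with $\mathsf J^\delta=J(\delta|D|)$ and satisfying $(\zeta,\psi)|_{t=0}=(\zeta_0,\psi_0)$, where $$T=\frac{T_0\,\delta^{3/2}}{\big(\epsilon|\zeta_0|_{H^{\frac12}}+\epsilon|\nabla\psi_0|_{L^2}\big)^2}.$$
   Context: The setting is $(2\pi\mathbb Z)^d$-periodic real-valued functions (distributions) on $(2\pi\mathbb T)^d$, with Fourier coefficients $\widehat\zeta_{k}=(2\pi)^{-d}\int_{(2\pi\mathbb T)^d}\zeta(x)e^{-ik\cdot x}dx$, $k\in\mathbb Z^d$, and $|\zeta|_{H^s}^2:=\sum_{k\in\mathbb Z^d}(1+|k|^2)^s|\widehat\zeta_k|^2$. Fourier multipliers act by $\widehat{(G(D)f)}_k=G(k)\widehat f_k$. $G_0^\mu:=|D|\tanh(\sqrt\mu|D|)$. The toy model is $$\begin{cases}\partial_t\zeta-G_0^\mu\psi=0,\\ \partial_t\psi+\zeta-\epsilon^2\alpha[\psi](\mathsf J^\delta)^2|D|\zeta=0,\end{cases}\qquad \alpha[\psi]:=\int_{(2\pi\mathbb T)^d}(G_0^\mu\psi)^2\,dx=(2\pi)^d\sum_{k\in\mathbb Z^d}\big(\tanh(\sqrt\mu|k|)|k||\widehat\psi_k|\big)^2.$$ When the denominator in the definition of $T$ vanishes, $T$ is understood as $+\infty$ (existence for all times). *)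

theory Defs
  imports "HOL-Analysis.Analysis"
begin

section \<open>Periodic functions, Fourier coefficients and Sobolev spaces\<close>

definition periodic :: "(real^'d \<Rightarrow> real) \<Rightarrow> bool" where
  "periodic f \<longleftrightarrow> (\<forall>x i. f (x + axis i (2 * pi)) = f x)"

definition cell :: "(real^'d) set" where
  "cell = cbox 0 (\<chi> i. 2 * pi)"

definition wavevector :: "int^'d \<Rightarrow> real^'d" where
  "wavevector k = (\<chi> i. of_int (k $ i))"

abbreviation wavenumber :: "int^'d \<Rightarrow> real" where
  "wavenumber k \<equiv> norm (wavevector k)"

definition fourier :: "(real^'d \<Rightarrow> real) \<Rightarrow> int^'d \<Rightarrow> complex" where
  "fourier f k =
     (LINT x:cell|lborel. of_real (f x) * cis (- (wavevector k \<bullet> x))) / of_real ((2 * pi) ^ CARD('d))"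

text \<open>
  The Sobolev norm is a function of the Fourier coefficients only. It is set up for
  coefficients in an arbitrary normed space, so that it applies to scalar functions
  (complex coefficients) and to gradients (coefficients in \<open>complex^'d\<close>) alike.
  The infinite sum is 0 if it diverges; the norm is only used where it converges.
\<close>

definition sobolev_norm :: "real \<Rightarrow> (int^'d \<Rightarrow> 'b::real_normed_vector) \<Rightarrow> real" where
  "sobolev_norm s c = sqrt (\<Sum>\<^sub>\<infinity>k. (1 + (wavenumber k)\<^sup>2) powr s * (norm (c k))\<^sup>2)"

text \<open>
  \<open>H\<^sup>s\<close> for nonnegative \<open>s\<close>, where its elements are (square-integrable) functions.
  Functions that agree almost everywhere represent the same element.
\<close>

definition sobolev :: "real \<Rightarrow> (real^'d \<Rightarrow> real) set" where
  "sobolev s = {f. periodic f \<and> set_integrable lborel cell f \<and>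
     (\<lambda>k. (1 + (wavenumber k)\<^sup>2) powr s * (norm (fourier f k))\<^sup>2) summable_on UNIV}"

definition fourier_grad :: "(real^'d \<Rightarrow> real) \<Rightarrow> int^'d \<Rightarrow> complex^'d" where
  "fourier_grad f k = (\<chi> j. \<i> * of_int (k $ j) * fourier f k)"

definition continuous_in_sobolev :: "real set \<Rightarrow> real \<Rightarrow> (real \<Rightarrow> real^'d \<Rightarrow> real) \<Rightarrow> bool" where
  "continuous_in_sobolev I s u \<longleftrightarrow>
     (\<forall>t\<in>I. u t \<in> sobolev s) \<and>
     (\<forall>t\<in>I. ((\<lambda>\<tau>. sobolev_norm s (fourier (\<lambda>x. u \<tau> x - u t x))) \<longlongrightarrow> 0) (at t within I))"

section \<open>The toy model\<close>

text \<open>The Fourier coefficients of \<open>G(|D|) f\<close>; the result need not be a function.\<close>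

definition multiplier :: "(real \<Rightarrow> real) \<Rightarrow> (real^'d \<Rightarrow> real) \<Rightarrow> int^'d \<Rightarrow> complex" where
  "multiplier G f k = of_real (G (wavenumber k)) * fourier f k"

definition G0 :: "real \<Rightarrow> real \<Rightarrow> real" where
  "G0 \<mu> \<xi> = \<xi> * tanh (sqrt \<mu> * \<xi>)"

text \<open>The integral of \<open>(G\<^sub>0\<^sup>\<mu> \<psi>)\<^sup>2\<close> over the torus, written on the Fourier side.\<close>

definition alpha :: "real \<Rightarrow> (real^'d \<Rightarrow> real) \<Rightarrow> real" where
  "alpha \<mu> \<psi> = (2 * pi) ^ CARD('d) * (\<Sum>\<^sub>\<infinity>k. (norm (multiplier (G0 \<mu>) \<psi> k))\<^sup>2)"

text \<open>
  The equations hold in the sense of periodic distributions, that is, Fourier coefficient by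
  Fourier coefficient. Since the coefficients of \<open>\<zeta>\<close>, \<open>\<psi>\<close> and \<open>alpha\<close> depend continuously on time
  for the solutions considered below, the time derivatives are classical (one-sided at the
  end points of \<open>I\<close>).
\<close>

definition toy_model ::
  "real \<Rightarrow> real \<Rightarrow> real \<Rightarrow> (real \<Rightarrow> real) \<Rightarrow> real set \<Rightarrow>
   (real \<Rightarrow> real^'d \<Rightarrow> real) \<Rightarrow> (real \<Rightarrow> real^'d \<Rightarrow> real) \<Rightarrow> bool" where
  "toy_model \<epsilon> \<mu> \<delta> J I \<zeta> \<psi> \<longleftrightarrow>
     (\<forall>t\<in>I. \<forall>k.
        ((\<lambda>\<tau>. fourier (\<zeta> \<tau>) k) has_vector_derivative multiplier (G0 \<mu>) (\<psi> t) k) (at t within I) \<and>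
        ((\<lambda>\<tau>. fourier (\<psi> \<tau>) k) has_vector_derivative
           - fourier (\<zeta> t) k
           + of_real (\<epsilon>\<^sup>2 * alpha \<mu> (\<psi> t)) * multiplier (\<lambda>\<xi>. (J (\<delta> * \<xi>))\<^sup>2 * \<xi>) (\<zeta> t) k) (at t within I))"

definition solution ::
  "real \<Rightarrow> real \<Rightarrow> real \<Rightarrow> (real \<Rightarrow> real) \<Rightarrow> real \<Rightarrow> real set \<Rightarrow> (real^'d \<Rightarrow> real) \<Rightarrow> (real^'d \<Rightarrow> real) \<Rightarrow>
   (real \<Rightarrow> real^'d \<Rightarrow> real) \<Rightarrow> (real \<Rightarrow> real^'d \<Rightarrow> real) \<Rightarrow> bool" where
  "solution \<epsilon> \<mu> \<delta> J s I \<zeta>0 \<psi>0 \<zeta> \<psi> \<longleftrightarrow>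
     continuous_in_sobolev I s \<zeta> \<and> continuous_in_sobolev I (s + 1/2) \<psi> \<and>
     toy_model \<epsilon> \<mu> \<delta> J I \<zeta> \<psi> \<and>
     (AE x in lborel. \<zeta> 0 x = \<zeta>0 x \<and> \<psi> 0 x = \<psi>0 x)"

definition exists_unique_solution ::
  "real \<Rightarrow> real \<Rightarrow> real \<Rightarrow> (real \<Rightarrow> real) \<Rightarrow> real \<Rightarrow> real set \<Rightarrow>
   (real^'d \<Rightarrow> real) \<Rightarrow> (real^'d \<Rightarrow> real) \<Rightarrow> bool" where
  "exists_unique_solution \<epsilon> \<mu> \<delta> J s I \<zeta>0 \<psi>0 \<longleftrightarrow>
     (\<exists>\<zeta> \<psi>. solution \<epsilon> \<mu> \<delta> J s I \<zeta>0 \<psi>0 \<zeta> \<psi> \<and>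
       (\<forall>\<zeta>' \<psi>'. solution \<epsilon> \<mu> \<delta> J s I \<zeta>0 \<psi>0 \<zeta>' \<psi>' \<longrightarrow>
          (\<forall>t\<in>I. AE x in lborel. \<zeta>' t x = \<zeta> t x \<and> \<psi>' t x = \<psi> t x)))"

text \<open>\<open>time_interval c n\<close> is \<open>[-T, T]\<close> with \<open>T = c / n\<^sup>2\<close>, and the whole line if \<open>n = 0\<close>.\<close>

definition time_interval :: "real \<Rightarrow> real \<Rightarrow> real set" where
  "time_interval c n = (if n = 0 then UNIV else {- (c / n\<^sup>2) .. c / n\<^sup>2})"

text \<open>
  Well-posedness in dimension \<open>CARD('d)\<close>, for all data with \<open>\<epsilon>|\<zeta>\<^sub>0| + \<epsilon>|\<nabla>\<psi>\<^sub>0| \<le> M\<close> in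
  \<open>H\<^sup>1\<^sup>/\<^sup>2 \<times> L\<^sup>2\<close> and all regularities \<open>s \<ge> \<sigma>\<close>, on a time \<open>c\<close> divided by the square of
  \<open>\<epsilon>|\<zeta>\<^sub>0| + \<epsilon>|\<nabla>\<psi>\<^sub>0|\<close> in \<open>H\<^sup>\<sigma> \<times> H\<^sup>\<sigma>\<^sup>-\<^sup>1\<^sup>/\<^sup>2\<close>. The dimension is passed as a type argument because
  a single \<open>c\<close> has to serve several dimensions.
\<close>

definition wellposed_with_lifespan ::
  "'d::finite itself \<Rightarrow> real \<Rightarrow> (real \<Rightarrow> real) \<Rightarrow> real \<Rightarrow> real \<Rightarrow> real \<Rightarrow> bool" where
  "wellposed_with_lifespan TYPE('d) \<delta> J M \<sigma> c \<longleftrightarrow>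
     (\<forall>\<epsilon>>0. \<forall>\<mu>\<ge>1. \<forall>s\<ge>\<sigma>. \<forall>\<zeta>0 :: real^'d \<Rightarrow> real. \<forall>\<psi>0 :: real^'d \<Rightarrow> real.
        \<zeta>0 \<in> sobolev s \<longrightarrow> \<psi>0 \<in> sobolev (s + 1/2) \<longrightarrow>
        \<epsilon> * sobolev_norm (1/2) (fourier \<zeta>0) + \<epsilon> * sobolev_norm 0 (fourier_grad \<psi>0) \<le> M \<longrightarrow>
        exists_unique_solution \<epsilon> \<mu> \<delta> J s
          (time_interval c
             (\<epsilon> * sobolev_norm \<sigma> (fourier \<zeta>0) + \<epsilon> * sobolev_norm (\<sigma> - 1/2) (fourier_grad \<psi>0)))
          \<zeta>0 \<psi>0)"

end

theory Submission
  imports Defs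
begin

text \<open>
  On the Fourier side the toy model is a family of oscillators
  \<open>z' = g w\<close>, \<open>w' = (a m - 1) z\<close>, one for each wave vector \<open>k\<close>, with \<open>z\<close> and \<open>w\<close> the
  coefficients of \<open>\<zeta>\<close> and \<open>\<psi>\<close>, \<open>g = G\<^sub>0(|k|)\<close> and \<open>m = J(\<delta>|k|)\<^sup>2|k|\<close>. The modes interact only through
  the scalar \<open>a = \<epsilon>\<^sup>2 \<alpha>[\<psi>]\<close>, a weighted sum of the \<open>|w|\<^sup>2\<close>. For a given function \<open>a\<close> each mode
  solves a linear equation, so the task is to find the functions \<open>a\<close> that reproduce themselves.

  The energy \<open>|z|\<^sup>2 + g|w|\<^sup>2\<close> of a mode grows at a rate of at most \<open>a m \<surd>g\<close>. If
  \<open>k\<^sup>3\<^sup>/\<^sup>2 J(k)\<^sup>2\<close> is bounded by \<open>K\<close>, then \<open>m \<surd>g \<le> K \<delta>\<^sup>-\<^sup>3\<^sup>/\<^sup>2\<close> for all modes, and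
  \<open>a\<close> is controlled by the energies in \<open>H\<^sup>1\<^sup>/\<^sup>2 \<times> H\<^sup>1\<close>: this is the second half of the theorem.
  In the first half only \<open>m \<rightarrow> 0\<close> is known. Then the crude rate is used for finitely many
  modes. For the others \<open>a m \<le> 1/2\<close>, because \<open>a\<close> is bounded by a multiple of \<open>M\<^sup>2\<close>, and
  the modified energy \<open>(1 - a m)|z|\<^sup>2 + g|w|\<^sup>2\<close> removes the dangerous cross term at the price of a
  growth rate proportional to \<open>m\<close> times the Lipschitz constant of \<open>a\<close>. The derivative of \<open>a\<close> is
  controlled by the energies in \<open>H\<^sup>3\<^sup>/\<^sup>4 \<times> H\<^sup>5\<^sup>/\<^sup>4\<close>, whence the exponent \<open>3/4\<close>.
  Both cases are instances of one estimate, \<open>mode_energy\<close>.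

  Let \<open>n\<close> be the size of the data that enters the lifespan. All growth rates are bounded by
  constants times \<open>n\<^sup>2\<close>, so up to a time \<open>c / n\<^sup>2\<close> with a small \<open>c\<close> no mode more than
  quadruples its energy. This keeps the bounds on \<open>a\<close> and on its Lipschitz constant
  (\<open>solution_exists\<close>). Moreover, the map that produces a new \<open>a\<close> from an old one halves distances
  in a norm with weight \<open>exp(- \<rho>|t|)\<close> for large \<open>\<rho>\<close> (\<open>contraction\<close>); this needs no smallness and
  gives existence by iteration, and uniqueness on any interval. As the energy bound holds mode by mode, every
  Sobolev regularity of the data is propagated.

  Coefficients are turned into functions by the Riesz--Fischer theorem (\<open>riesz_fischer\<close>), and
  functions with the same coefficients agree almost everywhere (\<open>fourier_unique\<close>). Both are
  proved here for the torus of any dimension. If \<open>n = 0\<close>, the data are stationary.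
\<close>

section \<open>The energy of a single mode\<close>

text \<open>
  The coefficient \<open>a\<close> is only Lipschitz, so \<open>q - a r\<close> need not be differentiable. If \<open>a\<close> were
  differentiable with \<open>|a'| \<le> L\<close>, the hypothesis \<open>q' - a r' + L r \<le> 0\<close> would bound the derivative
  of \<open>q - a r\<close>. Without derivatives, increments over short intervals around a point
  are estimated and then patched together by bisection.
\<close>

lemma lipschitz_product_nonincreasing:
  fixes q r a :: "real \<Rightarrow> real"
  assumes T: "0 \<le> T" and L: "0 \<le> L"
    and q: "\<And>t. t \<in> {0..T} \<Longrightarrow> (q has_real_derivative q' t) (at t within {0..T})"
    and r: "\<And>t. t \<in> {0..T} \<Longrightarrow> (r has_real_derivative r' t) (at t within {0..T})"
    and r_nonneg: "\<And>t. t \<in> {0..T} \<Longrightarrow> 0 \<le> r t"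
    and lip: "\<And>s t. s \<in> {0..T} \<Longrightarrow> t \<in> {0..T} \<Longrightarrow> \<bar>a s - a t\<bar> \<le> L * \<bar>s - t\<bar>"
    and decr: "\<And>t. t \<in> {0..T} \<Longrightarrow> q' t - a t * r' t + L * r t \<le> 0"
  shows "q T - a T * r T \<le> q 0 - a 0 * r 0"
proof (rule field_le_epsilon)
  fix e :: real assume e: "0 < e"
  define \<eta> where "\<eta> = e / (T + 1)"
  have \<eta>: "0 < \<eta>" and \<eta>T: "\<eta> * T \<le> e"
    using e T by (auto simp: \<eta>_def field_simps)
  define \<phi> where "\<phi> t = q t - a t * r t" for t
  define P where "P u v \<longleftrightarrow> (0 \<le> u \<and> v \<le> T \<longrightarrow> \<phi> v - \<phi> u \<le> \<eta> * (v - u))" for u v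
  have "P 0 T"
    using T
  proof (induction rule: Bolzano)
    case (trans u v w)
    then show ?case by (auto simp: P_def algebra_simps)
  next
    case (local x)
    then have x: "x \<in> {0..T}" by auto
    define \<epsilon> where "\<epsilon> = \<eta> / (1 + \<bar>a x\<bar> + L)"
    have pos: "1 + \<bar>a x\<bar> + L > 0" using L by linarith
    have \<epsilon>: "0 < \<epsilon>" and \<epsilon>_eq: "\<epsilon> * (1 + \<bar>a x\<bar> + L) = \<eta>"
      using \<eta> pos by (auto simp: \<epsilon>_def)
    obtain d1 where d1: "d1 > 0" "\<And>y. y \<in> {0..T} \<Longrightarrow> \<bar>y - x\<bar> < d1 \<Longrightarrow>
        \<bar>q y - q x - q' x * (y - x)\<bar> \<le> \<epsilon> * \<bar>y - x\<bar>"
      using q[OF x] \<epsilon> unfolding has_field_derivative_def has_derivative_within_alt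
      by (auto simp: mult.commute)
    obtain d2 where d2: "d2 > 0" "\<And>y. y \<in> {0..T} \<Longrightarrow> \<bar>y - x\<bar> < d2 \<Longrightarrow>
        \<bar>r y - r x - r' x * (y - x)\<bar> \<le> \<epsilon> * \<bar>y - x\<bar>"
      using r[OF x] \<epsilon> unfolding has_field_derivative_def has_derivative_within_alt
      by (auto simp: mult.commute)
    have "continuous (at x within {0..T}) r"
      using r[OF x] by (rule DERIV_continuous)
    then obtain d3 where d3: "d3 > 0" "\<And>y. y \<in> {0..T} \<Longrightarrow> \<bar>y - x\<bar> < d3 \<Longrightarrow> \<bar>r y - r x\<bar> < \<epsilon>"
      using \<epsilon> unfolding continuous_within_eps_delta dist_real_def by metis
    define d where "d = min d1 (min d2 d3)"
    have near: "\<bar>(\<phi> y - \<phi> x) - (q' x - a x * r' x) * (y - x)\<bar>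
        \<le> (\<eta> + L * r x) * \<bar>y - x\<bar>" if y: "y \<in> {0..T}" "\<bar>y - x\<bar> < d" for y
    proof -
      have 1: "\<bar>q y - q x - q' x * (y - x)\<bar> \<le> \<epsilon> * \<bar>y - x\<bar>"
        using d1(2)[of y] y by (simp add: d_def)
      have "\<bar>a x * (r y - r x - r' x * (y - x))\<bar> \<le> \<bar>a x\<bar> * (\<epsilon> * \<bar>y - x\<bar>)"
        unfolding abs_mult using d2(2)[of y] y by (intro mult_left_mono) (auto simp: d_def)
      then have 2: "\<bar>a x * (r y - r x - r' x * (y - x))\<bar> \<le> \<bar>a x\<bar> * \<epsilon> * \<bar>y - x\<bar>"
        by (simp add: mult_ac)
      have "\<bar>r y * (a y - a x)\<bar> \<le> (r x + \<epsilon>) * (L * \<bar>y - x\<bar>)"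
        unfolding abs_mult using d3(2)[of y] lip[OF y(1) x] y r_nonneg[OF y(1)]
        by (intro mult_mono) (auto simp: d_def)
      then have 3: "\<bar>r y * (a y - a x)\<bar> \<le> (L * r x + \<epsilon> * L) * \<bar>y - x\<bar>"
        by (simp add: algebra_simps)
      have eq: "(\<phi> y - \<phi> x) - (q' x - a x * r' x) * (y - x) = (q y - q x - q' x * (y - x))
          - a x * (r y - r x - r' x * (y - x)) - r y * (a y - a x)"
        by (simp add: \<phi>_def algebra_simps)
      have "\<bar>(\<phi> y - \<phi> x) - (q' x - a x * r' x) * (y - x)\<bar>
          \<le> \<epsilon> * \<bar>y - x\<bar> + \<bar>a x\<bar> * \<epsilon> * \<bar>y - x\<bar> + (L * r x + \<epsilon> * L) * \<bar>y - x\<bar>"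
        unfolding eq using 1 2 3 by linarith
      also have "\<dots> = (\<epsilon> * (1 + \<bar>a x\<bar> + L) + L * r x) * \<bar>y - x\<bar>"
        by (simp add: algebra_simps)
      finally show ?thesis by (simp only: \<epsilon>_eq)
    qed
    have "\<phi> v - \<phi> u \<le> \<eta> * (v - u)" if "0 \<le> u" "v \<le> T" "u \<le> x" "x \<le> v" "v - u < d" for u v
    proof -
      have "\<phi> v - \<phi> x \<le> (q' x - a x * r' x) * (v - x) + (\<eta> + L * r x) * (v - x)"
        using near[of v] that x by auto
      moreover have "\<phi> x - \<phi> u \<le> (q' x - a x * r' x) * (x - u) + (\<eta> + L * r x) * (x - u)"
      proof -
        have "\<bar>(\<phi> u - \<phi> x) - (q' x - a x * r' x) * (u - x)\<bar> \<le> (\<eta> + L * r x) * (x - u)"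
          using near[of u] that x by auto
        then show ?thesis by (simp add: algebra_simps abs_le_iff)
      qed
      ultimately have "\<phi> v - \<phi> u \<le> (q' x - a x * r' x + L * r x) * (v - u) + \<eta> * (v - u)"
        by (simp add: algebra_simps)
      moreover have "(q' x - a x * r' x + L * r x) * (v - u) \<le> 0"
        using decr[OF x] that by (intro mult_nonpos_nonneg) auto
      ultimately show ?thesis by linarith
    qed
    moreover have "d > 0" using d1(1) d2(1) d3(1) by (simp add: d_def)
    ultimately show ?case unfolding P_def by (intro exI[of _ d]) auto
  qed
  then show "q T - a T * r T \<le> q 0 - a 0 * r 0 + e"
    using \<eta>T by (simp add: P_def \<phi>_def)
qed

definition mode_solution ::
  "real set \<Rightarrow> real \<Rightarrow> real \<Rightarrow> (real \<Rightarrow> real) \<Rightarrow> (real \<Rightarrow> 'a) \<Rightarrow> (real \<Rightarrow> 'a) \<Rightarrow> (real \<Rightarrow> 'a::real_normed_vector) \<Rightarrow> bool"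
  where "mode_solution I g m a F z w \<longleftrightarrow> (\<forall>t\<in>I.
     (z has_vector_derivative g *\<^sub>R w t) (at t within I) \<and>
     (w has_vector_derivative (a t * m - 1) *\<^sub>R z t + F t) (at t within I))"

definition energy :: "real \<Rightarrow> 'a::real_normed_vector \<Rightarrow> 'a \<Rightarrow> real" where
  "energy g z w = (norm z)\<^sup>2 + g * (norm w)\<^sup>2"

text \<open>
  The function \<open>b\<close> is the part of \<open>a\<close> that the modified energy \<open>(1 - b m)|z|\<^sup>2 + g|w|\<^sup>2\<close>
  absorbs: only \<open>a - b\<close> multiplies the cross term, while \<open>b\<close> has to be Lipschitz and small. The choices
  \<open>b = 0\<close> and \<open>b = a\<close> serve the low and the high modes; see \<open>growth_rate_low\<close> and
  \<open>growth_rate_high\<close>.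
\<close>

definition growth_rate :: "real set \<Rightarrow> real \<Rightarrow> real \<Rightarrow> (real \<Rightarrow> real) \<Rightarrow> real \<Rightarrow> bool" where
  "growth_rate I g m a \<gamma> \<longleftrightarrow> (\<exists>b L. 0 \<le> L \<and>
     (\<forall>t\<in>I. 0 \<le> b t \<and> b t * m \<le> 1/2 \<and> 2 * (\<bar>a t - b t\<bar> * (m * sqrt g) + L * m) \<le> \<gamma>) \<and>
     (\<forall>s\<in>I. \<forall>t\<in>I. \<bar>b s - b t\<bar> \<le> L * \<bar>s - t\<bar>))"

lemma energy_nonneg: "0 \<le> g \<Longrightarrow> 0 \<le> energy g z w"
  by (simp add: energy_def)

lemma mode_solution_subset:
  "mode_solution I g m a F z w \<Longrightarrow> J \<subseteq> I \<Longrightarrow> mode_solution J g m a F z w"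
  unfolding mode_solution_def by (meson has_vector_derivative_within_subset subset_iff)

lemma growth_rate_subset: "growth_rate I g m a \<gamma> \<Longrightarrow> J \<subseteq> I \<Longrightarrow> growth_rate J g m a \<gamma>"
  unfolding growth_rate_def by (meson subset_iff)

text \<open>
  Gronwall's inequality for the modified energy. The terms \<open>\<kappa>\<close> and \<open>\<beta> exp(2 \<rho> t)\<close> allow for a
  forcing \<open>F\<close> that grows exponentially; the denominator \<open>2 \<rho> - \<gamma> - \<kappa>\<close> makes its effect small
  for large \<open>\<rho>\<close>, which is what the contraction argument rests on. The factor 2 comes from
  comparing the energy with the modified energy.
\<close>

lemma mode_energy_forward:
  fixes z w F :: "real \<Rightarrow> 'a::real_inner"
  assumes T: "0 \<le> T" and g: "0 \<le> g" and m: "0 \<le> m"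
    and sol: "mode_solution {0..T} g m a F z w" and rate: "growth_rate {0..T} g m a \<gamma>"
    and source: "\<And>t. t \<in> {0..T} \<Longrightarrow>
      2 * g * (F t \<bullet> w t) \<le> \<kappa> * (g * (norm (w t))\<^sup>2) + \<beta> * exp (2 * \<rho> * t)"
    and \<kappa>: "0 \<le> \<kappa>" and \<beta>: "0 \<le> \<beta>" and \<rho>: "\<gamma> + \<kappa> < 2 * \<rho>"
  shows "energy g (z T) (w T) \<le> 2 * exp ((\<gamma> + \<kappa>) * T) * energy g (z 0) (w 0)
      + 2 * \<beta> * exp (2 * \<rho> * T) / (2 * \<rho> - \<gamma> - \<kappa>)"
proof -
  obtain b L where L: "0 \<le> L"
    and b0: "\<And>t. t \<in> {0..T} \<Longrightarrow> 0 \<le> b t" and bm: "\<And>t. t \<in> {0..T} \<Longrightarrow> b t * m \<le> 1/2"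
    and b: "\<And>t. t \<in> {0..T} \<Longrightarrow> 2 * (\<bar>a t - b t\<bar> * (m * sqrt g) + L * m) \<le> \<gamma>"
    and lip: "\<And>s t. s \<in> {0..T} \<Longrightarrow> t \<in> {0..T} \<Longrightarrow> \<bar>b s - b t\<bar> \<le> L * \<bar>s - t\<bar>"
    using rate unfolding growth_rate_def by blast
  define c where "c = \<gamma> + \<kappa>"
  define \<nu> where "\<nu> = 2 * \<rho> - \<gamma> - \<kappa>"
  have \<nu>: "\<nu> > 0" using \<rho> by (simp add: \<nu>_def)
  define N where "N t = energy g (z t) (w t)" for t
  define r0 where "r0 t = m * (norm (z t))\<^sup>2" for t
  define N' where "N' t = 2 * (g * (a t * m * (z t \<bullet> w t) + F t \<bullet> w t))" for t
  define r0' where "r0' t = 2 * (m * (g * (z t \<bullet> w t)))" for t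
  \<comment> \<open>The weighted modified energy minus the contribution of the forcing is
    \<open>q - b r\<close>, and \<open>lipschitz_product_nonincreasing\<close> applies to it.\<close>
  define q where "q t = exp (- c * t) * N t - \<beta> / \<nu> * exp (\<nu> * t)" for t
  define r where "r t = exp (- c * t) * r0 t" for t
  define q' where "q' t = exp (- c * t) * (N' t - c * N t) - \<beta> * exp (\<nu> * t)" for t
  define r' where "r' t = exp (- c * t) * (r0' t - c * r0 t)" for t
  have z: "(z has_vector_derivative g *\<^sub>R w t) (at t within {0..T})"
    and w: "(w has_vector_derivative (a t * m - 1) *\<^sub>R z t + F t) (at t within {0..T})"
    if "t \<in> {0..T}" for t
    using sol that by (auto simp: mode_solution_def)
  have dz: "((\<lambda>t. (norm (z t))\<^sup>2) has_real_derivative 2 * (g * (z t \<bullet> w t))) (at t within {0..T})"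
    if t: "t \<in> {0..T}" for t
    unfolding power2_norm_eq_inner has_real_derivative_iff_has_vector_derivative
    using bounded_bilinear.has_vector_derivative[OF bounded_bilinear_inner z[OF t] z[OF t]]
    by (simp add: inner_commute)
  have dw: "((\<lambda>t. (norm (w t))\<^sup>2) has_real_derivative
      2 * ((a t * m - 1) * (z t \<bullet> w t) + F t \<bullet> w t)) (at t within {0..T})"
    if t: "t \<in> {0..T}" for t
    unfolding power2_norm_eq_inner has_real_derivative_iff_has_vector_derivative
    using bounded_bilinear.has_vector_derivative[OF bounded_bilinear_inner w[OF t] w[OF t]]
    by (simp add: inner_commute inner_add_left inner_add_right mult_ac)
  have dN: "(N has_real_derivative N' t) (at t within {0..T})" if t: "t \<in> {0..T}" for t
  proof -
    have "(N has_real_derivative 2 * (g * (z t \<bullet> w t))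
        + g * (2 * ((a t * m - 1) * (z t \<bullet> w t) + F t \<bullet> w t))) (at t within {0..T})"
      unfolding N_def[abs_def] energy_def by (intro DERIV_add dz[OF t] DERIV_cmult dw[OF t])
    then show ?thesis by (simp add: N'_def algebra_simps)
  qed
  have dr0: "(r0 has_real_derivative r0' t) (at t within {0..T})" if t: "t \<in> {0..T}" for t
    using DERIV_cmult[OF dz[OF t], of m] by (simp add: r0_def[abs_def] r0'_def mult_ac)
  have dexp: "((\<lambda>t. exp (k * t)) has_real_derivative k * exp (k * t)) (at t within {0..T})" for k t
    by (auto intro!: derivative_eq_intros)
  have dq: "(q has_real_derivative q' t) (at t within {0..T})" if t: "t \<in> {0..T}" for t
  proof -
    have "(q has_real_derivative (- c * exp (- c * t) * N t + N' t * exp (- c * t))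
        - \<beta> / \<nu> * (\<nu> * exp (\<nu> * t))) (at t within {0..T})"
      unfolding q_def[abs_def] by (intro DERIV_diff DERIV_mult DERIV_cmult dexp dN[OF t])
    moreover have "(- c * exp (- c * t) * N t + N' t * exp (- c * t)) - \<beta> / \<nu> * (\<nu> * exp (\<nu> * t)) = q' t"
      using \<nu> by (simp add: q'_def algebra_simps)
    ultimately show ?thesis by simp
  qed
  have dr: "(r has_real_derivative r' t) (at t within {0..T})" if t: "t \<in> {0..T}" for t
  proof -
    have "(r has_real_derivative (- c * exp (- c * t) * r0 t + r0' t * exp (- c * t))) (at t within {0..T})"
      unfolding r_def[abs_def] by (intro DERIV_mult dexp dr0[OF t])
    moreover have "- c * exp (- c * t) * r0 t + r0' t * exp (- c * t) = r' t"
      by (simp add: r'_def algebra_simps)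
    ultimately show ?thesis by simp
  qed
  have N_le: "N t \<le> 2 * (N t - b t * r0 t)" if t: "t \<in> {0..T}" for t
  proof -
    have "b t * r0 t \<le> 1/2 * (norm (z t))\<^sup>2"
      using mult_right_mono[OF bm[OF t], of "(norm (z t))\<^sup>2"] by (simp add: r0_def mult_ac)
    moreover have "0 \<le> g * (norm (w t))\<^sup>2" using g by simp
    moreover have "N t = (norm (z t))\<^sup>2 + g * (norm (w t))\<^sup>2" by (simp add: N_def energy_def)
    ultimately show ?thesis unfolding right_diff_distrib by linarith
  qed
  have decr: "q' t - b t * r' t + L * r t \<le> 0" if t: "t \<in> {0..T}" for t
  proof -
    define e where "e = N t - b t * r0 t"
    have Ne: "N t \<le> 2 * e" using N_le[OF t] by (simp add: e_def)
    have N0: "0 \<le> N t" using g by (simp add: N_def energy_nonneg)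
    have e0: "0 \<le> e" using Ne N0 by linarith
    have we: "g * (norm (w t))\<^sup>2 \<le> e"
    proof -
      have "b t * r0 t \<le> 1/2 * (norm (z t))\<^sup>2"
        using mult_right_mono[OF bm[OF t], of "(norm (z t))\<^sup>2"] by (simp add: r0_def mult_ac)
      moreover have "0 \<le> (norm (z t))\<^sup>2" by simp
      ultimately show ?thesis unfolding e_def N_def energy_def by linarith
    qed
    have cross: "2 * \<bar>sqrt g * (z t \<bullet> w t)\<bar> \<le> N t"
    proof -
      have "\<bar>sqrt g * (z t \<bullet> w t)\<bar> \<le> norm (z t) * (sqrt g * norm (w t))"
        using mult_left_mono[OF Cauchy_Schwarz_ineq2[of "z t" "w t"], of "sqrt g"] g
        by (simp add: abs_mult mult_ac)
      moreover have "2 * (norm (z t) * (sqrt g * norm (w t))) \<le> (norm (z t))\<^sup>2 + (sqrt g * norm (w t))\<^sup>2"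
        using sum_squares_bound[of "norm (z t)" "sqrt g * norm (w t)"] by simp
      ultimately show ?thesis using g by (simp add: N_def energy_def power_mult_distrib)
    qed
    have "N' t - b t * r0' t = (a t - b t) * (m * sqrt g) * (2 * (sqrt g * (z t \<bullet> w t))) + 2 * g * (F t \<bullet> w t)"
    proof -
      have gg: "g = sqrt g * sqrt g" using g by simp
      have "N' t - b t * r0' t = (a t - b t) * m * (2 * (g * (z t \<bullet> w t))) + 2 * g * (F t \<bullet> w t)"
        by (simp add: N'_def r0'_def algebra_simps)
      also have "(a t - b t) * m * (2 * (g * (z t \<bullet> w t))) =
          (a t - b t) * (m * sqrt g) * (2 * (sqrt g * (z t \<bullet> w t)))"
        by (subst gg) (simp only: mult_ac)
      finally show ?thesis .
    qed
    also have "\<dots> \<le> \<bar>a t - b t\<bar> * (m * sqrt g) * N t + (\<kappa> * e + \<beta> * exp (2 * \<rho> * t))"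
    proof (rule add_mono)
      have "(a t - b t) * (m * sqrt g) * (2 * (sqrt g * (z t \<bullet> w t)))
          \<le> \<bar>(a t - b t) * (m * sqrt g)\<bar> * \<bar>2 * (sqrt g * (z t \<bullet> w t))\<bar>"
        by (metis abs_ge_self abs_mult)
      also have "\<dots> \<le> \<bar>(a t - b t) * (m * sqrt g)\<bar> * N t"
        using cross by (intro mult_left_mono) auto
      finally show "(a t - b t) * (m * sqrt g) * (2 * (sqrt g * (z t \<bullet> w t))) \<le> \<bar>a t - b t\<bar> * (m * sqrt g) * N t"
        using m g by (simp add: abs_mult)
      show "2 * g * (F t \<bullet> w t) \<le> \<kappa> * e + \<beta> * exp (2 * \<rho> * t)"
        using source[OF t] mult_left_mono[OF we \<kappa>] by linarith
    qed
    finally have 1: "N' t - b t * r0' t \<le> \<bar>a t - b t\<bar> * (m * sqrt g) * N t + (\<kappa> * e + \<beta> * exp (2 * \<rho> * t))" .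
    have "r0 t \<le> m * N t"
      using m g by (auto simp: r0_def N_def energy_def intro!: mult_left_mono)
    then have 2: "L * r0 t \<le> (L * m) * N t"
      using mult_left_mono[OF _ L] by (metis mult.assoc)
    have "(\<bar>a t - b t\<bar> * (m * sqrt g) + L * m) * N t \<le> (\<bar>a t - b t\<bar> * (m * sqrt g) + L * m) * (2 * e)"
      using Ne L m g by (intro mult_left_mono) auto
    also have "\<dots> \<le> \<gamma> * e"
      using mult_right_mono[OF b[OF t] e0] by (simp add: algebra_simps)
    finally have 3: "N' t - b t * r0' t + L * r0 t \<le> c * e + \<beta> * exp (2 * \<rho> * t)"
      using 1 2 by (simp add: algebra_simps c_def)
    have split: "exp (\<nu> * t) = exp (- c * t) * exp (2 * \<rho> * t)"
      by (simp add: mult_exp_exp \<nu>_def c_def algebra_simps)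
    have "q' t - b t * r' t + L * r t =
        exp (- c * t) * (N' t - b t * r0' t + L * r0 t - c * e - \<beta> * exp (2 * \<rho> * t))"
      unfolding q'_def r'_def r_def e_def split by (simp add: algebra_simps)
    also have "\<dots> \<le> 0" using 3 by (intro mult_nonneg_nonpos) auto
    finally show ?thesis .
  qed
  have "q T - b T * r T \<le> q 0 - b 0 * r 0"
  proof (rule lipschitz_product_nonincreasing[where L=L and q'=q' and r'=r'])
    show "\<And>t. t \<in> {0..T} \<Longrightarrow> 0 \<le> r t" using m by (simp add: r_def r0_def)
  qed (use T L dq dr lip decr in auto)
  also have "\<dots> \<le> N 0"
  proof -
    have "0 \<le> b 0 * r0 0" using b0[of 0] T m by (simp add: r0_def)
    moreover have "0 \<le> \<beta> / \<nu>" using \<beta> \<nu> by simp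
    ultimately show ?thesis by (simp add: q_def r_def)
  qed
  finally have "exp (- c * T) * (N T - b T * r0 T) \<le> N 0 + \<beta> / \<nu> * exp (\<nu> * T)"
    by (simp add: q_def r_def algebra_simps)
  then have "exp (c * T) * (exp (- c * T) * (N T - b T * r0 T)) \<le> exp (c * T) * (N 0 + \<beta> / \<nu> * exp (\<nu> * T))"
    by (intro mult_left_mono) auto
  moreover have "exp (c * T) * (exp (- c * T) * (N T - b T * r0 T)) = N T - b T * r0 T"
    by (simp add: mult.assoc[symmetric] mult_exp_exp)
  moreover have "exp (c * T) * exp (\<nu> * T) = exp (2 * \<rho> * T)"
    by (simp add: mult_exp_exp \<nu>_def c_def algebra_simps)
  ultimately have "N T - b T * r0 T \<le> exp (c * T) * N 0 + \<beta> * exp (2 * \<rho> * T) / \<nu>"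
    by (simp add: algebra_simps)
  then show ?thesis using N_le[of T] T by (simp add: N_def c_def \<nu>_def diff_diff_eq)
qed

text \<open>
  The equations are reversible, which reduces negative times to positive ones.
\<close>

lemma mode_solution_reverse:
  assumes "mode_solution {-T..T} g m a F z w"
  shows "mode_solution {-T..T} g m (\<lambda>t. a (- t)) (\<lambda>t. F (- t)) (\<lambda>t. z (- t)) (\<lambda>t. - w (- t))"
  unfolding mode_solution_def
proof (intro ballI conjI)
  fix t assume t: "t \<in> {-T..T}"
  have im: "uminus ` {-T..T} = {-T..T}" by simp
  have d: "(uminus has_vector_derivative -1) (at t within {-T..T})"
    by (auto intro!: derivative_eq_intros)
  have t': "- t \<in> {-T..T}" using t by auto
  note sol = assms[unfolded mode_solution_def, rule_format, OF t']
  show "((\<lambda>t. z (- t)) has_vector_derivative g *\<^sub>R - w (- t)) (at t within {-T..T})"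
    using vector_diff_chain_within[OF d, of z "g *\<^sub>R w (- t)"] sol im by (simp add: o_def)
  show "((\<lambda>t. - w (- t)) has_vector_derivative (a (- t) * m - 1) *\<^sub>R z (- t) + F (- t)) (at t within {-T..T})"
    using has_vector_derivative_minus[OF vector_diff_chain_within[OF d, of w "(a (- t) * m - 1) *\<^sub>R z (- t) + F (- t)"]] sol im
    by (simp add: o_def add.commute)
qed

lemma growth_rate_reverse:
  assumes "growth_rate {-T..T} g m a \<gamma>"
  shows "growth_rate {-T..T} g m (\<lambda>t. a (- t)) \<gamma>"
proof -
  obtain b L where L: "0 \<le> L"
    and b: "\<And>t. t \<in> {-T..T} \<Longrightarrow> 0 \<le> b t \<and> b t * m \<le> 1/2 \<and> 2 * (\<bar>a t - b t\<bar> * (m * sqrt g) + L * m) \<le> \<gamma>"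
    and lip: "\<And>s t. s \<in> {-T..T} \<Longrightarrow> t \<in> {-T..T} \<Longrightarrow> \<bar>b s - b t\<bar> \<le> L * \<bar>s - t\<bar>"
    using assms unfolding growth_rate_def by blast
  have "\<bar>b (- s) - b (- t)\<bar> \<le> L * \<bar>s - t\<bar>" if "s \<in> {-T..T}" "t \<in> {-T..T}" for s t
    using lip[of "- s" "- t"] that by (simp add: abs_minus_commute)
  moreover have "0 \<le> b (- t) \<and> b (- t) * m \<le> 1/2 \<and> 2 * (\<bar>a (- t) - b (- t)\<bar> * (m * sqrt g) + L * m) \<le> \<gamma>"
    if "t \<in> {-T..T}" for t
    using b[of "- t"] that by simp
  ultimately show ?thesis unfolding growth_rate_def using L
    by (intro exI[of _ "\<lambda>t. b (- t)"] exI[of _ L]) auto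
qed

lemma mode_energy:
  fixes z w F :: "real \<Rightarrow> 'a::real_inner"
  assumes t: "t \<in> {-T..T}" and g: "0 \<le> g" and m: "0 \<le> m"
    and sol: "mode_solution {-T..T} g m a F z w" and rate: "growth_rate {-T..T} g m a \<gamma>"
    and source: "\<And>s. s \<in> {-T..T} \<Longrightarrow>
      2 * g * \<bar>F s \<bullet> w s\<bar> \<le> \<kappa> * (g * (norm (w s))\<^sup>2) + \<beta> * exp (2 * \<rho> * \<bar>s\<bar>)"
    and \<kappa>: "0 \<le> \<kappa>" and \<beta>: "0 \<le> \<beta>" and \<rho>: "\<gamma> + \<kappa> < 2 * \<rho>"
  shows "energy g (z t) (w t) \<le> 2 * exp ((\<gamma> + \<kappa>) * \<bar>t\<bar>) * energy g (z 0) (w 0)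
      + 2 * \<beta> * exp (2 * \<rho> * \<bar>t\<bar>) / (2 * \<rho> - \<gamma> - \<kappa>)"
proof (cases "0 \<le> t")
  case True
  have sub: "{0..t} \<subseteq> {-T..T}" using t by auto
  have "2 * g * (F s \<bullet> w s) \<le> \<kappa> * (g * (norm (w s))\<^sup>2) + \<beta> * exp (2 * \<rho> * s)" if "s \<in> {0..t}" for s
  proof -
    have "2 * g * (F s \<bullet> w s) \<le> 2 * g * \<bar>F s \<bullet> w s\<bar>"
      using g by (intro mult_left_mono) auto
    then show ?thesis using source[of s] that sub by force
  qed
  then show ?thesis
    using mode_energy_forward[OF True g m mode_solution_subset[OF sol sub]
        growth_rate_subset[OF rate sub] _ \<kappa> \<beta> \<rho>] True by simp
next
  case False
  define u where "u = - t"
  have u: "0 \<le> u" using False by (simp add: u_def)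
  have sub: "{0..u} \<subseteq> {-T..T}" using t False by (auto simp: u_def)
  have src: "2 * g * (F (- s) \<bullet> - w (- s)) \<le> \<kappa> * (g * (norm (- w (- s)))\<^sup>2) + \<beta> * exp (2 * \<rho> * s)"
    if "s \<in> {0..u}" for s
  proof -
    have "2 * g * (F (- s) \<bullet> - w (- s)) \<le> 2 * g * \<bar>F (- s) \<bullet> w (- s)\<bar>"
      using g by (intro mult_left_mono) auto
    then show ?thesis using source[of "- s"] that sub by force
  qed
  have "energy g (z (- u)) (- w (- u)) \<le> 2 * exp ((\<gamma> + \<kappa>) * u) * energy g (z (- 0)) (- w (- 0))
      + 2 * \<beta> * exp (2 * \<rho> * u) / (2 * \<rho> - \<gamma> - \<kappa>)"
    by (rule mode_energy_forward[OF u g m mode_solution_subset[OF mode_solution_reverse[OF sol] sub]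
        growth_rate_subset[OF growth_rate_reverse[OF rate] sub] src \<kappa> \<beta> \<rho>])
  then show ?thesis using False by (simp add: u_def energy_def)
qed

lemma free_mode_energy:
  fixes z w :: "real \<Rightarrow> 'a::real_inner"
  assumes "t \<in> {-T..T}" "0 \<le> g" "0 \<le> m"
    and "mode_solution {-T..T} g m a (\<lambda>_. 0) z w" and "growth_rate {-T..T} g m a \<gamma>"
  shows "energy g (z t) (w t) \<le> 2 * exp (\<gamma> * \<bar>t\<bar>) * energy g (z 0) (w 0)"
  using mode_energy[OF assms, of 0 0 "\<bar>\<gamma>\<bar> + 1"] by simp

text \<open>
  The forcing is split off by \<open>2 F \<bullet> w \<le> |F|\<^sup>2 + |w|\<^sup>2\<close>, that is, \<open>\<kappa> = 1\<close>.
\<close>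

lemma forced_mode_energy:
  fixes z w F :: "real \<Rightarrow> 'a::real_inner"
  assumes t: "t \<in> {-T..T}" and g: "0 \<le> g" and m: "0 \<le> m"
    and sol: "mode_solution {-T..T} g m a F z w" and rate: "growth_rate {-T..T} g m a \<gamma>"
    and init: "z 0 = 0" "w 0 = 0"
    and F: "\<And>s. s \<in> {-T..T} \<Longrightarrow> g * (norm (F s))\<^sup>2 \<le> \<beta> * exp (2 * \<rho> * \<bar>s\<bar>)"
    and \<beta>: "0 \<le> \<beta>" and \<rho>: "\<gamma> + 1 < 2 * \<rho>"
  shows "energy g (z t) (w t) \<le> 2 * \<beta> * exp (2 * \<rho> * \<bar>t\<bar>) / (2 * \<rho> - \<gamma> - 1)"
proof -
  have src: "2 * g * \<bar>F s \<bullet> w s\<bar> \<le> 1 * (g * (norm (w s))\<^sup>2) + \<beta> * exp (2 * \<rho> * \<bar>s\<bar>)"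
    if s: "s \<in> {-T..T}" for s
  proof -
    have "2 * \<bar>F s \<bullet> w s\<bar> \<le> 2 * (norm (F s) * norm (w s))"
      using Cauchy_Schwarz_ineq2[of "F s" "w s"] by simp
    also have "\<dots> \<le> (norm (F s))\<^sup>2 + (norm (w s))\<^sup>2"
      using sum_squares_bound[of "norm (F s)" "norm (w s)"] by (simp add: mult.assoc)
    finally have "g * (2 * \<bar>F s \<bullet> w s\<bar>) \<le> g * ((norm (F s))\<^sup>2 + (norm (w s))\<^sup>2)"
      using g by (rule mult_left_mono)
    then show ?thesis using F[OF s] by (simp add: algebra_simps)
  qed
  show ?thesis using mode_energy[OF t g m sol rate src _ \<beta> \<rho>] init by (simp add: energy_def)
qed

text \<open>
  Two solutions with different coefficients \<open>a\<close> and \<open>b\<close> differ by a solution for \<open>a\<close> whose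
  forcing is proportional to \<open>a - b\<close>.
\<close>

lemma mode_solution_diff:
  assumes "mode_solution I g m a (\<lambda>_. 0) z w" "mode_solution I g m b (\<lambda>_. 0) z' w'"
  shows "mode_solution I g m a (\<lambda>t. ((a t - b t) * m) *\<^sub>R z' t) (\<lambda>t. z t - z' t) (\<lambda>t. w t - w' t)"
  unfolding mode_solution_def
proof (intro ballI conjI)
  fix t assume t: "t \<in> I"
  note 1 = assms(1)[unfolded mode_solution_def, rule_format, OF t]
  note 2 = assms(2)[unfolded mode_solution_def, rule_format, OF t]
  show "((\<lambda>t. z t - z' t) has_vector_derivative g *\<^sub>R (w t - w' t)) (at t within I)"
    using has_vector_derivative_diff[OF conjunct1[OF 1] conjunct1[OF 2]]
    by (simp add: scaleR_diff_right)
  have "(a t * m - 1) *\<^sub>R (z t - z' t) + ((a t - b t) * m) *\<^sub>R z' t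
      = (a t * m - 1) *\<^sub>R z t - (b t * m - 1) *\<^sub>R z' t"
    by (simp add: algebra_simps)
  then show "((\<lambda>t. w t - w' t) has_vector_derivative (a t * m - 1) *\<^sub>R (z t - z' t)
      + ((a t - b t) * m) *\<^sub>R z' t) (at t within I)"
    using has_vector_derivative_diff[OF conjunct2[OF 1] conjunct2[OF 2]]
    by simp
qed

text \<open>
  For \<open>g = 0\<close>, the zero mode, the energy does not see \<open>w\<close>; but then \<open>w\<close> is determined by \<open>z\<close>.
\<close>

lemma mode_solution_unique:
  fixes z w z' w' :: "real \<Rightarrow> 'a::real_inner"
  assumes sol: "mode_solution {-T..T} g m a (\<lambda>_. 0) z w" "mode_solution {-T..T} g m a (\<lambda>_. 0) z' w'"
    and g: "0 \<le> g" and m: "0 \<le> m" and a: "\<And>t. t \<in> {-T..T} \<Longrightarrow> \<bar>a t\<bar> \<le> A"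
    and init: "z 0 = z' 0" "w 0 = w' 0" and t: "t \<in> {-T..T}"
  shows "z t = z' t \<and> w t = w' t"
proof -
  have d: "mode_solution {-T..T} g m a (\<lambda>_. 0) (\<lambda>t. z t - z' t) (\<lambda>t. w t - w' t)"
    using mode_solution_diff[OF sol] by simp
  have rate: "growth_rate {-T..T} g m a (2 * (A * (m * sqrt g)))"
    unfolding growth_rate_def
    by (intro exI[of _ "\<lambda>_. 0"] exI[of _ 0]) (use a m g in \<open>auto intro!: mult_right_mono\<close>)
  have en: "energy g (z s - z' s) (w s - w' s) \<le> 0" if "s \<in> {-T..T}" for s
    using free_mode_energy[OF that g m d rate] init by (simp add: energy_def)
  have zz: "z s = z' s" if "s \<in> {-T..T}" for s
  proof -
    have "(norm (z s - z' s))\<^sup>2 \<le> 0"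
      using en[OF that] g unfolding energy_def
      by (smt (verit) mult_nonneg_nonneg zero_le_power2)
    then show ?thesis by simp
  qed
  have ww: "w t - w' t = w 0 - w' 0"
  proof (rule has_vector_derivative_zero_constant)
    fix s assume s: "s \<in> {-T..T}"
    show "((\<lambda>t. w t - w' t) has_vector_derivative 0) (at s within {-T..T})"
      using d s zz[OF s] unfolding mode_solution_def by fastforce
  qed (use t in \<open>auto simp: convex_real_interval\<close>)
  then show ?thesis using zz[OF t] init by simp
qed

section \<open>Linear differential equations\<close>

lemma exp_growth_bound_forward:
  fixes f :: "real \<Rightarrow> 'b::real_normed_vector"
  assumes t: "0 \<le> t" and \<rho>: "0 < \<rho>" and f0: "f 0 = 0" and B: "0 \<le> B"
    and f: "\<And>s. s \<in> {0..t} \<Longrightarrow> (f has_vector_derivative f' s) (at s within {0..t})"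
    and f': "\<And>s. s \<in> {0..t} \<Longrightarrow> norm (f' s) \<le> B * exp (\<rho> * s)"
  shows "norm (f t) \<le> B / \<rho> * exp (\<rho> * t)"
proof (cases "t = 0")
  case False
  then have t: "0 < t" using t by simp
  define \<phi> where "\<phi> s = B / \<rho> * exp (\<rho> * s)" for s
  have "norm (f t - f 0) \<le> \<phi> t - \<phi> 0"
  proof (rule differentiable_bound_general[OF t])
    show "continuous_on {0..t} f"
      by (rule continuous_on_vector_derivative[OF f])
    show "continuous_on {0..t} \<phi>" unfolding \<phi>_def by (intro continuous_intros)
    fix s assume s: "0 < s" "s < t"
    show "(f has_vector_derivative f' s) (at s)"
      using f[of s] s by (simp add: at_within_Icc_at)
    have "(\<phi> has_real_derivative B * exp (\<rho> * s)) (at s)"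
      unfolding \<phi>_def using \<rho> by (auto intro!: derivative_eq_intros)
    then show "(\<phi> has_vector_derivative B * exp (\<rho> * s)) (at s)"
      by (simp add: has_real_derivative_iff_has_vector_derivative)
    show "norm (f' s) \<le> B * exp (\<rho> * s)" using f'[of s] s by simp
  qed
  moreover have "0 \<le> \<phi> 0" using B \<rho> by (simp add: \<phi>_def)
  ultimately show ?thesis using f0 by (simp add: \<phi>_def)
qed (use f0 B \<rho> in simp)

lemma exp_growth_bound:
  fixes f :: "real \<Rightarrow> 'b::real_normed_vector"
  assumes t: "t \<in> {-T..T}" and \<rho>: "0 < \<rho>" and f0: "f 0 = 0" and B: "0 \<le> B"
    and f: "\<And>s. s \<in> {-T..T} \<Longrightarrow> (f has_vector_derivative f' s) (at s within {-T..T})"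
    and f': "\<And>s. s \<in> {-T..T} \<Longrightarrow> norm (f' s) \<le> B * exp (\<rho> * \<bar>s\<bar>)"
  shows "norm (f t) \<le> B / \<rho> * exp (\<rho> * \<bar>t\<bar>)"
proof (cases "0 \<le> t")
  case True
  have sub: "{0..t} \<subseteq> {-T..T}" using t by auto
  show ?thesis
  proof -
    have "norm (f t) \<le> B / \<rho> * exp (\<rho> * t)"
    proof (rule exp_growth_bound_forward[OF True \<rho> _ B, where f = f and f' = f'])
      fix s assume "s \<in> {0..t}"
      then have "s \<in> {-T..T}" "0 \<le> s" using sub by auto
      then show "(f has_vector_derivative f' s) (at s within {0..t})" "norm (f' s) \<le> B * exp (\<rho> * s)"
        using has_vector_derivative_within_subset[OF f sub] f'[of s] by auto
    qed (rule f0)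
    then show ?thesis using True by simp
  qed
next
  case False
  define u where "u = - t"
  have u: "0 \<le> u" using False by (simp add: u_def)
  have sub: "{0..u} \<subseteq> {-T..T}" using t False by (auto simp: u_def)
  have "norm (f (- u)) \<le> B / \<rho> * exp (\<rho> * u)"
  proof (rule exp_growth_bound_forward[OF u \<rho> _ B, of "\<lambda>s. f (- s)" "\<lambda>s. - f' (- s)"])
    fix s assume s: "s \<in> {0..u}"
    have im: "uminus ` {-T..T} = {-T..T}" by simp
    have d: "(uminus has_vector_derivative -1) (at s within {-T..T})"
      by (auto intro!: derivative_eq_intros)
    have "- s \<in> {-T..T}" using s sub by auto
    then have "((\<lambda>s. f (- s)) has_vector_derivative - f' (- s)) (at s within {-T..T})"
      using vector_diff_chain_within[OF d, of f "f' (- s)"] f im by (simp add: o_def)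
    then show "((\<lambda>s. f (- s)) has_vector_derivative - f' (- s)) (at s within {0..u})"
      by (rule has_vector_derivative_within_subset[OF _ sub])
    show "norm (- f' (- s)) \<le> B * exp (\<rho> * s)"
      using f'[of "- s"] s sub by auto
  qed (use f0 in simp)
  then show ?thesis using False by (simp add: u_def)
qed

text \<open>
  Picard iteration, organised as a series of successive corrections. Measured with the weight
  \<open>exp(2 K |t|)\<close>, each correction is at most half of the previous one, so the series and its derivative
  converge uniformly on the whole interval.
\<close>

lemma linear_ode_exists:
  fixes A :: "real \<Rightarrow> 'b \<Rightarrow> 'b::euclidean_space"
  assumes T: "0 \<le> T" and lin: "\<And>t. t \<in> {-T..T} \<Longrightarrow> linear (A t)"
    and cont: "\<And>y. continuous_on {-T..T} y \<Longrightarrow> continuous_on {-T..T} (\<lambda>t. A t (y t))"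
    and K: "0 < K" and bound: "\<And>t x. t \<in> {-T..T} \<Longrightarrow> norm (A t x) \<le> K * norm x"
  shows "\<exists>y. y 0 = y0 \<and> (\<forall>t\<in>{-T..T}. (y has_vector_derivative A t (y t)) (at t within {-T..T}))"
proof -
  let ?I = "{-T..T}"
  have zero: "0 \<in> ?I" using T by simp
  define Y where "Y = rec_nat (\<lambda>t. y0) (\<lambda>n y t. LBINT s=0..t. A s (y s))"
  have Y0: "Y 0 = (\<lambda>t. y0)" and YS: "Y (Suc n) = (\<lambda>t. LBINT s=0..t. A s (Y n s))" for n
    by (simp_all add: Y_def)
  have step: "(Y (Suc n) has_vector_derivative A t (Y n t)) (at t within ?I)"
    if c: "continuous_on ?I (Y n)" and t: "t \<in> ?I" for n t
    unfolding YS zero_ereal_def using interval_integral_FTC2[of "-T" 0 T "\<lambda>s. A s (Y n s)" t] T t cont[OF c]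
    by simp
  have Yc: "continuous_on ?I (Y n)" for n
  proof (induction n)
    case (Suc n)
    show ?case by (rule continuous_on_vector_derivative) (rule step[OF Suc])
  qed (simp add: Y0)
  have YS0: "Y (Suc n) 0 = 0" for n by (simp add: YS zero_ereal_def[symmetric])
  define \<rho> where "\<rho> = 2 * K"
  have \<rho>: "0 < \<rho>" using K by (simp add: \<rho>_def)
  have Yb: "norm (Y n t) \<le> norm y0 * (1/2)^n * exp (\<rho> * \<bar>t\<bar>)" if "t \<in> ?I" for n t
    using that
  proof (induction n arbitrary: t)
    case 0
    have "norm y0 * 1 \<le> norm y0 * exp (\<rho> * \<bar>t\<bar>)" using \<rho> by (intro mult_left_mono) auto
    then show ?case by (simp add: Y0)
  next
    case (Suc n)
    have "norm (Y (Suc n) t) \<le> (K * (norm y0 * (1/2)^n)) / \<rho> * exp (\<rho> * \<bar>t\<bar>)"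
    proof (rule exp_growth_bound[OF Suc.prems \<rho> YS0 _ step[OF Yc]])
      fix s assume s: "s \<in> ?I"
      have "norm (A s (Y n s)) \<le> K * norm (Y n s)" by (rule bound[OF s])
      also have "\<dots> \<le> K * (norm y0 * (1/2)^n * exp (\<rho> * \<bar>s\<bar>))"
        using K Suc.IH[OF s] by (intro mult_left_mono) auto
      finally show "norm (A s (Y n s)) \<le> K * (norm y0 * (1/2)^n) * exp (\<rho> * \<bar>s\<bar>)"
        by (simp add: mult_ac)
    qed (use K in auto)
    then show ?case using K by (simp add: \<rho>_def)
  qed
  define S where "S t = (\<Sum>n. Y n t)" for t
  define C where "C = norm y0 * exp (\<rho> * T)"
  have YC: "norm (Y n t) \<le> C * (1/2)^n" if t: "t \<in> ?I" for n t
  proof -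
    have "norm y0 * (1/2)^n * exp (\<rho> * \<bar>t\<bar>) \<le> norm y0 * (1/2)^n * exp (\<rho> * T)"
      using t \<rho> by (intro mult_left_mono) auto
    then show ?thesis using Yb[OF t, of n] by (simp add: C_def mult_ac)
  qed
  have geo: "summable (\<lambda>n. C * (1/2::real)^n)" by (intro summable_mult summable_geometric) simp
  have unif: "uniform_limit ?I (\<lambda>n t. \<Sum>i<n. Y i t) S sequentially"
    unfolding S_def by (rule Weierstrass_m_test[OF _ geo]) (use YC in auto)
  have sums: "(\<lambda>n. Y n t) sums S t" if "t \<in> ?I" for t
    unfolding S_def using summable_comparison_test'[OF geo YC[OF that]] by (simp add: summable_sums)
  define Y' where "Y' n t = (case n of 0 \<Rightarrow> 0 | Suc k \<Rightarrow> A t (Y k t))" for n t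
  have "\<exists>g. \<forall>t\<in>?I. (\<lambda>n. Y n t) sums g t \<and> (g has_derivative (\<lambda>h. h *\<^sub>R A t (S t))) (at t within ?I)"
  proof (rule has_derivative_series[where f' = "\<lambda>n t h. h *\<^sub>R Y' n t" and x = 0 and l = "S 0"])
    show "0 \<in> ?I" "(\<lambda>n. Y n 0) sums S 0" using zero sums[OF zero] by auto
    show "convex ?I" by (rule convex_real_interval)
    show "(Y n has_derivative (\<lambda>h. h *\<^sub>R Y' n t)) (at t within ?I)" if "t \<in> ?I" for n t
      using step[OF Yc that] unfolding has_vector_derivative_def Y'_def by (cases n) (auto simp: Y0)
    fix e :: real assume e: "0 < e"
    have "\<forall>\<^sub>F n in sequentially. \<forall>t\<in>?I. dist (\<Sum>i<n. Y i t) (S t) < e / K"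
      using unif e K unfolding uniform_limit_iff by simp
    then have "\<forall>\<^sub>F n in sequentially. \<forall>t\<in>?I. \<forall>h. norm ((\<Sum>i<Suc n. h *\<^sub>R Y' i t) - h *\<^sub>R A t (S t)) \<le> e * norm h"
    proof (eventually_elim, intro ballI allI)
      fix n t and h :: real assume n: "\<forall>t\<in>?I. dist (\<Sum>i<n. Y i t) (S t) < e / K" and t: "t \<in> ?I"
      have "(\<Sum>i<Suc n. h *\<^sub>R Y' i t) = h *\<^sub>R (\<Sum>i<n. A t (Y i t))"
        by (subst sum.lessThan_Suc_shift) (simp add: Y'_def scaleR_sum_right)
      also have "\<dots> = h *\<^sub>R A t (\<Sum>i<n. Y i t)" by (simp add: linear_sum[OF lin[OF t]])
      finally have "norm ((\<Sum>i<Suc n. h *\<^sub>R Y' i t) - h *\<^sub>R A t (S t)) =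
          \<bar>h\<bar> * norm (A t ((\<Sum>i<n. Y i t) - S t))"
        by (simp add: linear_diff[OF lin[OF t]] scaleR_diff_right[symmetric])
      also have "\<dots> \<le> \<bar>h\<bar> * (K * (e / K))"
      proof (intro mult_left_mono order.trans[OF bound[OF t]])
        show "norm ((\<Sum>i<n. Y i t) - S t) \<le> e / K" using n t by (simp add: dist_norm less_imp_le)
      qed (use K in auto)
      finally show "norm ((\<Sum>i<Suc n. h *\<^sub>R Y' i t) - h *\<^sub>R A t (S t)) \<le> e * norm h"
        using K by (simp add: mult_ac)
    qed
    then show "\<forall>\<^sub>F n in sequentially. \<forall>t\<in>?I. \<forall>h. norm ((\<Sum>i<n. h *\<^sub>R Y' i t) - h *\<^sub>R A t (S t)) \<le> e * norm h"
      by (subst (asm) eventually_sequentially_Suc)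
  qed
  then obtain g where g: "\<And>t. t \<in> ?I \<Longrightarrow> (\<lambda>n. Y n t) sums g t"
    "\<And>t. t \<in> ?I \<Longrightarrow> (g has_vector_derivative A t (S t)) (at t within ?I)"
    unfolding has_vector_derivative_def by blast
  have gS: "g t = S t" if "t \<in> ?I" for t using sums_unique2[OF g(1) sums] that by blast
  have "(\<lambda>n. Y n 0) sums (\<Sum>n\<in>{0}. Y n 0)"
    by (rule sums_finite) (use YS0 not0_implies_Suc in auto)
  then have "g 0 = y0" using sums_unique2[OF g(1)[OF zero]] by (simp add: Y0)
  then show ?thesis using g(2) gS by (intro exI[of _ g]) auto
qed

lemma mode_solution_exists:
  fixes z0 w0 :: "'a::euclidean_space"
  assumes T: "0 \<le> T" and a: "continuous_on {-T..T} a"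
  shows "\<exists>z w. z 0 = z0 \<and> w 0 = w0 \<and> mode_solution {-T..T} g m a (\<lambda>_. 0) z w"
proof -
  let ?I = "{-T..T}"
  define A where "A t y = (g *\<^sub>R snd y, (a t * m - 1) *\<^sub>R fst y)" for t and y :: "'a \<times> 'a"
  have "continuous_on ?I (\<lambda>t. a t * m - 1)" by (intro continuous_intros a)
  then have "bounded ((\<lambda>t. a t * m - 1) ` ?I)"
    by (intro compact_imp_bounded compact_continuous_image) auto
  then obtain B where B0: "0 < B" and "\<forall>x\<in>(\<lambda>t. a t * m - 1) ` ?I. norm x \<le> B"
    unfolding bounded_pos by blast
  then have B: "\<bar>a t * m - 1\<bar> \<le> B" if "t \<in> ?I" for t using that by auto
  have "\<exists>y. y 0 = (z0, w0) \<and> (\<forall>t\<in>?I. (y has_vector_derivative A t (y t)) (at t within ?I))"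
  proof (rule linear_ode_exists[OF T, where K = "\<bar>g\<bar> + B"])
    show "linear (A t)" for t
      unfolding A_def by (intro linearI) (auto simp: algebra_simps)
    show "continuous_on ?I (\<lambda>t. A t (y t))" if "continuous_on ?I y" for y
      unfolding A_def by (intro continuous_intros a that)
    show "0 < \<bar>g\<bar> + B" using B0 by linarith
    fix t and x :: "'a \<times> 'a" assume t: "t \<in> ?I"
    have "norm (A t x) \<le> norm (g *\<^sub>R snd x) + norm ((a t * m - 1) *\<^sub>R fst x)"
      unfolding A_def by (rule norm_Pair_le)
    also have "\<dots> \<le> \<bar>g\<bar> * norm x + B * norm x"
      unfolding norm_scaleR using B[OF t] B0 norm_fst_le[of "fst x" "snd x"] norm_snd_le[of "snd x" "fst x"]
      by (intro add_mono mult_mono) auto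
    finally show "norm (A t x) \<le> (\<bar>g\<bar> + B) * norm x" by (simp add: algebra_simps)
  qed
  then obtain y where y: "y 0 = (z0, w0)"
    "\<And>t. t \<in> ?I \<Longrightarrow> (y has_vector_derivative A t (y t)) (at t within ?I)" by blast
  have "mode_solution ?I g m a (\<lambda>_. 0) (\<lambda>t. fst (y t)) (\<lambda>t. snd (y t))"
    unfolding mode_solution_def
    using bounded_linear.has_vector_derivative[OF bounded_linear_fst y(2)]
      bounded_linear.has_vector_derivative[OF bounded_linear_snd y(2)]
    by (simp add: A_def)
  then show ?thesis using y(1)
    by (intro exI[of _ "\<lambda>t. fst (y t)"] exI[of _ "\<lambda>t. snd (y t)"]) auto
qed

section \<open>Oscillators coupled through a scalar\<close>

lemma infsum_diff_le:
  fixes f h M :: "'k \<Rightarrow> real"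
  assumes "f summable_on UNIV" "h summable_on UNIV" "M summable_on UNIV"
    and le: "\<And>k. \<bar>f k - h k\<bar> \<le> c * M k"
  shows "\<bar>infsum f UNIV - infsum h UNIV\<bar> \<le> c * infsum M UNIV"
proof -
  have eq: "infsum f UNIV - infsum h UNIV = (\<Sum>\<^sub>\<infinity>k. f k - h k)"
    using infsum_add[OF assms(1) summable_on_uminus[THEN iffD2, OF assms(2)]] by (simp add: infsum_uminus)
  have d: "(\<lambda>k. f k - h k) summable_on UNIV"
    using summable_on_add[OF assms(1) summable_on_uminus[THEN iffD2, OF assms(2)]] by simp
  have c: "(\<lambda>k. c * M k) summable_on UNIV" "infsum (\<lambda>k. c * M k) UNIV = c * infsum M UNIV"
    using assms(3) by (auto intro: summable_on_cmult_right infsum_cmult_right)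
  have "(\<Sum>\<^sub>\<infinity>k. f k - h k) \<le> c * infsum M UNIV"
    unfolding c(2)[symmetric] by (intro infsum_mono d c) (use le in \<open>auto simp: abs_le_iff\<close>)
  moreover have "(\<Sum>\<^sub>\<infinity>k. - (f k - h k)) \<le> c * infsum M UNIV"
    unfolding c(2)[symmetric]
    by (intro infsum_mono c summable_on_uminus[THEN iffD2, OF d]) (use le in \<open>auto simp: abs_le_iff\<close>)
  ultimately show ?thesis unfolding eq infsum_uminus by (simp add: abs_le_iff)
qed

text \<open>
  The index \<open>k\<close> stands for the wave vector. The sum of \<open>P k\<close> times the initial energies must be finite for the
  feedback to depend in a Lipschitz way on \<open>a\<close>; the hypothesis on \<open>\<Lambda>\<close> says how strong the weight
  \<open>P\<close> must be compared with the coupling. The bound \<open>\<gamma>\<close> on the growth rates is a parameter,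
  because existence needs an explicit rate and uniqueness any rate.
\<close>

locale oscillators =
  fixes g m P :: "'k \<Rightarrow> real" and D \<Lambda> T \<gamma> :: real and z0 w0 :: "'k \<Rightarrow> 'a::euclidean_space"
  assumes g: "0 \<le> g k" and m: "0 \<le> m k" and D: "0 \<le> D" and T: "0 \<le> T" and \<Lambda>: "0 \<le> \<Lambda>" and \<gamma>: "0 \<le> \<gamma>"
    and gP: "g k \<le> P k" and \<Lambda>P: "g k * (m k * sqrt (g k)) \<le> \<Lambda> * P k"
    and sumP: "(\<lambda>k. P k * energy (g k) (z0 k) (w0 k)) summable_on UNIV"
begin

abbreviation "I \<equiv> {-T..T}"

abbreviation "e0 k \<equiv> energy (g k) (z0 k) (w0 k)"

definition feedback :: "('k \<Rightarrow> real \<Rightarrow> 'a) \<Rightarrow> real \<Rightarrow> real" where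
  "feedback w t = D * (\<Sum>\<^sub>\<infinity>k. (g k * norm (w k t))\<^sup>2)"

definition flow :: "(real \<Rightarrow> real) \<Rightarrow> ('k \<Rightarrow> real \<Rightarrow> 'a) \<Rightarrow> ('k \<Rightarrow> real \<Rightarrow> 'a) \<Rightarrow> bool" where
  "flow a z w \<longleftrightarrow> (\<forall>k. growth_rate I (g k) (m k) a \<gamma> \<and>
     mode_solution I (g k) (m k) a (\<lambda>_. 0) (z k) (w k) \<and> z k 0 = z0 k \<and> w k 0 = w0 k)"

lemma e0_nonneg: "0 \<le> e0 k" by (rule energy_nonneg[OF g])

lemma P_nonneg: "0 \<le> P k" using g gP by (rule order.trans)

lemma flow_energy:
  assumes "flow a z w" "t \<in> I"
  shows "energy (g k) (z k t) (w k t) \<le> 2 * exp (\<gamma> * T) * e0 k"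
proof -
  have "energy (g k) (z k t) (w k t) \<le> 2 * exp (\<gamma> * \<bar>t\<bar>) * e0 k"
    using free_mode_energy[OF assms(2) g m, of k k a "z k" "w k" \<gamma>] assms(1) by (auto simp: flow_def)
  also have "\<dots> \<le> 2 * exp (\<gamma> * T) * e0 k"
    using assms(2) \<gamma> e0_nonneg by (intro mult_right_mono mult_left_mono) (auto intro!: mult_left_mono)
  finally show ?thesis .
qed

lemma weight_le:
  assumes "flow a z w" "t \<in> I"
  shows "(g k * norm (w k t))\<^sup>2 \<le> 2 * exp (\<gamma> * T) * (g k * e0 k)"
proof -
  have "(g k * norm (w k t))\<^sup>2 = g k * (g k * (norm (w k t))\<^sup>2)" by (simp add: power2_eq_square)
  also have "\<dots> \<le> g k * energy (g k) (z k t) (w k t)"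
    by (intro mult_left_mono g) (simp add: energy_def)
  also have "\<dots> \<le> g k * (2 * exp (\<gamma> * T) * e0 k)"
    by (intro mult_left_mono g flow_energy[OF assms])
  finally show ?thesis by (simp add: mult_ac)
qed

lemma sum_g: "(\<lambda>k. g k * e0 k) summable_on UNIV"
  by (rule summable_on_comparison_test[OF sumP]) (use g gP e0_nonneg in \<open>auto intro!: mult_right_mono\<close>)

lemma sum_feedback:
  assumes "flow a z w" "t \<in> I"
  shows "(\<lambda>k. (g k * norm (w k t))\<^sup>2) summable_on UNIV"
  by (rule summable_on_comparison_test[OF summable_on_cmult_right[OF sum_g, of "2 * exp (\<gamma> * T)"]])
     (use weight_le[OF assms] in auto)

lemma feedback_bounds:
  assumes "flow a z w" "t \<in> I"
  shows "0 \<le> feedback w t" "feedback w t \<le> D * (2 * exp (\<gamma> * T) * (\<Sum>\<^sub>\<infinity>k. g k * e0 k))"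
proof -
  show "0 \<le> feedback w t" unfolding feedback_def by (intro mult_nonneg_nonneg D infsum_nonneg) simp
  have "(\<Sum>\<^sub>\<infinity>k. (g k * norm (w k t))\<^sup>2) \<le> (\<Sum>\<^sub>\<infinity>k. 2 * exp (\<gamma> * T) * (g k * e0 k))"
    by (intro infsum_mono sum_feedback[OF assms] weight_le[OF assms] summable_on_cmult_right sum_g)
  also have "\<dots> = 2 * exp (\<gamma> * T) * (\<Sum>\<^sub>\<infinity>k. g k * e0 k)"
    by (rule infsum_cmult_right) (rule sum_g)
  finally show "feedback w t \<le> D * (2 * exp (\<gamma> * T) * (\<Sum>\<^sub>\<infinity>k. g k * e0 k))"
    unfolding feedback_def by (rule mult_left_mono[OF _ D])
qed

lemma feedback_continuous:
  assumes f: "flow a z w"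
  shows "continuous_on I (feedback w)"
proof -
  have "uniform_limit I (\<lambda>X t. \<Sum>k\<in>X. (g k * norm (w k t))\<^sup>2) (\<lambda>t. \<Sum>\<^sub>\<infinity>k. (g k * norm (w k t))\<^sup>2) (finite_subsets_at_top UNIV)"
    by (rule Weierstrass_m_test_general[OF _ summable_on_cmult_right[OF sum_g, of "2 * exp (\<gamma> * T)"]])
       (use weight_le[OF f] in auto)
  moreover have "continuous_on I (w k)" for k
    by (rule continuous_on_vector_derivative[where f' = "\<lambda>t. (a t * m k - 1) *\<^sub>R z k t"])
      (use f in \<open>auto simp: flow_def mode_solution_def\<close>)
  then have "continuous_on I (\<lambda>t. \<Sum>k\<in>X. (g k * norm (w k t))\<^sup>2)" for X
    by (intro continuous_on_sum continuous_on_power continuous_on_mult continuous_on_const continuous_on_norm)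
  ultimately have "continuous_on I (\<lambda>t. \<Sum>\<^sub>\<infinity>k. (g k * norm (w k t))\<^sup>2)"
    by (intro uniform_limit_theorem[OF always_eventually]) auto
  then show ?thesis unfolding feedback_def[abs_def] by (rule continuous_on_mult_left)
qed

text \<open>
  Each term of the feedback has a derivative of size \<open>g\<^sup>3\<^sup>/\<^sup>2\<close> times the energy, by the
  arithmetic-geometric mean inequality. Only finite sums are differentiated; the bound passes to the limit.
\<close>

lemma feedback_lipschitz:
  assumes sol: "\<And>k. mode_solution I (g k) (m k) a (\<lambda>_. 0) (z k) (w k)"
    and sum: "\<And>t. t \<in> I \<Longrightarrow> (\<lambda>k. (g k * norm (w k t))\<^sup>2) summable_on UNIV"
    and B: "\<And>k t. t \<in> I \<Longrightarrow> \<bar>a t * m k - 1\<bar> \<le> B"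
    and R: "\<And>X t. finite X \<Longrightarrow> t \<in> I \<Longrightarrow> (\<Sum>k\<in>X. g k * sqrt (g k) * energy (g k) (z k t) (w k t)) \<le> R"
    and s: "s \<in> I" and t: "t \<in> I"
  shows "\<bar>feedback w s - feedback w t\<bar> \<le> D * (B * R) * \<bar>s - t\<bar>"
proof -
  define f where "f k t = (g k * norm (w k t))\<^sup>2" for k t
  define f' where "f' k t = 2 * (g k)\<^sup>2 * ((a t * m k - 1) * (z k t \<bullet> w k t))" for k t
  have B0: "0 \<le> B" using B[OF t] by (meson abs_ge_zero order.trans)
  have df: "(f k has_real_derivative f' k t) (at t within I)" if t: "t \<in> I" for k t
  proof -
    have w: "(w k has_vector_derivative (a t * m k - 1) *\<^sub>R z k t) (at t within I)"
      using sol[of k] t by (auto simp: mode_solution_def)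
    have "((\<lambda>t. (g k)\<^sup>2 * (w k t \<bullet> w k t)) has_real_derivative
        (g k)\<^sup>2 * (w k t \<bullet> ((a t * m k - 1) *\<^sub>R z k t) + ((a t * m k - 1) *\<^sub>R z k t) \<bullet> w k t)) (at t within I)"
      using bounded_bilinear.has_vector_derivative[OF bounded_bilinear_inner w w]
      by (intro DERIV_cmult) (simp add: has_real_derivative_iff_has_vector_derivative)
    moreover have "f k = (\<lambda>t. (g k)\<^sup>2 * (w k t \<bullet> w k t))"
      by (simp add: fun_eq_iff f_def power_mult_distrib power2_norm_eq_inner)
    ultimately show ?thesis by (simp add: f'_def inner_commute algebra_simps)
  qed
  have f'_le: "\<bar>f' k t\<bar> \<le> B * (g k * sqrt (g k) * energy (g k) (z k t) (w k t))" if t: "t \<in> I" for k t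
  proof -
    have "2 * (norm (z k t) * (sqrt (g k) * norm (w k t))) \<le> energy (g k) (z k t) (w k t)"
      using sum_squares_bound[of "norm (z k t)" "sqrt (g k) * norm (w k t)"] g[of k]
      by (simp add: energy_def power_mult_distrib mult.assoc)
    then have "2 * (sqrt (g k) * \<bar>z k t \<bullet> w k t\<bar>) \<le> energy (g k) (z k t) (w k t)"
      using mult_left_mono[OF Cauchy_Schwarz_ineq2[of "z k t" "w k t"], of "sqrt (g k)"] g[of k]
      by (simp add: mult_ac)
    then have "g k * sqrt (g k) * (2 * (sqrt (g k) * \<bar>z k t \<bullet> w k t\<bar>)) \<le> g k * sqrt (g k) * energy (g k) (z k t) (w k t)"
      by (rule mult_left_mono) (simp add: g)
    moreover have "g k * sqrt (g k) * (2 * (sqrt (g k) * \<bar>z k t \<bullet> w k t\<bar>)) = 2 * (g k)\<^sup>2 * \<bar>z k t \<bullet> w k t\<bar>"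
      using g[of k] by (simp add: power2_eq_square)
    ultimately have le: "2 * (g k)\<^sup>2 * \<bar>z k t \<bullet> w k t\<bar> \<le> g k * sqrt (g k) * energy (g k) (z k t) (w k t)" by simp
    have "\<bar>f' k t\<bar> = \<bar>a t * m k - 1\<bar> * (2 * (g k)\<^sup>2 * \<bar>z k t \<bullet> w k t\<bar>)"
      by (simp add: f'_def abs_mult)
    also have "\<dots> \<le> B * (g k * sqrt (g k) * energy (g k) (z k t) (w k t))"
      by (rule mult_mono[OF B[OF t] le B0]) simp
    finally show ?thesis .
  qed
  have fin: "\<bar>sum (\<lambda>k. f k s) X - sum (\<lambda>k. f k t) X\<bar> \<le> B * R * \<bar>s - t\<bar>" if X: "finite X" for X
  proof -
    have "norm (sum (\<lambda>k. f k s) X - sum (\<lambda>k. f k t) X) \<le> B * R * norm (s - t)"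
    proof (rule field_differentiable_bound[where S = I and f' = "\<lambda>t. sum (\<lambda>k. f' k t) X"])
      fix u assume u: "u \<in> I"
      show "((\<lambda>t. sum (\<lambda>k. f k t) X) has_field_derivative sum (\<lambda>k. f' k u) X) (at u within I)"
        by (rule DERIV_sum) (rule df[OF u])
      have "norm (sum (\<lambda>k. f' k u) X) \<le> (\<Sum>k\<in>X. B * (g k * sqrt (g k) * energy (g k) (z k u) (w k u)))"
        using f'_le[OF u] by (intro sum_norm_le) auto
      also have "\<dots> \<le> B * R"
        unfolding sum_distrib_left[symmetric] by (intro mult_left_mono R X u B0)
      finally show "norm (sum (\<lambda>k. f' k u) X) \<le> B * R" .
    qed (use s t in auto)
    then show ?thesis by simp
  qed
  have lim: "((\<lambda>X. sum (\<lambda>k. f k u) X) \<longlongrightarrow> (\<Sum>\<^sub>\<infinity>k. f k u)) (finite_subsets_at_top UNIV)" if "u \<in> I" for u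
    using infsum_tendsto[OF sum[OF that]] by (simp add: f_def)
  have "\<bar>(\<Sum>\<^sub>\<infinity>k. f k s) - (\<Sum>\<^sub>\<infinity>k. f k t)\<bar> \<le> B * R * \<bar>s - t\<bar>"
  proof (rule tendsto_le[OF _ tendsto_const tendsto_rabs[OF tendsto_diff[OF lim[OF s] lim[OF t]]]])
    show "\<forall>\<^sub>F X in finite_subsets_at_top UNIV. \<bar>sum (\<lambda>k. f k s) X - sum (\<lambda>k. f k t) X\<bar> \<le> B * R * \<bar>s - t\<bar>"
      by (rule eventually_finite_subsets_at_top_weakI) (rule fin)
  qed simp
  then have "D * \<bar>(\<Sum>\<^sub>\<infinity>k. f k s) - (\<Sum>\<^sub>\<infinity>k. f k t)\<bar> \<le> D * (B * R * \<bar>s - t\<bar>)"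
    by (rule mult_left_mono[OF _ D])
  then show ?thesis
    using D by (simp add: feedback_def f_def right_diff_distrib[symmetric] abs_mult mult_ac)
qed

text \<open>
  If \<open>a - b\<close> is of size \<open>\<delta> exp(\<rho>|t|)\<close>, the forcing in the equation for the difference is of the same size,
  so \<open>\<surd>g (w - w')\<close> gains a factor \<open>1 / \<surd>\<nu>\<close> with \<open>\<nu> = 2 \<rho> - \<gamma> - 1\<close>.
\<close>

lemma mode_contraction:
  assumes f: "flow a z w" and f': "flow b z' w'" and t: "t \<in> I" and \<delta>: "0 \<le> \<delta>"
    and \<nu>: "2 * \<rho> = \<gamma> + 1 + \<nu>" "0 < \<nu>"
    and ab: "\<And>s. s \<in> I \<Longrightarrow> \<bar>a s - b s\<bar> \<le> \<delta> * exp (\<rho> * \<bar>s\<bar>)"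
  shows "\<bar>(g k * norm (w k t))\<^sup>2 - (g k * norm (w' k t))\<^sup>2\<bar>
    \<le> (8 * \<Lambda> * exp (\<gamma> * T) / sqrt \<nu> * \<delta> * exp (\<rho> * \<bar>t\<bar>)) * (P k * e0 k)"
proof -
  define G where "G = exp (\<gamma> * T)"
  have G: "0 < G" by (simp add: G_def)
  define \<kappa> where "\<kappa> = m k * sqrt (g k)"
  have \<kappa>: "0 \<le> \<kappa>" using m g by (simp add: \<kappa>_def)
  define X where "X = sqrt (G * e0 k)"
  have X0: "0 \<le> X" and X2: "X\<^sup>2 = G * e0 k" using G e0_nonneg[of k] by (auto simp: X_def)
  define \<beta> where "\<beta> = (\<delta> * \<kappa>)\<^sup>2 * (2 * X\<^sup>2)"
  have en: "energy (g k) (z k s) (w k s) \<le> 2 * X\<^sup>2" "energy (g k) (z' k s) (w' k s) \<le> 2 * X\<^sup>2" if "s \<in> I" for s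
    using flow_energy[OF f that, of k] flow_energy[OF f' that, of k] by (simp_all add: X2 G_def mult.assoc)
  have sol: "mode_solution I (g k) (m k) a (\<lambda>s. ((a s - b s) * m k) *\<^sub>R z' k s)
      (\<lambda>s. z k s - z' k s) (\<lambda>s. w k s - w' k s)"
    using f f' by (intro mode_solution_diff) (auto simp: flow_def)
  have src: "g k * (norm (((a s - b s) * m k) *\<^sub>R z' k s))\<^sup>2 \<le> \<beta> * exp (2 * \<rho> * \<bar>s\<bar>)" if s: "s \<in> I" for s
  proof -
    have zz: "(norm (z' k s))\<^sup>2 \<le> 2 * X\<^sup>2"
      using en(2)[OF s] g[of k] unfolding energy_def by (smt (verit) mult_nonneg_nonneg zero_le_power2)
    have aa: "(a s - b s)\<^sup>2 \<le> (\<delta> * exp (\<rho> * \<bar>s\<bar>))\<^sup>2"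
      using ab[OF s] by (metis abs_ge_zero power2_abs power_mono)
    have "g k * (norm (((a s - b s) * m k) *\<^sub>R z' k s))\<^sup>2 = \<kappa>\<^sup>2 * ((a s - b s)\<^sup>2 * (norm (z' k s))\<^sup>2)"
      using g[of k] by (simp add: \<kappa>_def power_mult_distrib mult_ac)
    also have "\<dots> \<le> \<kappa>\<^sup>2 * ((\<delta> * exp (\<rho> * \<bar>s\<bar>))\<^sup>2 * (2 * X\<^sup>2))"
      by (intro mult_left_mono mult_mono aa zz) auto
    also have "\<dots> = \<beta> * exp (2 * \<rho> * \<bar>s\<bar>)"
      by (simp add: \<beta>_def power_mult_distrib exp_double[symmetric] mult_ac)
    finally show ?thesis .
  qed
  have "energy (g k) (z k t - z' k t) (w k t - w' k t) \<le> 2 * \<beta> * exp (2 * \<rho> * \<bar>t\<bar>) / (2 * \<rho> - \<gamma> - 1)"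
    by (rule forced_mode_energy[OF t g m sol _ _ _ src])
       (use f f' \<nu> in \<open>auto simp: flow_def \<beta>_def\<close>)
  then have "g k * (norm (w k t - w' k t))\<^sup>2 \<le> 2 * \<beta> * exp (2 * \<rho> * \<bar>t\<bar>) / \<nu>"
    using \<nu> unfolding energy_def by (smt (verit) zero_le_power2)
  also have "\<dots> = (2 * X * (\<delta> * \<kappa>) * exp (\<rho> * \<bar>t\<bar>) / sqrt \<nu>)\<^sup>2"
    using \<nu> by (simp add: \<beta>_def power_mult_distrib power_divide exp_double[symmetric] mult_ac)
  finally have "(sqrt (g k) * norm (w k t - w' k t))\<^sup>2 \<le> (2 * X * (\<delta> * \<kappa>) * exp (\<rho> * \<bar>t\<bar>) / sqrt \<nu>)\<^sup>2"
    using g[of k] by (simp add: power_mult_distrib)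
  then have diff: "sqrt (g k) * norm (w k t - w' k t) \<le> 2 * X * (\<delta> * \<kappa>) * exp (\<rho> * \<bar>t\<bar>) / sqrt \<nu>"
    by (rule power2_le_imp_le) (use X0 \<delta> \<kappa> \<nu> in auto)
  have size: "sqrt (g k) * norm v \<le> 2 * X" if "energy (g k) u v \<le> 2 * X\<^sup>2" for u v :: 'a
  proof (rule power2_le_imp_le)
    have "g k * (norm v)\<^sup>2 \<le> 2 * X\<^sup>2" using that unfolding energy_def by (smt (verit) zero_le_power2)
    then show "(sqrt (g k) * norm v)\<^sup>2 \<le> (2 * X)\<^sup>2"
      using g[of k] by (simp add: power_mult_distrib) (smt (verit) zero_le_power2)
  qed (use X0 in simp)
  have "(g k * norm (w k t))\<^sup>2 - (g k * norm (w' k t))\<^sup>2 =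
      g k * (sqrt (g k) * (norm (w k t) - norm (w' k t))) * (sqrt (g k) * norm (w k t) + sqrt (g k) * norm (w' k t))"
  proof -
    have "sqrt (g k) * sqrt (g k) = g k" using g[of k] by simp
    then have "g k * (sqrt (g k) * (norm (w k t) - norm (w' k t))) * (sqrt (g k) * norm (w k t) + sqrt (g k) * norm (w' k t))
       = g k * g k * ((norm (w k t) - norm (w' k t)) * (norm (w k t) + norm (w' k t)))"
      by (metis (no_types, opaque_lifting) distrib_left mult.assoc mult.left_commute)
    then show ?thesis by (simp add: power2_eq_square algebra_simps)
  qed
  then have "\<bar>(g k * norm (w k t))\<^sup>2 - (g k * norm (w' k t))\<^sup>2\<bar> =
      g k * (sqrt (g k) * \<bar>norm (w k t) - norm (w' k t)\<bar>) * (sqrt (g k) * norm (w k t) + sqrt (g k) * norm (w' k t))"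
    using g[of k] by (simp add: abs_mult)
  also have "\<dots> \<le> g k * (2 * X * (\<delta> * \<kappa>) * exp (\<rho> * \<bar>t\<bar>) / sqrt \<nu>) * (2 * X + 2 * X)"
  proof (rule mult_mono[OF mult_left_mono[OF _ g] add_mono[OF size[OF en(1)[OF t]] size[OF en(2)[OF t]]]])
    have "sqrt (g k) * \<bar>norm (w k t) - norm (w' k t)\<bar> \<le> sqrt (g k) * norm (w k t - w' k t)"
      by (intro mult_left_mono norm_triangle_ineq3) (simp add: g)
    then show "sqrt (g k) * \<bar>norm (w k t) - norm (w' k t)\<bar> \<le> 2 * X * (\<delta> * \<kappa>) * exp (\<rho> * \<bar>t\<bar>) / sqrt \<nu>"
      using diff by linarith
  qed (use g[of k] X0 \<delta> \<kappa> \<nu> in auto)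
  also have "\<dots> = (8 * \<delta> * exp (\<rho> * \<bar>t\<bar>) / sqrt \<nu> * X\<^sup>2) * (g k * \<kappa>)"
    by (simp add: power2_eq_square)
  also have "\<dots> \<le> (8 * \<delta> * exp (\<rho> * \<bar>t\<bar>) / sqrt \<nu> * X\<^sup>2) * (\<Lambda> * P k)"
    unfolding \<kappa>_def using \<delta> \<nu> by (intro mult_left_mono \<Lambda>P) auto
  also have "\<dots> = (8 * \<Lambda> * exp (\<gamma> * T) / sqrt \<nu> * \<delta> * exp (\<rho> * \<bar>t\<bar>)) * (P k * e0 k)"
    by (simp add: X2 G_def)
  finally show ?thesis .
qed

definition contracts :: "real \<Rightarrow> bool" where
  "contracts \<rho> \<longleftrightarrow> (\<forall>a b z w z' w' \<delta>. flow a z w \<longrightarrow> flow b z' w' \<longrightarrow> 0 \<le> \<delta> \<longrightarrow>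
     (\<forall>s\<in>I. \<bar>a s - b s\<bar> \<le> \<delta> * exp (\<rho> * \<bar>s\<bar>)) \<longrightarrow>
     (\<forall>t\<in>I. \<bar>feedback w t - feedback w' t\<bar> \<le> \<delta> / 2 * exp (\<rho> * \<bar>t\<bar>)))"

lemma contractsD:
  assumes "contracts \<rho>" "flow a z w" "flow b z' w'" "0 \<le> \<delta>"
    and "\<And>s. s \<in> I \<Longrightarrow> \<bar>a s - b s\<bar> \<le> \<delta> * exp (\<rho> * \<bar>s\<bar>)" and "t \<in> I"
  shows "\<bar>feedback w t - feedback w' t\<bar> \<le> \<delta> / 2 * exp (\<rho> * \<bar>t\<bar>)"
  using assms unfolding contracts_def by blast

text \<open>
  The constant in \<open>mode_contraction\<close>, summed over all modes, is beaten by taking \<open>\<nu>\<close> large.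
\<close>

lemma contraction: "\<exists>\<rho>\<ge>0. contracts \<rho>"
proof -
  define S where "S = (\<Sum>\<^sub>\<infinity>k. P k * e0 k)"
  have S: "0 \<le> S" unfolding S_def by (intro infsum_nonneg mult_nonneg_nonneg P_nonneg e0_nonneg)
  \<comment> \<open>Chosen such that the constant is \<open>Q / (2 \<surd>\<nu>)\<close>, hence at most 1/2 if
    \<open>\<surd>\<nu> \<ge> Q\<close>.\<close>
  define Q where "Q = 16 * D * \<Lambda> * exp (\<gamma> * T) * S"
  have Q: "0 \<le> Q" unfolding Q_def using D \<Lambda> S by simp
  define \<nu> where "\<nu> = Q\<^sup>2 + 1"
  have \<nu>: "0 < \<nu>" unfolding \<nu>_def by (simp add: add_nonneg_pos)
  have sq: "Q \<le> sqrt \<nu>" unfolding \<nu>_def by (rule real_le_rsqrt) simp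
  have sq0: "0 < sqrt \<nu>" using \<nu> by simp
  define \<rho> where "\<rho> = (\<gamma> + 1 + \<nu>) / 2"
  have "contracts \<rho>"
    unfolding contracts_def
  proof (intro allI impI ballI)
    fix a b z w z' w' \<delta> t
    assume f: "flow a z w" "flow b z' w'" and \<delta>: "0 \<le> \<delta>" and t: "t \<in> I"
      and "\<forall>s\<in>I. \<bar>a s - b s\<bar> \<le> \<delta> * exp (\<rho> * \<bar>s\<bar>)"
    then have ab: "\<bar>a s - b s\<bar> \<le> \<delta> * exp (\<rho> * \<bar>s\<bar>)" if "s \<in> I" for s using that by blast
    have "\<bar>(\<Sum>\<^sub>\<infinity>k. (g k * norm (w k t))\<^sup>2) - (\<Sum>\<^sub>\<infinity>k. (g k * norm (w' k t))\<^sup>2)\<bar>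
        \<le> (8 * \<Lambda> * exp (\<gamma> * T) / sqrt \<nu> * \<delta> * exp (\<rho> * \<bar>t\<bar>)) * S"
      unfolding S_def
      by (intro infsum_diff_le sum_feedback[OF f(1) t] sum_feedback[OF f(2) t] sumP
          mode_contraction[OF f t \<delta> _ \<nu> ab]) (simp_all add: \<rho>_def)
    then have "\<bar>feedback w t - feedback w' t\<bar>
        \<le> D * ((8 * \<Lambda> * exp (\<gamma> * T) / sqrt \<nu> * \<delta> * exp (\<rho> * \<bar>t\<bar>)) * S)"
      unfolding feedback_def right_diff_distrib[symmetric] abs_mult abs_of_nonneg[OF D]
      by (rule mult_left_mono[OF _ D])
    also have "\<dots> = Q / sqrt \<nu> * (\<delta> / 2 * exp (\<rho> * \<bar>t\<bar>))"
      by (simp add: Q_def)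
    also have "\<dots> \<le> 1 * (\<delta> / 2 * exp (\<rho> * \<bar>t\<bar>))"
      using sq sq0 \<delta> by (intro mult_right_mono) auto
    finally show "\<bar>feedback w t - feedback w' t\<bar> \<le> \<delta> / 2 * exp (\<rho> * \<bar>t\<bar>)" by simp
  qed
  moreover have "0 \<le> \<rho>" using \<gamma> \<nu> by (simp add: \<rho>_def)
  ultimately show ?thesis by blast
qed

lemma flow_exists:
  assumes a: "continuous_on I a" and rate: "\<And>k. growth_rate I (g k) (m k) a \<gamma>"
  shows "\<exists>z w. flow a z w"
proof -
  have "\<forall>k. \<exists>z w. z 0 = z0 k \<and> w 0 = w0 k \<and> mode_solution I (g k) (m k) a (\<lambda>_. 0) z w"
    using mode_solution_exists[OF T a] by blast
  then obtain z w where "\<And>k. z k 0 = z0 k \<and> w k 0 = w0 k \<and> mode_solution I (g k) (m k) a (\<lambda>_. 0) (z k) (w k)"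
    by metis
  then show ?thesis using rate unfolding flow_def by blast
qed

text \<open>
  The iterates \<open>b (n + 1) = feedback of the flow driven by b n\<close> converge uniformly by \<open>contraction\<close>, and
  the same estimate shows that the limit reproduces itself. \<open>Adm\<close> collects the bounds that make the growth rate \<open>\<gamma>\<close> valid; it must be preserved by
  the iteration and closed under limits.
\<close>

theorem selfconsistent_flow_exists:
  fixes Adm :: "(real \<Rightarrow> real) \<Rightarrow> bool" and A :: real
  assumes cont: "\<And>a. Adm a \<Longrightarrow> continuous_on I a"
    and rate: "\<And>a k. Adm a \<Longrightarrow> growth_rate I (g k) (m k) a \<gamma>"
    and bounds: "\<And>a t. Adm a \<Longrightarrow> t \<in> I \<Longrightarrow> 0 \<le> a t \<and> a t \<le> A"
    and zero: "Adm (\<lambda>_. 0)"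
    and step: "\<And>a z w. Adm a \<Longrightarrow> flow a z w \<Longrightarrow> Adm (feedback w)"
    and limit: "\<And>a b. (\<And>n. Adm (b n)) \<Longrightarrow> continuous_on I a \<Longrightarrow>
      (\<And>t. t \<in> I \<Longrightarrow> (\<lambda>n::nat. b n t) \<longlonglongrightarrow> a t) \<Longrightarrow> Adm a"
  shows "\<exists>a z w. Adm a \<and> flow a z w \<and> (\<forall>t\<in>I. a t = feedback w t)"
proof -
  obtain \<rho> where \<rho>: "0 \<le> \<rho>" and contr: "contracts \<rho>" using contraction by blast
  define W where "W a = (SOME w. \<exists>z. flow a z w)" for a
  have W: "\<exists>z. flow a z (W a)" if "Adm a" for a
  proof -
    have "\<exists>w. \<exists>z. flow a z w" using flow_exists[OF cont[OF that] rate[OF that]] by blast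
    then show ?thesis unfolding W_def by (rule someI_ex)
  qed
  have contrW: "\<bar>feedback (W a) t - feedback (W b) t\<bar> \<le> \<delta> / 2 * exp (\<rho> * \<bar>t\<bar>)"
    if "Adm a" "Adm b" "0 \<le> \<delta>" "t \<in> I" "\<And>s. s \<in> I \<Longrightarrow> \<bar>a s - b s\<bar> \<le> \<delta> * exp (\<rho> * \<bar>s\<bar>)" for a b \<delta> t
    using W[OF that(1)] W[OF that(2)] contractsD[OF contr _ _ that(3) that(5) that(4)] by blast
  define b where "b = rec_nat (\<lambda>_. 0) (\<lambda>n a. feedback (W a))"
  have b0: "b 0 = (\<lambda>_. 0)" and bS: "b (Suc n) = feedback (W (b n))" for n by (simp_all add: b_def)
  have adm: "Adm (b n)" for n
  proof (induction n)
    case (Suc n)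
    then show ?case using W[OF Suc] step unfolding bS by blast
  qed (simp add: b0 zero)
  have A: "0 \<le> A" using bounds[OF zero, of 0] T by simp
  have diff: "\<bar>b (Suc n) t - b n t\<bar> \<le> (A * (1/2)^n) * exp (\<rho> * \<bar>t\<bar>)" if "t \<in> I" for n t
    using that
  proof (induction n arbitrary: t)
    case 0
    have "A * 1 \<le> A * exp (\<rho> * \<bar>t\<bar>)" using A \<rho> by (intro mult_left_mono) auto
    then show ?case using bounds[OF adm[of "Suc 0"] 0] by (simp add: b0)
  next
    case (Suc n)
    have "\<bar>b (Suc (Suc n)) t - b (Suc n) t\<bar> \<le> (A * (1/2)^n) / 2 * exp (\<rho> * \<bar>t\<bar>)"
      unfolding bS[of "Suc n"] bS[of n]
      by (rule contrW[OF _ adm _ Suc.prems]) (use adm[of "Suc n"] Suc.IH A in \<open>auto simp: bS\<close>)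
    then show ?case by simp
  qed
  define C where "C = A * exp (\<rho> * T)"
  have diffC: "norm (b (Suc n) t - b n t) \<le> C * (1/2)^n" if t: "t \<in> I" for n t
  proof -
    have "(A * (1/2)^n) * exp (\<rho> * \<bar>t\<bar>) \<le> (A * (1/2)^n) * exp (\<rho> * T)"
      using t \<rho> A by (intro mult_left_mono) (auto intro!: mult_left_mono)
    then show ?thesis using diff[OF t, of n] by (simp add: C_def mult_ac)
  qed
  define a where "a t = (\<Sum>n. b (Suc n) t - b n t)" for t
  have "uniform_limit I (\<lambda>n t. \<Sum>i<n. b (Suc i) t - b i t) a sequentially"
    unfolding a_def
  proof (rule Weierstrass_m_test)
    show "summable (\<lambda>n. C * (1/2::real)^n)" by (intro summable_mult summable_geometric) simp
  qed (rule diffC)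
  moreover have "(\<Sum>i<n. b (Suc i) t - b i t) = b n t" for n t
    by (induction n) (simp_all add: b0)
  ultimately have unif: "uniform_limit I b a sequentially" by simp
  have lim: "(\<lambda>n. b n t) \<longlonglongrightarrow> a t" if "t \<in> I" for t
    by (rule tendsto_uniform_limitI[OF unif that])
  have "continuous_on I a"
    by (rule uniform_limit_theorem[OF _ unif]) (use cont[OF adm] in auto)
  then have a: "Adm a" using limit adm lim by blast
  have fix_a: "a t = feedback (W a) t" if t: "t \<in> I" for t
  proof (rule LIMSEQ_unique[OF LIMSEQ_Suc[OF lim[OF t]]])
    show "(\<lambda>n. b (Suc n) t) \<longlonglongrightarrow> feedback (W a) t"
      unfolding tendsto_iff
    proof (intro allI impI)
      fix e :: real assume e: "0 < e"
      define \<delta> where "\<delta> = e / exp (\<rho> * T)"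
      have \<delta>: "0 < \<delta>" using e by (simp add: \<delta>_def)
      have "\<forall>\<^sub>F n in sequentially. \<forall>s\<in>I. dist (b n s) (a s) < \<delta>"
        using unif \<delta> unfolding uniform_limit_iff by blast
      then show "\<forall>\<^sub>F n in sequentially. dist (b (Suc n) t) (feedback (W a) t) < e"
      proof eventually_elim
        case (elim n)
        have "\<bar>b n s - a s\<bar> \<le> \<delta> * exp (\<rho> * \<bar>s\<bar>)" if "s \<in> I" for s
        proof -
          have "\<delta> * 1 \<le> \<delta> * exp (\<rho> * \<bar>s\<bar>)" using \<delta> \<rho> by (intro mult_left_mono) auto
          then show ?thesis using elim that by (force simp: dist_real_def)
        qed
        then have "\<bar>feedback (W (b n)) t - feedback (W a) t\<bar> \<le> \<delta> / 2 * exp (\<rho> * \<bar>t\<bar>)"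
          using \<delta> by (intro contrW adm a t) auto
        also have "\<dots> \<le> \<delta> / 2 * exp (\<rho> * T)"
          using t \<rho> \<delta> by (intro mult_left_mono) (auto intro!: mult_left_mono)
        also have "\<dots> = e / 2" by (simp add: \<delta>_def)
        finally show ?case using e by (simp add: bS dist_real_def)
      qed
    qed
  qed
  obtain z where "flow a z (W a)" using W[OF a] by blast
  then show ?thesis using a fix_a by blast
qed

text \<open>
  The distance of \<open>a\<close> and \<open>b\<close> is finite and can be halved any number of times.
\<close>

theorem selfconsistent_flow_unique:
  assumes f: "flow a z w" "flow b z' w'"
    and fb: "\<And>t. t \<in> I \<Longrightarrow> a t = feedback w t" "\<And>t. t \<in> I \<Longrightarrow> b t = feedback w' t"
    and t: "t \<in> I"
  shows "z k t = z' k t \<and> w k t = w' k t"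
proof -
  obtain \<rho> where \<rho>: "0 \<le> \<rho>" and contr: "contracts \<rho>" using contraction by blast
  define A where "A = D * (2 * exp (\<gamma> * T) * (\<Sum>\<^sub>\<infinity>k. g k * e0 k))"
  have bounds: "\<bar>a s\<bar> \<le> A" "\<bar>a s - b s\<bar> \<le> A" if "s \<in> I" for s
    using feedback_bounds[OF f(1) that] feedback_bounds[OF f(2) that] fb[OF that] by (auto simp: A_def)
  have A: "0 \<le> A" using bounds(1)[OF t] by linarith
  have diff: "\<bar>a s - b s\<bar> \<le> (A * (1/2)^n) * exp (\<rho> * \<bar>s\<bar>)" if "s \<in> I" for n s
    using that
  proof (induction n arbitrary: s)
    case 0
    have "A * 1 \<le> A * exp (\<rho> * \<bar>s\<bar>)" using A \<rho> by (intro mult_left_mono) auto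
    then show ?case using bounds(2)[OF 0] by simp
  next
    case (Suc n)
    have "\<bar>feedback w s - feedback w' s\<bar> \<le> (A * (1/2)^n) / 2 * exp (\<rho> * \<bar>s\<bar>)"
      by (rule contractsD[OF contr f _ Suc.IH Suc.prems]) (use A in auto)
    then show ?case using fb Suc.prems by simp
  qed
  have ab: "a s = b s" if s: "s \<in> I" for s
  proof -
    have "(\<lambda>n. (A * (1/2)^n) * exp (\<rho> * \<bar>s\<bar>)) \<longlonglongrightarrow> (A * 0) * exp (\<rho> * \<bar>s\<bar>)"
      by (intro tendsto_intros LIMSEQ_power_zero) simp
    then have "\<bar>a s - b s\<bar> \<le> (A * 0) * exp (\<rho> * \<bar>s\<bar>)"
      by (rule LIMSEQ_le_const) (use diff[OF s] in blast)
    then show ?thesis by simp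
  qed
  have "mode_solution I (g k) (m k) a (\<lambda>_. 0) (z' k) (w' k)"
    using f(2) ab unfolding flow_def mode_solution_def by simp
  moreover have "mode_solution I (g k) (m k) a (\<lambda>_. 0) (z k) (w k)" "z k 0 = z' k 0" "w k 0 = w' k 0"
    using f unfolding flow_def by auto
  ultimately show ?thesis
    using mode_solution_unique[of T "g k" "m k" a "z k" "w k" "z' k" "w' k" A t] g m bounds(1) t by blast
qed

end

section \<open>Fourier series on the torus: existence\<close>

definition wave :: "int^'d \<Rightarrow> real^'d \<Rightarrow> complex" where
  "wave k x = cis (wavevector k \<bullet> x)"

lemma wavevector_0 [simp]: "wavevector 0 = 0"
  by (simp add: wavevector_def vec_eq_iff)

lemma wavevector_minus [simp]: "wavevector (- k) = - wavevector k"
  by (simp add: wavevector_def vec_eq_iff)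

lemma wavevector_add: "wavevector (k + l) = wavevector k + wavevector l"
  by (simp add: wavevector_def vec_eq_iff)

lemma wave_0 [simp]: "wave 0 x = 1"
  by (simp add: wave_def)

lemma norm_wave [simp]: "norm (wave k x) = 1"
  by (simp add: wave_def)

lemma wave_mult: "wave k x * wave l x = wave (k + l) x"
  by (simp add: wave_def wavevector_add inner_add_left cis_mult)

lemma cnj_wave: "cnj (wave k x) = wave (- k) x"
  by (simp add: wave_def cis_cnj)

lemma cis_neg_wave: "cis (- (wavevector k \<bullet> x)) = wave (- k) x"
  by (simp add: wave_def)

lemma continuous_on_wave [continuous_intros]: "continuous_on S (wave k)"
  unfolding wave_def cis_conv_exp by (intro continuous_intros)

lemma wave_measurable [measurable]: "wave k \<in> borel_measurable borel"
  by (intro borel_measurable_continuous_onI continuous_on_wave)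

lemma wave_periodic: "wave k (x + axis i (2 * pi)) = wave k x"
proof -
  have "wavevector k \<bullet> (x + axis i (2 * pi)) = wavevector k \<bullet> x + 2 * pi * of_int (k $ i)"
    by (simp add: inner_add_right inner_axis wavevector_def)
  then show ?thesis by (simp add: wave_def cis_mult[symmetric] cis_multiple_2pi)
qed

lemma mem_cell: "x \<in> cell \<longleftrightarrow> (\<forall>i. 0 \<le> x $ i \<and> x $ i \<le> 2 * pi)"
  by (auto simp: cell_def mem_box_cart)

lemma cell_borel [measurable]: "cell \<in> sets borel"
  by (simp add: cell_def)

lemma emeasure_cell_finite: "emeasure lborel (cell :: (real^'d) set) < \<infinity>"
  unfolding cell_def by (rule emeasure_lborel_cbox_finite)

lemma integral_cis_period:
  fixes n :: int
  shows "(LINT y|lborel. indicator {0..2*pi} y *\<^sub>R cis (of_int n * y)) = (if n = 0 then 2 * pi else 0)"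
    and "integrable lborel (\<lambda>y. indicator {0..2*pi} y *\<^sub>R cis (of_int n * y))"
proof -
  define F where "F y = (if n = 0 then of_real y else cis (of_int n * y) / (\<i> * of_int n))" for y :: real
  have "(F has_vector_derivative cis (of_int n * y)) (at y within {0..2*pi})" for y
  proof (cases "n = 0")
    case True
    then show ?thesis
      unfolding F_def using has_vector_derivative_of_real[OF DERIV_ident] by simp
  next
    case False
    have "((\<lambda>y. exp (\<i> * of_int n * of_real y)) has_vector_derivative (\<i> * of_int n * exp (\<i> * of_int n * of_real y))) (at y within {0..2*pi})"
      by (rule has_vector_derivative_real_field) (auto intro!: derivative_eq_intros)
    then have "((\<lambda>y. exp (\<i> * of_int n * of_real y) / (\<i> * of_int n)) has_vector_derivative
        (\<i> * of_int n * exp (\<i> * of_int n * of_real y)) / (\<i> * of_int n)) (at y within {0..2*pi})"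
      by (rule has_vector_derivative_divide)
    moreover have "exp (\<i> * of_int n * of_real y) = cis (of_int n * y)" for y
      by (simp add: cis_conv_exp mult.assoc)
    ultimately show ?thesis using False by (simp add: F_def[abs_def])
  qed
  moreover have "continuous_on {0..2*pi} (\<lambda>y. cis (of_int n * y))"
    unfolding cis_conv_exp by (intro continuous_intros)
  ultimately have "has_bochner_integral lborel (\<lambda>y. indicator {0..2*pi} y *\<^sub>R cis (of_int n * y)) (F (2*pi) - F 0)"
    by (intro has_bochner_integral_FTC_Icc) auto
  moreover have "F (2*pi) - F 0 = (if n = 0 then 2 * pi else 0)"
    using cis_multiple_2pi[of "of_int n"] by (simp add: F_def mult.commute)
  ultimately show "(LINT y|lborel. indicator {0..2*pi} y *\<^sub>R cis (of_int n * y)) = (if n = 0 then 2 * pi else 0)"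
    and "integrable lborel (\<lambda>y. indicator {0..2*pi} y *\<^sub>R cis (of_int n * y))"
    by (auto simp: has_bochner_integral_iff)
qed

text \<open>
  Fubini's theorem in the form needed for the orthogonality of the waves.
\<close>

lemma lborel_integral_prod_Basis:
  fixes f :: "'a::euclidean_space \<Rightarrow> real \<Rightarrow> complex"
  assumes int: "\<And>b. b \<in> Basis \<Longrightarrow> integrable lborel (f b)"
  shows "(LINT x|lborel. (\<Prod>b\<in>Basis. f b (x \<bullet> b))) = (\<Prod>b\<in>(Basis::'a set). LINT y|lborel. f b y)"
proof -
  interpret product_sigma_finite "\<lambda>_::'a. lborel :: real measure" by standard
  have [measurable]: "f b \<in> borel_measurable borel" if "b \<in> Basis" for b
    using borel_measurable_integrable[OF int[OF that]] by simp
  have m: "(\<lambda>x::'a. \<Prod>b\<in>Basis. f b (x \<bullet> b)) \<in> borel_measurable borel"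
    by (intro borel_measurable_prod) measurable
  have "(LINT x|lborel. (\<Prod>b\<in>Basis. f b (x \<bullet> b))) =
      (LINT x|distr (\<Pi>\<^sub>M b\<in>Basis. lborel) borel (\<lambda>f. \<Sum>b\<in>Basis. f b *\<^sub>R b). (\<Prod>b\<in>(Basis::'a set). f b (x \<bullet> b)))"
    by (subst lborel_eq) simp
  also have "\<dots> = (LINT x|(\<Pi>\<^sub>M b\<in>(Basis::'a set). lborel). (\<Prod>b\<in>(Basis::'a set). f b ((\<Sum>b\<in>Basis. x b *\<^sub>R b) \<bullet> b)))"
    by (rule integral_distr[OF _ m]) measurable
  also have "\<dots> = (LINT x|(\<Pi>\<^sub>M b\<in>(Basis::'a set). lborel). (\<Prod>b\<in>(Basis::'a set). f b (x b)))"
    by (intro Bochner_Integration.integral_cong prod.cong refl) simp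
  also have "\<dots> = (\<Prod>b\<in>(Basis::'a set). LINT y|lborel. f b y)"
    by (rule product_integral_prod) (use int in auto)
  finally show ?thesis .
qed

lemma integral_wave:
  "(LINT x:cell|lborel. wave (k :: int^'d) x) = (if k = 0 then (2 * pi) ^ CARD('d) else 0)"
proof -
  let ?B = "Basis :: (real^'d) set"
  define n where "n b = (if b \<in> range (\<lambda>i. axis i (1::real)) then k $ (THE i. axis i 1 = b) else 0)" for b :: "real^'d"
  have n_axis: "n (axis i 1) = k $ i" for i
  proof -
    have "(THE j. axis j (1::real) = axis i 1) = i" by (rule the_equality) (auto simp: axis_eq_axis)
    then show ?thesis by (simp add: n_def)
  qed
  have n: "wavevector k \<bullet> b = of_int (n b)" if "b \<in> ?B" for b
    using that by (auto simp: Basis_vec_def n_axis inner_axis wavevector_def)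
  have cell_iff: "x \<in> cell \<longleftrightarrow> (\<forall>b\<in>?B. x \<bullet> b \<in> {0..2*pi})" for x
    by (auto simp: mem_cell Basis_vec_def inner_axis)
  have "(\<Prod>b\<in>?B. indicator {0..2*pi} (x \<bullet> b) *\<^sub>R cis (of_int (n b) * (x \<bullet> b))) = indicator cell x *\<^sub>R wave k x" for x
  proof -
    have "(\<Prod>b\<in>?B. indicator {0..2*pi} (x \<bullet> b) *\<^sub>R cis (of_int (n b) * (x \<bullet> b))) =
        of_real (\<Prod>b\<in>?B. indicator {0..2*pi} (x \<bullet> b)) * (\<Prod>b\<in>?B. cis (of_int (n b) * (x \<bullet> b)))"
      by (simp add: scaleR_conv_of_real prod.distrib)
    also have "(\<Prod>b\<in>?B. indicator {0..2*pi} (x \<bullet> b)) = (indicator cell x :: real)"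
      by (auto simp: cell_iff indicator_def)
    also have "(\<Prod>b\<in>?B. cis (of_int (n b) * (x \<bullet> b))) = cis (\<Sum>b\<in>?B. of_int (n b) * (x \<bullet> b))"
      by (simp add: cis_conv_exp exp_sum sum_distrib_left)
    also have "(\<Sum>b\<in>?B. of_int (n b) * (x \<bullet> b)) = wavevector k \<bullet> x"
      unfolding euclidean_inner[of "wavevector k" x] by (intro sum.cong) (simp_all add: n)
    finally show ?thesis by (simp add: wave_def scaleR_conv_of_real)
  qed
  then have "(LINT x:cell|lborel. wave k x) =
      (LINT x|lborel. (\<Prod>b\<in>?B. indicator {0..2*pi} (x \<bullet> b) *\<^sub>R cis (of_int (n b) * (x \<bullet> b))))"
    by (simp add: set_lebesgue_integral_def)
  also have "\<dots> = (\<Prod>b\<in>?B. LINT y|lborel. indicator {0..2*pi} y *\<^sub>R cis (of_int (n b) * y))"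
    by (rule lborel_integral_prod_Basis) (rule integral_cis_period)
  also have "\<dots> = (\<Prod>b\<in>?B. if n b = 0 then complex_of_real (2 * pi) else 0)"
    by (simp only: integral_cis_period) (auto intro!: prod.cong)
  also have "\<dots> = (if k = 0 then (2 * pi) ^ CARD('d) else 0)"
  proof (cases "k = 0")
    case True
    then have "n b = 0" if "b \<in> ?B" for b using that by (auto simp: Basis_vec_def n_axis)
    then have "(\<Prod>b\<in>?B. if n b = 0 then complex_of_real (2 * pi) else 0) = (\<Prod>b\<in>?B. complex_of_real (2 * pi))"
      by (intro prod.cong) auto
    then show ?thesis using True by simp
  next
    case False
    then obtain i where i: "k $ i \<noteq> 0" by (auto simp: vec_eq_iff)
    have "(\<Prod>b\<in>?B. if n b = 0 then complex_of_real (2 * pi) else 0) = 0"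
      by (rule prod_zero) (use i n_axis[of i] in \<open>auto intro!: bexI[of _ "axis i 1"]\<close>)
    then show ?thesis using False by simp
  qed
  finally show ?thesis .
qed

lemma set_integrable_bounded:
  fixes f :: "real^'d \<Rightarrow> 'b::{banach,second_countable_topology}"
  assumes "f \<in> borel_measurable borel" "\<And>x. x \<in> cell \<Longrightarrow> norm (f x) \<le> B"
  shows "set_integrable lborel cell f"
  unfolding set_integrable_def
proof (rule integrableI_bounded_set_indicator[where B = B])
  show "cell \<in> sets lborel" "f \<in> borel_measurable lborel" using assms(1) by auto
  show "emeasure lborel (cell::(real^'d) set) < \<infinity>" by (rule emeasure_cell_finite)
  show "AE x in lborel. x \<in> cell \<longrightarrow> norm (f x) \<le> B" using assms(2) by simp
qed

lemma set_integrable_mult_bounded: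
  fixes f g :: "real^'d \<Rightarrow> complex"
  assumes f: "set_integrable lborel cell f" and g: "g \<in> borel_measurable borel" and B: "\<And>x. norm (g x) \<le> B"
  shows "set_integrable lborel cell (\<lambda>x. f x * g x)"
proof -
  define h where "h x = indicator cell x *\<^sub>R f x" for x
  have h: "integrable lborel h" using f by (simp add: h_def[abs_def] set_integrable_def)
  have "integrable lborel (\<lambda>x. h x * g x)"
  proof (rule Bochner_Integration.integrable_bound)
    show "integrable lborel (\<lambda>x. B * norm (h x))" using h by auto
    show "(\<lambda>x. h x * g x) \<in> borel_measurable lborel" using h g by auto
    have "norm (h x * g x) \<le> norm (B * norm (h x))" for x
    proof -
      have "norm (h x) * norm (g x) \<le> norm (h x) * B" by (intro mult_left_mono B) simp
      also have "\<dots> \<le> norm (B * norm (h x))" by (simp add: mult.commute)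
      finally show ?thesis by (simp add: norm_mult)
    qed
    then show "AE x in lborel. norm (h x * g x) \<le> norm (B * norm (h x))" by simp
  qed
  then have "integrable lborel (\<lambda>x. indicator cell x *\<^sub>R (f x * g x))" by (simp add: h_def)
  then show ?thesis by (simp add: set_integrable_def)
qed

lemma set_integrable_fourier:
  fixes f :: "real^'d \<Rightarrow> real"
  assumes "set_integrable lborel cell f"
  shows "set_integrable lborel cell (\<lambda>x. complex_of_real (f x) * wave k x)"
proof (rule set_integrable_mult_bounded[where B = 1])
  show "set_integrable lborel cell (\<lambda>x. complex_of_real (f x))"
    using assms by (simp add: set_integrable_def complex_of_real_integrable_eq scaleR_conv_of_real flip: of_real_mult)
qed auto

lemma fourier_wave: "fourier f k = (LINT x:cell|lborel. of_real (f x) * wave (- k) x) / of_real ((2 * pi) ^ CARD('d))"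
  for f :: "real^'d \<Rightarrow> real"
  by (simp add: fourier_def cis_neg_wave)

definition trig_sum :: "(int^'d \<Rightarrow> complex) \<Rightarrow> (int^'d) set \<Rightarrow> real^'d \<Rightarrow> complex" where
  "trig_sum c A x = (\<Sum>k\<in>A. c k * wave k x)"

lemma trig_sum_measurable [measurable]: "trig_sum c A \<in> borel_measurable borel"
  unfolding trig_sum_def by measurable

lemma norm_trig_sum_le: "norm (trig_sum c A x) \<le> (\<Sum>k\<in>A. norm (c k))"
  unfolding trig_sum_def by (intro sum_norm_le) (simp add: norm_mult)

lemma set_integral_sum:
  fixes f :: "'i \<Rightarrow> 'a \<Rightarrow> 'b::{banach,second_countable_topology}"
  assumes "\<And>i. i \<in> I \<Longrightarrow> set_integrable M S (f i)"
  shows "(LINT x:S|M. (\<Sum>i\<in>I. f i x)) = (\<Sum>i\<in>I. LINT x:S|M. f i x)"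
  using assms unfolding set_lebesgue_integral_def set_integrable_def scaleR_sum_right
  by (intro Bochner_Integration.integral_sum) auto

lemma integral_trig_sum_wave:
  fixes c :: "int^'d \<Rightarrow> complex"
  assumes "finite A"
  shows "(LINT x:cell|lborel. trig_sum c A x * wave (- k) x) =
    (if k \<in> A then (2 * pi) ^ CARD('d) * c (k :: int^'d) else 0)"
proof -
  have int: "set_integrable lborel cell (\<lambda>x. c l * wave (l - k) x)" for l
    by (rule set_integrable_bounded[where B = "norm (c l)"]) (auto simp: norm_mult)
  have "(LINT x:cell|lborel. trig_sum c A x * wave (- k) x) = (LINT x:cell|lborel. (\<Sum>l\<in>A. c l * wave (l - k) x))"
    by (simp add: trig_sum_def sum_distrib_right mult.assoc wave_mult)
  also have "\<dots> = (\<Sum>l\<in>A. LINT x:cell|lborel. c l * wave (l - k) x)"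
    by (rule set_integral_sum) (rule int)
  also have "\<dots> = (\<Sum>l\<in>A. if l = k then (2 * pi) ^ CARD('d) * c k else 0)"
    by (intro sum.cong refl) (simp add: integral_wave)
  also have "\<dots> = (if k \<in> A then (2 * pi) ^ CARD('d) * c k else 0)"
    using assms by simp
  finally show ?thesis .
qed

lemma integral_trig_sum_norm2:
  fixes c :: "int^'d \<Rightarrow> complex"
  assumes "finite A"
  shows "(LINT x:cell|lborel. (norm (trig_sum c A x))\<^sup>2) = (2 * pi) ^ CARD('d) * (\<Sum>k\<in>A. (norm (c k))\<^sup>2)"
proof -
  define B where "B = (\<Sum>k\<in>A. norm (c k))"
  have int: "set_integrable lborel cell (\<lambda>x. cnj (c k) * (trig_sum c A x * wave (- k) x))" for k
    by (rule set_integrable_bounded[where B = "norm (c k) * B"])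
       (use norm_trig_sum_le in \<open>auto simp: norm_mult B_def intro!: mult_left_mono\<close>)
  have "complex_of_real (LINT x:cell|lborel. (norm (trig_sum c A x))\<^sup>2) =
      (LINT x:cell|lborel. of_real ((norm (trig_sum c A x))\<^sup>2))"
    by (rule set_integral_complex_of_real[symmetric])
  also have "\<dots> = (LINT x:cell|lborel. (\<Sum>k\<in>A. cnj (c k) * (trig_sum c A x * wave (- k) x)))"
  proof -
    have "of_real ((norm (trig_sum c A x))\<^sup>2) = (\<Sum>k\<in>A. cnj (c k) * (trig_sum c A x * wave (- k) x))" for x
    proof -
      have "of_real ((norm (trig_sum c A x))\<^sup>2) = trig_sum c A x * cnj (trig_sum c A x)"
        by (rule complex_norm_square)
      also have "cnj (trig_sum c A x) = (\<Sum>k\<in>A. cnj (c k) * wave (- k) x)"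
        by (simp add: trig_sum_def cnj_wave)
      finally show ?thesis by (simp add: sum_distrib_left mult_ac)
    qed
    then show ?thesis by simp
  qed
  also have "\<dots> = (\<Sum>k\<in>A. LINT x:cell|lborel. cnj (c k) * (trig_sum c A x * wave (- k) x))"
    by (rule set_integral_sum) (rule int)
  also have "\<dots> = (\<Sum>k\<in>A. of_real ((2 * pi) ^ CARD('d)) * (c k * cnj (c k)))"
    by (intro sum.cong refl) (simp add: integral_trig_sum_wave[OF assms])
  also have "\<dots> = of_real ((2 * pi) ^ CARD('d) * (\<Sum>k\<in>A. (norm (c k))\<^sup>2))"
    by (simp only: of_real_mult of_real_sum complex_norm_square sum_distrib_left)
  finally show ?thesis using of_real_eq_iff by blast
qed

lemma measure_cell: "(LINT x:(cell :: (real^'d) set)|lborel. (1::real)) = (2 * pi) ^ CARD('d)"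
proof -
  have "complex_of_real (LINT x:(cell :: (real^'d) set)|lborel. 1) = (LINT x:(cell :: (real^'d) set)|lborel. of_real 1)"
    by (rule set_integral_complex_of_real[symmetric])
  also have "\<dots> = of_real ((2 * pi) ^ CARD('d))"
    using integral_wave[of "0 :: int^'d"] by simp
  finally show ?thesis using of_real_eq_iff by blast
qed

lemma AE_summable_norm:
  fixes h :: "nat \<Rightarrow> 'a \<Rightarrow> 'b::{banach,second_countable_topology}"
  assumes int: "\<And>i. integrable M (h i)" and sum: "summable (\<lambda>i. LINT x|M. norm (h i x))"
  shows "AE x in M. summable (\<lambda>i. norm (h i x))"
proof -
  have "(\<integral>\<^sup>+x. (\<Sum>i. ennreal (norm (h i x))) \<partial>M) = (\<Sum>i. \<integral>\<^sup>+x. ennreal (norm (h i x)) \<partial>M)"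
    using int by (intro nn_integral_suminf) auto
  also have "\<dots> = (\<Sum>i. ennreal (LINT x|M. norm (h i x)))"
    by (intro suminf_cong nn_integral_eq_integral integrable_norm int) auto
  also have "\<dots> \<noteq> \<infinity>"
    using sum by (simp add: ennreal_suminf_neq_top)
  finally have "AE x in M. (\<Sum>i. ennreal (norm (h i x))) \<noteq> \<infinity>"
    using int by (intro nn_integral_PInf_AE) auto
  then show ?thesis
    by eventually_elim (auto intro: summable_suminf_not_top)
qed

text \<open>
  The partial sums over cubes converge in \<open>L\<^sup>2\<close>. Along a fast subsequence the \<open>L\<^sup>1\<close> norms of the
  increments are summable, so the series of increments converges absolutely almost everywhere and can be
  integrated term by term against each wave. Its pointwise sum is periodic at every point, since
  the increments are, also where it fails to converge. Symmetric cubes keep it real.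
\<close>

theorem riesz_fischer:
  fixes c :: "int^'d \<Rightarrow> complex"
  assumes sum: "(\<lambda>k. (norm (c k))\<^sup>2) summable_on UNIV" and sym: "\<And>k. c (- k) = cnj (c k)"
  shows "\<exists>f. periodic f \<and> set_integrable lborel cell f \<and> fourier f = c"
proof -
  define V :: real where "V = (2 * pi) ^ CARD('d)"
  have V: "0 < V" by (simp add: V_def)
  define F :: "nat \<Rightarrow> (int^'d) set" where "F n = {k. \<forall>i. k $ i \<in> {- int n .. int n}}" for n
  have F_fin: "finite (F n)" for n
  proof -
    have "finite (vec_nth ` F n)"
      by (rule finite_subset[OF _ finite_PiE[of UNIV "\<lambda>_. {- int n .. int n}"]]) (auto simp: F_def PiE_def)
    then show ?thesis by (rule finite_imageD) (auto simp: inj_on_def vec_eq_iff)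
  qed
  have F_mono: "F n \<subseteq> F n'" if "n \<le> n'" for n n'
  proof
    fix k assume k: "k \<in> F n"
    have "k $ i \<in> {- int n' .. int n'}" for i
    proof -
      have "- int n \<le> k $ i" "k $ i \<le> int n" using k by (auto simp: F_def)
      then show ?thesis using that by auto
    qed
    then show "k \<in> F n'" by (simp add: F_def)
  qed
  have F_minus: "- k \<in> F n \<longleftrightarrow> k \<in> F n" for k n by (auto simp: F_def minus_le_iff)
  have F_all: "\<exists>n. k \<in> F n" for k
  proof
    show "k \<in> F (nat (\<Sum>i\<in>UNIV. \<bar>k $ i\<bar>))"
    proof -
      have "k $ i \<in> {- int (nat (\<Sum>i\<in>UNIV. \<bar>k $ i\<bar>)) .. int (nat (\<Sum>i\<in>UNIV. \<bar>k $ i\<bar>))}" for i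
      proof -
        have "\<bar>k $ i\<bar> \<le> (\<Sum>i\<in>UNIV. \<bar>k $ i\<bar>)" by (rule member_le_sum) auto
        then show ?thesis by auto
      qed
      then show ?thesis by (simp add: F_def)
    qed
  qed
  define s where "s n = (\<Sum>k\<in>F n. (norm (c k))\<^sup>2)" for n
  have s_mono: "s n \<le> s n'" if "n \<le> n'" for n n'
    unfolding s_def using F_fin F_mono[OF that] by (intro sum_mono2) auto
  have "convergent s"
  proof (rule Bseq_mono_convergent)
    have "norm (s n) \<le> (\<Sum>\<^sub>\<infinity>k. (norm (c k))\<^sup>2)" for n
      unfolding s_def using sum F_fin by (simp add: sum_nonneg) (intro finite_sum_le_infsum, auto)
    then show "Bseq s" by (rule BseqI')
  qed (use s_mono in auto)
  then have "Cauchy s" by (simp add: Cauchy_convergent_iff)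
  then have "\<exists>N. \<forall>m\<ge>N. \<forall>n\<ge>N. norm (s m - s n) < (1/4)^j" for j :: nat
    by (auto simp: Cauchy_iff)
  then obtain N where N: "\<And>j m n. N j \<le> m \<Longrightarrow> N j \<le> n \<Longrightarrow> norm (s m - s n) < (1/4)^j" by metis
  \<comment> \<open>A nondecreasing index that tends to infinity and is at least \<open>N j\<close>.\<close>
  define M where "M j = j + (\<Sum>i\<le>j. N i)" for j
  have M_N: "N j \<le> M j" for j
    unfolding M_def by (rule trans_le_add2) (rule member_le_sum, auto)
  have M_mono: "M j \<le> M (Suc j)" for j by (simp add: M_def)
  have M_ge: "j \<le> M j" for j by (simp add: M_def)
  define G where "G j = (case j of 0 \<Rightarrow> F (M 0) | Suc i \<Rightarrow> F (M (Suc i)) - F (M i))" for j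
  have G_fin: "finite (G j)" for j using F_fin by (auto simp: G_def split: nat.split)
  have G_minus: "- k \<in> G j \<longleftrightarrow> k \<in> G j" for k j by (auto simp: G_def F_minus split: nat.splits)
  have G_sum: "(\<Sum>k\<in>G (Suc j). (norm (c k))\<^sup>2) \<le> (1/4)^j" for j
  proof -
    have "(\<Sum>k\<in>G (Suc j). (norm (c k))\<^sup>2) = s (M (Suc j)) - s (M j)"
      unfolding s_def G_def using F_fin F_mono[OF M_mono] by (simp add: sum_diff)
    then show ?thesis using N[of j "M (Suc j)" "M j"] M_N[of j] M_mono[of j] by (simp add: abs_le_iff)
  qed
  have real: "Im (trig_sum c (G j) x) = 0" for j x
  proof -
    have "cnj (trig_sum c (G j) x) = (\<Sum>k\<in>G j. c (- k) * wave (- k) x)"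
      by (simp add: trig_sum_def cnj_wave sym)
    also have "\<dots> = trig_sum c (G j) x"
      unfolding trig_sum_def
      by (rule sum.reindex_bij_witness[where i = uminus and j = uminus]) (auto simp: G_minus)
    finally show ?thesis by (simp add: complex_eq_iff)
  qed
  define p where "p j x = Re (trig_sum c (G j) x)" for j x
  have p: "of_real (p j x) = trig_sum c (G j) x" for j x
    using real by (simp add: p_def complex_eq_iff)
  have p_abs: "\<bar>p j x\<bar> = norm (trig_sum c (G j) x)" for j x
    by (metis p norm_of_real)
  have p_meas [measurable]: "p j \<in> borel_measurable borel" for j unfolding p_def[abs_def] by measurable
  have p_int: "set_integrable lborel cell (p j)" for j
    by (rule set_integrable_bounded[OF p_meas, where B = "\<Sum>k\<in>G j. norm (c k)"]) (simp add: p_abs norm_trig_sum_le)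
  have p_int2: "set_integrable lborel cell (\<lambda>x. (p j x)\<^sup>2)" for j
  proof (rule set_integrable_bounded)
    fix x :: "real^'d"
    have "norm ((p j x)\<^sup>2) = (norm (trig_sum c (G j) x))\<^sup>2" by (simp add: p_abs[symmetric])
    also have "\<dots> \<le> (\<Sum>k\<in>G j. norm (c k))\<^sup>2" by (intro power_mono norm_trig_sum_le) simp
    finally show "norm ((p j x)\<^sup>2) \<le> (\<Sum>k\<in>G j. norm (c k))\<^sup>2" .
  qed simp
  have one: "set_integrable lborel (cell :: (real^'d) set) (\<lambda>x. a :: real)" for a
    by (rule set_integrable_bounded[where B = "\<bar>a\<bar>"]) auto
  have p_L1: "(LINT x:cell|lborel. \<bar>p (Suc j) x\<bar>) \<le> V * (1/2)^j" for j
  proof -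
    let ?q = "(1/2::real)^j"
    have q: "0 < ?q" "(1/4::real)^j = ?q * ?q" by (simp_all add: power_mult_distrib[symmetric])
    \<comment> \<open>The \<open>L\<^sup>1\<close> norm is bounded by the \<open>L\<^sup>2\<close> norm through
      \<open>2|p| \<le> 2\<^sup>-\<^sup>j + 2\<^sup>j p\<^sup>2\<close>.\<close>
    have "(LINT x:cell|lborel. \<bar>p (Suc j) x\<bar>) \<le> (LINT x:cell|lborel. ?q / 2 * 1 + 1 / (2 * ?q) * (p (Suc j) x)\<^sup>2)"
    proof (rule set_integral_mono)
      show "set_integrable lborel cell (\<lambda>x. \<bar>p (Suc j) x\<bar>)" by (rule set_integrable_abs[OF p_int])
      show "set_integrable lborel cell (\<lambda>x. ?q / 2 * 1 + 1 / (2 * ?q) * (p (Suc j) x)\<^sup>2)"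
        by (intro set_integral_add set_integrable_mult_right one p_int2)
      fix x
      have "2 * \<bar>p (Suc j) x\<bar> * ?q \<le> \<bar>p (Suc j) x\<bar>\<^sup>2 + ?q\<^sup>2" by (rule sum_squares_bound)
      then show "\<bar>p (Suc j) x\<bar> \<le> ?q / 2 * 1 + 1 / (2 * ?q) * (p (Suc j) x)\<^sup>2"
        using q by (simp add: field_simps power2_eq_square)
    qed
    also have "\<dots> = ?q / 2 * (LINT x:(cell::(real^'d) set)|lborel. 1) + 1 / (2 * ?q) * (LINT x:cell|lborel. (p (Suc j) x)\<^sup>2)"
      unfolding set_integral_mult_right[symmetric]
      by (intro set_integral_add(2) set_integrable_mult_right one p_int2)
    also have "(LINT x:cell|lborel. (p (Suc j) x)\<^sup>2) = V * (\<Sum>k\<in>G (Suc j). (norm (c k))\<^sup>2)"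
      unfolding V_def integral_trig_sum_norm2[OF G_fin, symmetric] by (simp add: p_abs[symmetric])
    also have "?q / 2 * (LINT x:(cell::(real^'d) set)|lborel. 1) + 1 / (2 * ?q) * (V * (\<Sum>k\<in>G (Suc j). (norm (c k))\<^sup>2))
        \<le> ?q / 2 * V + 1 / (2 * ?q) * (V * (?q * ?q))"
      using G_sum[of j] V q unfolding measure_cell V_def[symmetric] by (intro add_mono mult_left_mono) auto
    also have "\<dots> = V * ?q" by (simp add: field_simps)
    finally show ?thesis .
  qed
  have p_sum: "summable (\<lambda>j. LINT x:cell|lborel. \<bar>p j x\<bar>)"
  proof (subst summable_Suc_iff[symmetric], rule summable_comparison_test')
    show "summable (\<lambda>j. V * (1/2::real)^j)" by (intro summable_mult summable_geometric) simp
    show "norm (LINT x:cell|lborel. \<bar>p (Suc j) x\<bar>) \<le> V * (1/2)^j" for j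
    proof -
      have "0 \<le> (LINT x:cell|lborel. \<bar>p (Suc j) x\<bar>)"
        unfolding set_lebesgue_integral_def by (intro integral_nonneg_AE) simp
      then show ?thesis using p_L1[of j] by simp
    qed
  qed
  define f where "f x = (\<Sum>j. p j x)" for x
  have per: "periodic f"
    unfolding periodic_def f_def p_def trig_sum_def by (simp add: wave_periodic)
  define h where "h \<phi> j x = indicator cell x *\<^sub>R (complex_of_real (p j x) * wave \<phi> x)" for \<phi> j x
  have h_norm: "norm (h \<phi> j x) = indicator cell x *\<^sub>R \<bar>p j x\<bar>" for \<phi> j x
    by (simp add: h_def norm_mult)
  have h_int: "integrable lborel (h \<phi> j)" for \<phi> j
  proof -
    have "set_integrable lborel cell (\<lambda>x. complex_of_real (p j x) * wave \<phi> x)"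
      by (rule set_integrable_fourier[OF p_int])
    then show ?thesis by (simp add: set_integrable_def h_def[abs_def])
  qed
  have h_sum: "summable (\<lambda>j. LINT x|lborel. norm (h \<phi> j x))" for \<phi>
    unfolding h_norm using p_sum by (simp add: set_lebesgue_integral_def)
  have h_AE: "AE x in lborel. summable (\<lambda>j. norm (h \<phi> j x))" for \<phi>
    by (rule AE_summable_norm[OF h_int h_sum])
  note h_lim = integrable_suminf[OF h_int h_AE h_sum] sums_integral[OF h_int h_AE h_sum]
  have h_f: "(\<Sum>j. h \<phi> j x) = indicator cell x *\<^sub>R (complex_of_real (f x) * wave \<phi> x)"
    if "summable (\<lambda>j. norm (h \<phi> j x))" for \<phi> x
  proof (cases "x \<in> cell")
    case True
    then have "summable (\<lambda>j. \<bar>p j x\<bar>)" using that by (simp add: h_norm)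
    then have "summable (\<lambda>j. p j x)" by (rule summable_rabs_cancel)
    then have "(\<lambda>j. p j x) sums f x" unfolding f_def by (rule summable_sums)
    then have "(\<lambda>j. complex_of_real (p j x) * wave \<phi> x) sums (complex_of_real (f x) * wave \<phi> x)"
      by (intro sums_mult2 sums_of_real)
    then show ?thesis using True by (simp add: h_def sums_unique[symmetric])
  qed (simp add: h_def)
  have f_AE: "AE x in lborel. (\<Sum>j. h \<phi> j x) = indicator cell x *\<^sub>R (complex_of_real (f x) * wave \<phi> x)" for \<phi>
    using h_AE[of \<phi>] by eventually_elim (rule h_f)
  have f_meas [measurable]: "f \<in> borel_measurable borel" unfolding f_def[abs_def] by measurable
  have f_int: "set_integrable lborel cell f"
  proof -
    have "integrable lborel (\<lambda>x. indicator cell x *\<^sub>R (complex_of_real (f x) * wave 0 x))"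
      by (subst integrable_cong_AE[OF _ _ f_AE[of 0, THEN AE_symmetric]])
        (use h_lim(1)[of 0] in auto)
    then have "integrable lborel (\<lambda>x. complex_of_real (indicator cell x *\<^sub>R f x))"
      by (simp add: scaleR_conv_of_real)
    then show ?thesis unfolding set_integrable_def by (simp only: complex_of_real_integrable_eq)
  qed
  have "fourier f k = c k" for k
  proof -
    have I: "(LINT x|lborel. h (- k) j x) = (if k \<in> G j then V * c k else 0)" for j
      using integral_trig_sum_wave[OF G_fin[of j], of c k] by (simp add: h_def p set_lebesgue_integral_def V_def)
    have part: "(\<Sum>j<Suc n. LINT x|lborel. h (- k) j x) = (if k \<in> F (M n) then V * c k else 0)" for n
    proof (induction n)
      case 0
      show ?case by (simp add: I G_def)
    next
      case (Suc n)
      then show ?case using F_mono[OF M_mono[of n]] by (auto simp: I G_def)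
    qed
    obtain n0 where n0: "k \<in> F n0" using F_all by blast
    have "\<forall>\<^sub>F n in sequentially. (\<Sum>j<Suc n. LINT x|lborel. h (- k) j x) = V * c k"
      unfolding part
      using eventually_ge_at_top[of n0]
    proof eventually_elim
      case (elim n)
      have "n0 \<le> M n" using elim M_ge[of n] by linarith
      then show ?case using F_mono n0 by auto
    qed
    then have "(\<lambda>n. \<Sum>j<Suc n. LINT x|lborel. h (- k) j x) \<longlonglongrightarrow> V * c k"
      by (rule tendsto_eventually)
    moreover have "(\<lambda>n. \<Sum>j<Suc n. LINT x|lborel. h (- k) j x) \<longlonglongrightarrow> (LINT x|lborel. (\<Sum>j. h (- k) j x))"
      using h_lim(2)[of "- k"] unfolding sums_def by (rule LIMSEQ_Suc)
    ultimately have "V * c k = (LINT x|lborel. (\<Sum>j. h (- k) j x))" by (rule LIMSEQ_unique)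
    also have "\<dots> = (LINT x:cell|lborel. complex_of_real (f x) * wave (- k) x)"
      unfolding set_lebesgue_integral_def
      by (rule integral_cong_AE[OF _ _ f_AE]) (use h_lim(1)[of "- k"] in auto)
    finally have "V * c k = (LINT x:cell|lborel. complex_of_real (f x) * wave (- k) x)" .
    then have "fourier f k = V * c k / of_real V"
      unfolding fourier_wave V_def by simp
    then show ?thesis using V by simp
  qed
  then show ?thesis using per f_int by blast
qed

section \<open>Fourier series on the torus: uniqueness\<close>

inductive trig_poly :: "(real^'d \<Rightarrow> complex) \<Rightarrow> bool" where
  wave: "trig_poly (\<lambda>x. c * wave k x)"
| add: "trig_poly \<phi> \<Longrightarrow> trig_poly \<psi> \<Longrightarrow> trig_poly (\<lambda>x. \<phi> x + \<psi> x)"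

lemma trig_poly_wave_mult: "trig_poly \<phi> \<Longrightarrow> trig_poly (\<lambda>x. (c * wave k x) * \<phi> x)"
proof (induction rule: trig_poly.induct)
  case (wave d l)
  show ?case using trig_poly.wave[of "c * d" "k + l"] by (simp add: wave_mult[symmetric] mult_ac)
next
  case (add \<phi> \<psi>)
  then show ?case using trig_poly.add[OF add.IH] by (simp add: algebra_simps)
qed

lemma trig_poly_mult: "trig_poly \<phi> \<Longrightarrow> trig_poly \<psi> \<Longrightarrow> trig_poly (\<lambda>x. \<phi> x * \<psi> x)"
proof (induction rule: trig_poly.induct)
  case (wave c k)
  then show ?case by (rule trig_poly_wave_mult)
next
  case (add \<phi>1 \<phi>2)
  then show ?case using trig_poly.add[OF add.IH(1)[OF add.prems] add.IH(2)[OF add.prems]] by (simp add: algebra_simps)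
qed

lemma integral_trig_poly_zero:
  fixes f :: "real^'d \<Rightarrow> real"
  assumes f: "set_integrable lborel cell f" and zero: "\<And>k. fourier f k = 0" and \<phi>: "trig_poly \<phi>"
  shows "set_integrable lborel cell (\<lambda>x. complex_of_real (f x) * \<phi> x) \<and>
    (LINT x:cell|lborel. complex_of_real (f x) * \<phi> x) = 0"
  using \<phi>
proof (induction rule: trig_poly.induct)
  case (wave c k)
  have int: "set_integrable lborel cell (\<lambda>x. complex_of_real (f x) * wave k x)"
    by (rule set_integrable_fourier[OF f])
  have "(LINT x:cell|lborel. complex_of_real (f x) * wave k x) = 0"
    using zero[of "- k"] by (simp add: fourier_wave)
  moreover have "(\<lambda>x. complex_of_real (f x) * (c * wave k x)) = (\<lambda>x. c * (complex_of_real (f x) * wave k x))"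
    by (simp add: mult_ac)
  ultimately show ?case using int by (simp add: set_integrable_mult_right)
next
  case (add \<phi> \<psi>)
  then show ?case by (simp add: distrib_left set_integral_add)
qed

text \<open>
  Periodicity is built in by passing to the compact set \<open>torus\<close>, on which the trigonometric polynomials
  separate points, so that the Stone--Weierstrass theorem applies.
\<close>

definition torus_map :: "real^'d \<Rightarrow> complex^'d" where
  "torus_map x = (\<chi> i. cis (x $ i))"

definition torus :: "(complex^'d) set" where
  "torus = {v. \<forall>i. norm (v $ i) = 1}"

lemma torus_map_in [simp]: "torus_map x \<in> torus"
  by (simp add: torus_map_def torus_def)

lemma compact_torus: "compact torus"
proof (rule compact_eq_bounded_closed[THEN iffD2, OF conjI])
  have "norm v \<le> real CARD('d)" if "v \<in> torus" for v :: "complex^'d"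
    using that L2_set_le_sum[of UNIV "\<lambda>i. norm (v $ i)"] by (simp add: norm_vec_def torus_def)
  then show "bounded (torus :: (complex^'d) set)" by (rule boundedI)
  show "closed (torus :: (complex^'d) set)"
    unfolding torus_def by (intro closed_Collect_all closed_Collect_eq continuous_intros)
qed

lemma continuous_torus_map: "continuous_on S torus_map"
  unfolding torus_map_def[abs_def]
  by (rule continuous_on_vec_lambda) (intro continuous_on_cis continuous_on_component continuous_on_id)

lemma torus_map_inj:
  assumes "torus_map x = torus_map y" "\<And>i. 0 \<le> x $ i \<and> x $ i < 2 * pi" "\<And>i. 0 \<le> y $ i \<and> y $ i < 2 * pi"
  shows "x = y"
proof (subst vec_eq_iff, intro allI)
  fix i
  have "exp (\<i> * complex_of_real (x $ i)) = exp (\<i> * complex_of_real (y $ i))"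
    using assms(1) by (simp add: torus_map_def vec_eq_iff cis_conv_exp)
  moreover have "\<bar>Im (\<i> * complex_of_real (x $ i)) - Im (\<i> * complex_of_real (y $ i))\<bar> < 2 * pi"
    using assms(2)[of i] assms(3)[of i] unfolding abs_less_iff by simp
  ultimately have "\<i> * complex_of_real (x $ i) = \<i> * complex_of_real (y $ i)"
    by (rule exp_complex_eqI[rotated])
  from arg_cong[OF this, of Im] show "x $ i = y $ i" by simp
qed

lemma wavevector_axis: "wavevector (axis i n) \<bullet> x = of_int n * x $ i"
proof -
  have "wavevector (axis i n) = axis i (of_int n)" by (simp add: wavevector_def vec_eq_iff axis_def)
  then show ?thesis by (simp add: inner_axis')
qed

lemma integral_continuous_zero:
  fixes f :: "real^'d \<Rightarrow> real" and h :: "complex^'d \<Rightarrow> real"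
  assumes f: "set_integrable lborel cell f" and zero: "\<And>k. fourier f k = 0" and h: "continuous_on torus h"
  shows "(LINT x:cell|lborel. f x * h (torus_map x)) = 0"
proof -
  define P where "P h \<longleftrightarrow> continuous_on torus h \<and> trig_poly (\<lambda>x. complex_of_real (h (torus_map x)))"
    for h :: "complex^'d \<Rightarrow> real"
  have meas: "(\<lambda>x. h (torus_map x)) \<in> borel_measurable borel" if "continuous_on torus h" for h :: "complex^'d \<Rightarrow> real"
    by (intro borel_measurable_continuous_onI continuous_on_compose2[OF that continuous_torus_map]) auto
  have bdd: "\<exists>B. \<forall>x. \<bar>h (torus_map x)\<bar> \<le> B" if "continuous_on torus h" for h :: "complex^'d \<Rightarrow> real"
  proof -
    have "bounded (h ` torus)" by (intro compact_imp_bounded compact_continuous_image that compact_torus)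
    then obtain B where "\<forall>y\<in>h ` torus. norm y \<le> B" by (auto simp: bounded_iff)
    then show ?thesis by (intro exI[of _ B]) auto
  qed
  have int: "set_integrable lborel cell (\<lambda>x. f x * h (torus_map x))" if "continuous_on torus h" for h :: "complex^'d \<Rightarrow> real"
  proof -
    from bdd[OF that] obtain B where B: "\<forall>x. \<bar>h (torus_map x)\<bar> \<le> B" ..
    have "set_integrable lborel cell (\<lambda>x. complex_of_real (f x) * complex_of_real (h (torus_map x)))"
    proof (rule set_integrable_mult_bounded[where B = B])
      show "set_integrable lborel cell (\<lambda>x. complex_of_real (f x))"
        using f by (simp add: set_integrable_def complex_of_real_integrable_eq scaleR_conv_of_real flip: of_real_mult)
    qed (use B meas[OF that] in auto)
    then show ?thesis
      by (simp add: set_integrable_def complex_of_real_integrable_eq scaleR_conv_of_real flip: of_real_mult)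
  qed
  define F where "F = (LINT x:cell|lborel. \<bar>f x\<bar>)"
  have F: "0 \<le> F" unfolding F_def set_lebesgue_integral_def by (intro integral_nonneg_AE) simp
  have small: "\<bar>LINT x:cell|lborel. f x * h (torus_map x)\<bar> \<le> e" if e: "0 < e" for e
  proof -
    define e' where "e' = e / (F + 1)"
    have e': "0 < e'" "e' * F \<le> e" using e F by (auto simp: e'_def field_simps)
    have "\<exists>g. P g \<and> (\<forall>v\<in>torus. \<bar>h v - g v\<bar> < e')"
    proof (rule Stone_Weierstrass_HOL[OF compact_torus _ _ _ _ _ h e'(1)])
      show "P (\<lambda>v. c)" for c
        using trig_poly.wave[of "complex_of_real c" 0] by (simp add: P_def)
      show "continuous_on torus f" if "P f" for f using that by (simp add: P_def)
      show "P (\<lambda>v. f v + g v)" if "P f \<and> P g" for f g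
        using that unfolding P_def by (auto intro!: continuous_intros trig_poly.add)
      show "P (\<lambda>v. f v * g v)" if "P f \<and> P g" for f g
        using that unfolding P_def by (auto intro!: continuous_intros trig_poly_mult)
      fix v w :: "complex^'d" assume "v \<in> torus \<and> w \<in> torus \<and> v \<noteq> w"
      then obtain i where i: "v $ i \<noteq> w $ i" by (auto simp: vec_eq_iff)
      have "trig_poly (\<lambda>x. (1/2) * wave (axis i 1) x + (1/2) * wave (axis i (- 1)) x)"
        by (intro trig_poly.intros)
      moreover have "(\<lambda>x. (1/2) * wave (axis i 1) x + (1/2) * wave (axis i (- 1)) x) = (\<lambda>x. complex_of_real (Re (torus_map x $ i)))"
        by (simp add: wave_def wavevector_axis torus_map_def complex_eq_iff fun_eq_iff)
      ultimately have re: "P (\<lambda>v. Re (v $ i))"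
        unfolding P_def by (simp only:) (intro conjI continuous_intros TrueI)
      have "trig_poly (\<lambda>x. (- \<i>/2) * wave (axis i 1) x + (\<i>/2) * wave (axis i (- 1)) x)"
        by (intro trig_poly.intros)
      moreover have "(\<lambda>x. (- \<i>/2) * wave (axis i 1) x + (\<i>/2) * wave (axis i (- 1)) x) = (\<lambda>x. complex_of_real (Im (torus_map x $ i)))"
        by (simp add: wave_def wavevector_axis torus_map_def complex_eq_iff fun_eq_iff)
      ultimately have im: "P (\<lambda>v. Im (v $ i))"
        unfolding P_def by (simp only:) (intro conjI continuous_intros TrueI)
      show "\<exists>f. P f \<and> f v \<noteq> f w" using re im i complex_eq_iff by blast
    qed
    then obtain g where g: "P g" "\<And>v. v \<in> torus \<Longrightarrow> \<bar>h v - g v\<bar> < e'" by blast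
    have gc: "continuous_on torus g" using g(1) by (simp add: P_def)
    have "complex_of_real (LINT x:cell|lborel. f x * g (torus_map x)) = (LINT x:cell|lborel. of_real (f x * g (torus_map x)))"
      by (rule set_integral_complex_of_real[symmetric])
    also have "\<dots> = 0" using integral_trig_poly_zero[OF f zero, of "\<lambda>x. of_real (g (torus_map x))"] g(1) by (simp add: P_def)
    finally have g0: "(LINT x:cell|lborel. f x * g (torus_map x)) = 0" by simp
    have "(LINT x:cell|lborel. f x * h (torus_map x)) =
        (LINT x:cell|lborel. f x * h (torus_map x)) - (LINT x:cell|lborel. f x * g (torus_map x))"
      using g0 by simp
    also have "\<dots> = (LINT x:cell|lborel. f x * h (torus_map x) - f x * g (torus_map x))"
      by (rule set_integral_diff(2)[symmetric]) (rule int[OF h], rule int[OF gc])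
    finally have eq: "(LINT x:cell|lborel. f x * h (torus_map x)) =
        (LINT x:cell|lborel. f x * h (torus_map x) - f x * g (torus_map x))" .
    have "\<bar>LINT x:cell|lborel. f x * h (torus_map x) - f x * g (torus_map x)\<bar> \<le> (LINT x:cell|lborel. e' * \<bar>f x\<bar>)"
      unfolding set_lebesgue_integral_def real_norm_def[symmetric]
    proof (rule order.trans[OF Bochner_Integration.integral_norm_bound Bochner_Integration.integral_mono])
      show "integrable lborel (\<lambda>x. norm (indicator cell x *\<^sub>R (f x * h (torus_map x) - f x * g (torus_map x))))"
        using set_integral_diff(1)[OF int[OF h] int[OF gc]] unfolding set_integrable_def by (rule integrable_norm)
      show "integrable lborel (\<lambda>x. indicator cell x *\<^sub>R (e' * norm (f x)))"
        using set_integrable_mult_right[OF set_integrable_abs[OF f], of e'] by (simp add: set_integrable_def)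
      fix x
      have "\<bar>f x * h (torus_map x) - f x * g (torus_map x)\<bar> = \<bar>f x\<bar> * \<bar>h (torus_map x) - g (torus_map x)\<bar>"
        by (simp add: abs_mult[symmetric] right_diff_distrib)
      also have "\<dots> \<le> \<bar>f x\<bar> * e'" using g(2)[of "torus_map x"] by (intro mult_left_mono) auto
      finally show "norm (indicator cell x *\<^sub>R (f x * h (torus_map x) - f x * g (torus_map x))) \<le> indicator cell x *\<^sub>R (e' * norm (f x))"
        by (auto simp: indicator_def mult.commute)
    qed
    also have "\<dots> = e' * F" by (simp add: F_def)
    finally show ?thesis using e'(2) eq by simp
  qed
  have "\<bar>LINT x:cell|lborel. f x * h (torus_map x)\<bar> \<le> 0 + e" if "0 < e" for e
    using small[OF that] by simp
  then have "\<bar>LINT x:cell|lborel. f x * h (torus_map x)\<bar> \<le> 0" by (rule field_le_epsilon)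
  then show ?thesis by simp
qed

lemma AE_cell_interior: "AE x :: real^'d in lborel. x \<in> cell \<longrightarrow> (\<forall>i. x $ i < 2 * pi)"
proof -
  have "AE x in lborel. x $ i \<noteq> 2 * pi" for i :: 'd
  proof -
    have "negligible {x :: real^'d. x $ i = 2 * pi}" 
      using negligible_standard_hyperplane[of "axis i (1::real)" "2 * pi"] by (simp add: inner_axis)
    moreover have "{x :: real^'d. x $ i = 2 * pi} \<in> sets borel"
      by (intro borel_closed closed_Collect_eq continuous_intros)
    ultimately have "{x :: real^'d. x $ i = 2 * pi} \<in> null_sets lborel"
      by (auto simp: negligible_iff_null_sets null_sets_def)
    then show ?thesis by (intro AE_I'[where N = "{x. x $ i = 2 * pi}"]) auto
  qed
  then have "AE x :: real^'d in lborel. \<forall>i. x $ i \<noteq> 2 * pi" by (simp add: AE_all_countable)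
  then show "AE x :: real^'d in lborel. x \<in> cell \<longrightarrow> (\<forall>i. x $ i < 2 * pi)"
    by eventually_elim (auto simp: mem_cell less_le)
qed

text \<open>
  The indicator of the compact set \<open>torus_map ` B\<close> is a bounded pointwise limit of continuous
  functions on the torus. The map is injective on the half-open cell, and the rest of the cell is a null set.
\<close>

lemma integral_compact_zero:
  fixes f :: "real^'d \<Rightarrow> real"
  assumes f: "set_integrable lborel cell f" and zero: "\<And>k. fourier f k = 0"
    and B: "compact B" "\<And>x i. x \<in> B \<Longrightarrow> 0 \<le> x $ i \<and> x $ i < 2 * pi"
  shows "(LINT x:B|lborel. f x) = 0"
proof (cases "B = {}")
  case False
  define C where "C = torus_map ` B"
  have C: "closed C" "C \<noteq> {}"
    unfolding C_def using False
    by (auto intro!: compact_imp_closed compact_continuous_image B continuous_torus_map)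
  define h where "h n v = max 0 (1 - real n * infdist v C)" for n and v :: "complex^'d"
  have h_cont: "continuous_on S (h n)" for S n unfolding h_def by (intro continuous_intros)
  have h_bd: "\<bar>h n v\<bar> \<le> 1" for n v by (auto simp: h_def infdist_nonneg)
  have h_lim: "(\<lambda>n. h n v) \<longlonglongrightarrow> indicator C v" for v
  proof (cases "v \<in> C")
    case True
    then show ?thesis by (simp add: h_def)
  next
    case False
    then have pos: "0 < infdist v C"
      using C in_closed_iff_infdist_zero[of C v] infdist_nonneg[of v C] by linarith
    obtain N :: nat where N: "1 / infdist v C < real N" using reals_Archimedean2 by blast
    have "h n v = 0" if "N \<le> n" for n
    proof -
      have "1 < real N * infdist v C" using N pos by (simp add: field_simps)
      also have "\<dots> \<le> real n * infdist v C" using that pos by (intro mult_right_mono) auto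
      finally show ?thesis by (simp add: h_def)
    qed
    then have "\<forall>\<^sub>F n in sequentially. h n v = 0" by (auto simp: eventually_sequentially)
    then show ?thesis using False by (simp add: tendsto_eventually)
  qed
  have fm: "(\<lambda>x. indicator cell x *\<^sub>R f x) \<in> borel_measurable lborel"
    using f by (simp add: set_integrable_def borel_measurable_integrable)
  have hm: "(\<lambda>x. h n (torus_map x)) \<in> borel_measurable borel" for n
    by (intro borel_measurable_continuous_onI continuous_on_compose2[OF h_cont continuous_torus_map]) auto
  have Cm: "(\<lambda>x. indicator C (torus_map x) :: real) \<in> borel_measurable borel"
    by (rule borel_measurable_LIMSEQ_metric[OF hm]) (rule h_lim)
  have "(\<lambda>n. LINT x|lborel. (indicator cell x *\<^sub>R f x) * h n (torus_map x)) \<longlonglongrightarrow>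
      (LINT x|lborel. (indicator cell x *\<^sub>R f x) * indicator C (torus_map x))"
  proof (rule integral_dominated_convergence[where w = "\<lambda>x. norm (indicator cell x *\<^sub>R f x)"])
    show "AE x in lborel. (\<lambda>n. (indicator cell x *\<^sub>R f x) * h n (torus_map x)) \<longlonglongrightarrow> (indicator cell x *\<^sub>R f x) * indicator C (torus_map x)"
      by (intro always_eventually allI tendsto_mult tendsto_const h_lim)
    show "AE x in lborel. norm ((indicator cell x *\<^sub>R f x) * h n (torus_map x)) \<le> norm (indicator cell x *\<^sub>R f x)" for n
      using h_bd by (auto simp: abs_mult intro!: mult_left_le)
    show "integrable lborel (\<lambda>x. norm (indicator cell x *\<^sub>R f x))"
      using f by (simp add: set_integrable_def)
  qed (use fm hm Cm in auto)
  moreover have "(LINT x|lborel. (indicator cell x *\<^sub>R f x) * h n (torus_map x)) = 0" for n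
    using integral_continuous_zero[OF f zero h_cont, of n] by (simp add: set_lebesgue_integral_def mult.assoc)
  ultimately have "(LINT x|lborel. (indicator cell x *\<^sub>R f x) * indicator C (torus_map x)) = 0"
    using LIMSEQ_unique[OF tendsto_const] by fastforce
  moreover have "(LINT x|lborel. (indicator cell x *\<^sub>R f x) * indicator C (torus_map x)) = (LINT x:B|lborel. f x)"
    unfolding set_lebesgue_integral_def
  proof (rule integral_cong_AE)
    have sub: "B \<subseteq> cell"
    proof
      fix x assume "x \<in> B"
      then show "x \<in> cell" using B(2)[of x] by (simp add: mem_cell less_imp_le)
    qed
    have "set_integrable lborel B f"
      by (rule set_integrable_subset[OF f _ sub]) (use borel_compact[OF B(1)] in simp)
    then show "(\<lambda>x. indicator B x *\<^sub>R f x) \<in> borel_measurable lborel"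
      by (simp add: set_integrable_def borel_measurable_integrable)
    show "(\<lambda>x. (indicator cell x *\<^sub>R f x) * indicator C (torus_map x)) \<in> borel_measurable lborel"
      using fm Cm by auto
    show "AE x in lborel. (indicator cell x *\<^sub>R f x) * indicator C (torus_map x) = indicator B x *\<^sub>R f x"
      using AE_cell_interior
    proof eventually_elim
      case (elim x)
      have "x \<in> B" if x: "x \<in> cell" "torus_map x \<in> C"
      proof -
        obtain y where y: "y \<in> B" "torus_map x = torus_map y" using x(2) by (auto simp: C_def)
        have "x = y" by (rule torus_map_inj[OF y(2)]) (use elim x(1) B(2)[OF y(1)] in \<open>auto simp: mem_cell\<close>)
        then show ?thesis using y(1) by simp
      qed
      moreover have "x \<in> cell \<and> torus_map x \<in> C" if "x \<in> B" using that sub by (auto simp: C_def)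
      ultimately show ?case by (auto simp: indicator_def)
    qed
  qed
  ultimately show ?thesis by simp
qed (simp add: set_lebesgue_integral_def)

text \<open>
  The set where \<open>f > 0\<close> is exhausted up to small measure by compact sets. On each of these the integral of \<open>f\<close>
  vanishes, so each is a null set.
\<close>

lemma fourier_zero_imp_nonpos:
  fixes f :: "real^'d \<Rightarrow> real"
  assumes f: "set_integrable lborel cell f" and zero: "\<And>k. fourier f k = 0"
  shows "AE x in lborel. x \<in> cell \<longrightarrow> f x \<le> 0"
proof -
  define S where "S = {x. 0 < indicator cell x *\<^sub>R f x} \<inter> {x. \<forall>i. x $ i < 2 * pi}"
  have [measurable]: "(\<lambda>x. indicator cell x *\<^sub>R f x) \<in> borel_measurable borel"
    using borel_measurable_integrable[of lborel "\<lambda>x. indicator cell x *\<^sub>R f x"] f by (simp add: set_integrable_def)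
  have "{x. 0 < indicator cell x *\<^sub>R f x} \<in> sets borel" by measurable
  moreover have "{x :: real^'d. \<forall>i. x $ i < 2 * pi} \<in> sets borel"
  proof -
    have "{x :: real^'d. \<forall>i. x $ i < 2 * pi} = (\<Inter>i\<in>UNIV. {x. x $ i < 2 * pi})" by auto
    moreover have "open {x :: real^'d. x $ i < 2 * pi}" for i
      by (intro open_Collect_less continuous_intros)
    ultimately show ?thesis by (simp add: borel_open open_INT)
  qed
  ultimately have S: "S \<in> sets borel" unfolding S_def by (rule sets.Int)
  have S_cell: "x \<in> cell" "0 < f x" "\<And>i. x $ i < 2 * pi" if "x \<in> S" for x
    using that by (cases "x \<in> cell"; simp add: S_def)+
  have null: "emeasure lborel K = 0" if K: "closed K" "K \<subseteq> S" for K
  proof -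
    have KB: "K \<in> sets borel" using K(1) by simp
    have "K \<subseteq> cell" using K(2) S_cell by auto
    then have "bounded K" unfolding cell_def by (rule bounded_subset[OF bounded_cbox])
    then have "compact K" using K(1) by (simp add: compact_eq_bounded_closed)
    then have "(LINT x:K|lborel. f x) = 0"
      using S_cell K(2) by (intro integral_compact_zero[OF f zero]) (auto simp: mem_cell subset_iff)
    moreover have "integrable lborel (\<lambda>x. indicator K x *\<^sub>R f x)"
      using set_integrable_subset[OF f _ \<open>K \<subseteq> cell\<close>] KB by (simp add: set_integrable_def)
    moreover have "AE x in lborel. 0 \<le> indicator K x *\<^sub>R f x"
      using S_cell(2) K(2) by (auto simp: indicator_def subset_iff less_imp_le)
    ultimately have "AE x in lborel. indicator K x *\<^sub>R f x = 0"
      unfolding set_lebesgue_integral_def by (simp add: integral_nonneg_eq_0_iff_AE)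
    then have "AE x in lborel. x \<notin> K"
    proof eventually_elim
      case (elim x)
      then show ?case using S_cell(2)[of x] K(2) by (auto simp: indicator_def split: if_splits)
    qed
    then show ?thesis using KB AE_iff_null_sets[of K lborel] by (auto dest: null_setsD1)
  qed
  have "emeasure lebesgue S \<le> 0"
  proof (rule ennreal_le_epsilon)
    fix e :: real assume e: "0 < e"
    have "S \<in> sets lebesgue" using S by simp
    then obtain K where K: "closed K" "K \<subseteq> S" "S - K \<in> lmeasurable" "emeasure lebesgue (S - K) < ennreal e"
      using e by (rule sets_lebesgue_inner_closed)
    have "emeasure lebesgue S = emeasure lebesgue (K \<union> (S - K))" using K(2) by (simp add: Un_absorb1)
    also have "\<dots> \<le> emeasure lebesgue K + emeasure lebesgue (S - K)"
      using K by (intro emeasure_subadditive) (auto simp: fmeasurableD)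
    also have "emeasure lebesgue K = 0" using null[OF K(1,2)] K(1) by simp
    finally show "emeasure lebesgue S \<le> 0 + ennreal e" using K(4) by simp
  qed
  then have "emeasure lborel S = 0" using S by simp
  then have "S \<in> null_sets lborel" using S by auto
  then have "AE x in lborel. x \<notin> S" by (rule AE_not_in)
  then show ?thesis
    using AE_cell_interior by eventually_elim (auto simp: S_def indicator_def)
qed

lemma fourier_diff:
  fixes f g :: "real^'d \<Rightarrow> real"
  assumes "set_integrable lborel cell f" "set_integrable lborel cell g"
  shows "fourier (\<lambda>x. f x - g x) k = fourier f k - fourier g k"
  unfolding fourier_wave of_real_diff left_diff_distrib
  by (simp add: set_integral_diff(2)[OF set_integrable_fourier[OF assms(1)] set_integrable_fourier[OF assms(2)]] diff_divide_distrib)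

lemma fourier_uminus: "fourier (\<lambda>x. - f x) k = - fourier f k"
proof -
  have "(\<lambda>x. indicator cell x *\<^sub>R (complex_of_real (- f x) * cis (- (wavevector k \<bullet> x)))) =
      (\<lambda>x. - (indicator cell x *\<^sub>R (complex_of_real (f x) * cis (- (wavevector k \<bullet> x)))))" by auto
  then show ?thesis unfolding fourier_def set_lebesgue_integral_def by simp
qed

lemma periodic_shift:
  assumes "periodic f"
  shows "f (x + (2 * pi) *\<^sub>R wavevector k) = f x"
proof -
  have nat_shift: "f (x + axis i (2 * pi * real n)) = f x" for x i n
  proof (induction n arbitrary: x)
    case (Suc n)
    have "x + axis i (2 * pi * real (Suc n)) = (x + axis i (2 * pi * real n)) + axis i (2 * pi)"
      by (simp add: vec_eq_iff axis_def algebra_simps)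
    then show ?case using assms Suc unfolding periodic_def by metis
  next
    case 0
    have "axis i (0::real) = 0" by (simp add: vec_eq_iff axis_def)
    then show ?case by (simp add: \<open>axis i 0 = 0\<close>)
  qed
  have int_shift: "f (x + axis i (2 * pi * of_int n)) = f x" for x i n
  proof (cases "0 \<le> n")
    case True
    then show ?thesis using nat_shift[of x i "nat n"] by simp
  next
    case False
    have "x + axis i (2 * pi * of_int n) + axis i (2 * pi * real (nat (- n))) = x"
      using False by (simp add: vec_eq_iff axis_def)
    then show ?thesis using nat_shift[of "x + axis i (2 * pi * of_int n)" i "nat (- n)"] by metis
  qed
  have "f (x + (\<Sum>i\<in>A. axis i (2 * pi * of_int (k $ i)))) = f x" if "finite A" for A
    using that
  proof (induction A)
    case (insert j A)
    have eq: "x + (\<Sum>i\<in>insert j A. axis i (2 * pi * of_int (k $ i))) =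
        x + (\<Sum>i\<in>A. axis i (2 * pi * of_int (k $ i))) + axis j (2 * pi * of_int (k $ j))"
      using insert.hyps by simp
    show ?case unfolding eq int_shift by (rule insert.IH)
  qed simp
  from this[of UNIV] have "f (x + (\<Sum>i\<in>UNIV. axis i (2 * pi * of_int (k $ i)))) = f x" by simp
  moreover have "(\<Sum>i\<in>UNIV. axis i (2 * pi * of_int (k $ i))) = (2 * pi) *\<^sub>R wavevector k"
    by (simp add: vec_eq_iff axis_def wavevector_def if_distrib cong: if_cong)
  ultimately show ?thesis by simp
qed

lemma shift_into_cell:
  fixes x :: "real^'d"
  shows "\<exists>k. x - (2 * pi) *\<^sub>R wavevector k \<in> cell"
proof
  define k :: "int^'d" where "k = (\<chi> i. \<lfloor>x $ i / (2 * pi)\<rfloor>)"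
  have "0 \<le> x $ i - 2 * pi * of_int (k $ i) \<and> x $ i - 2 * pi * of_int (k $ i) \<le> 2 * pi" for i
  proof -
    have "of_int (k $ i) \<le> x $ i / (2 * pi)" "x $ i / (2 * pi) < of_int (k $ i) + 1"
      by (simp_all add: k_def)
    then show ?thesis by (simp add: field_simps)
  qed
  then show "x - (2 * pi) *\<^sub>R wavevector k \<in> cell" by (simp add: mem_cell wavevector_def)
qed

text \<open>
  Countably many translates of the cell cover the space.
\<close>

lemma AE_periodic:
  assumes per: "\<And>x k. P (x - (2 * pi) *\<^sub>R wavevector (k :: int^'d)) \<Longrightarrow> P x"
    and AE: "AE x in lborel. x \<in> cell \<longrightarrow> P x"
  shows "AE x in lborel. P x"
proof -
  obtain N where N: "N \<in> null_sets lborel" "{x. \<not> (x \<in> cell \<longrightarrow> P x)} \<subseteq> N"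
    using AE by (auto elim!: AE_E simp: null_sets_def)
  have "(\<Union>k\<in>(UNIV :: (int^'d) set). {x. x - (2 * pi) *\<^sub>R wavevector k \<in> N}) \<in> null_sets lborel"
    by (intro null_sets_UN' null_sets_translation N) auto
  then show ?thesis
  proof (rule AE_I')
    show "{x \<in> space lborel. \<not> P x} \<subseteq> (\<Union>k. {x. x - (2 * pi) *\<^sub>R wavevector k \<in> N})"
      using shift_into_cell per N(2) by blast
  qed
qed

theorem fourier_unique:
  fixes f g :: "real^'d \<Rightarrow> real"
  assumes f: "periodic f" "set_integrable lborel cell f" and g: "periodic g" "set_integrable lborel cell g"
    and eq: "\<And>k. fourier f k = fourier g k"
  shows "AE x in lborel. f x = g x"
proof (rule AE_periodic)
  define u where "u x = f x - g x" for x
  have u: "set_integrable lborel cell u" unfolding u_def using f(2) g(2) by (rule set_integral_diff)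
  have "fourier u k = 0" for k
    using eq unfolding u_def by (simp add: fourier_diff f g)
  then have "AE x in lborel. x \<in> cell \<longrightarrow> u x \<le> 0" "AE x in lborel. x \<in> cell \<longrightarrow> - u x \<le> 0"
    using u fourier_zero_imp_nonpos[of u] fourier_zero_imp_nonpos[of "\<lambda>x. - u x"]
    by (auto simp: fourier_uminus set_integrable_def)
  then show "AE x in lborel. x \<in> cell \<longrightarrow> f x = g x"
    by eventually_elim (auto simp: u_def)
  fix x k assume "f (x - (2 * pi) *\<^sub>R wavevector (k :: int^'d)) = g (x - (2 * pi) *\<^sub>R wavevector k)"
  then show "f x = g x"
    using periodic_shift[OF f(1), of "x - (2 * pi) *\<^sub>R wavevector k" k]
      periodic_shift[OF g(1), of "x - (2 * pi) *\<^sub>R wavevector k" k] by simp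
qed

section \<open>Symbols and Sobolev spaces\<close>

abbreviation japanese :: "int^'d \<Rightarrow> real" where
  "japanese k \<equiv> 1 + (wavenumber k)\<^sup>2"

definition dispersion :: "real \<Rightarrow> int^'d \<Rightarrow> real" where
  "dispersion \<mu> k = G0 \<mu> (wavenumber k)"

definition coupling :: "real \<Rightarrow> (real \<Rightarrow> real) \<Rightarrow> int^'d \<Rightarrow> real" where
  "coupling \<delta> J k = (J (\<delta> * wavenumber k))\<^sup>2 * wavenumber k"

lemma japanese_powr_mono: "r \<le> s \<Longrightarrow> japanese k powr r \<le> japanese k powr s"
  by (rule powr_mono) simp_all

lemma wavenumber_le_japanese: "wavenumber k \<le> japanese k powr (1/2)"
proof -
  have "wavenumber k = sqrt ((wavenumber k)\<^sup>2)" by simp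
  also have "\<dots> \<le> sqrt (japanese k)" by (intro real_sqrt_le_mono) simp
  finally show ?thesis by (simp add: powr_half_sqrt)
qed

lemma sqrt_wavenumber_le_japanese: "sqrt (wavenumber k) \<le> japanese k powr (1/4)"
proof -
  have "sqrt (wavenumber k) \<le> sqrt (japanese k powr (1/2))"
    by (intro real_sqrt_le_mono wavenumber_le_japanese)
  also have "\<dots> = (japanese k powr (1/2)) powr (1/2)" by (rule powr_half_sqrt[symmetric]) simp
  also have "\<dots> = japanese k powr (1/4)" by (simp only: powr_powr) simp
  finally show ?thesis .
qed

lemma wavenumber_ge_1:
  assumes "k \<noteq> 0"
  shows "1 \<le> wavenumber k"
proof -
  obtain i where "k $ i \<noteq> 0" using assms by (auto simp: vec_eq_iff)
  then have "1 \<le> \<bar>k $ i\<bar>" by linarith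
  then have "1 \<le> \<bar>real_of_int (k $ i)\<bar>" by linarith
  also have "\<dots> = \<bar>wavevector k $ i\<bar>" by (simp add: wavevector_def)
  also have "\<dots> \<le> wavenumber k" by (rule component_le_norm_cart)
  finally show ?thesis .
qed

lemma dispersion_nonneg: "0 < \<mu> \<Longrightarrow> 0 \<le> dispersion \<mu> k"
  by (simp add: dispersion_def G0_def)

lemma dispersion_le: "dispersion \<mu> k \<le> wavenumber k"
proof -
  have "wavenumber k * tanh (sqrt \<mu> * wavenumber k) \<le> wavenumber k * 1"
    by (intro mult_left_mono less_imp_le[OF tanh_real_lt_1]) simp
  then show ?thesis by (simp add: dispersion_def G0_def)
qed

lemma dispersion_ge:
  assumes "1 \<le> \<mu>" "k \<noteq> 0"
  shows "tanh 1 * wavenumber k \<le> dispersion \<mu> k"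
proof -
  have "1 * 1 \<le> sqrt \<mu> * wavenumber k"
    using assms wavenumber_ge_1[OF assms(2)] by (intro mult_mono) auto
  then have "tanh 1 \<le> tanh (sqrt \<mu> * wavenumber k)" by simp
  then show ?thesis
    unfolding dispersion_def G0_def by (metis mult.commute mult_right_mono norm_ge_zero)
qed

lemma coupling_nonneg: "0 \<le> coupling \<delta> J k"
  by (simp add: coupling_def)

lemma norm_fourier_grad: "(norm (fourier_grad f k))\<^sup>2 = (wavenumber k)\<^sup>2 * (norm (fourier f k))\<^sup>2"
proof -
  have "(norm (fourier_grad f k))\<^sup>2 = (\<Sum>j\<in>UNIV. (norm (\<i> * of_int (k $ j) * fourier f k))\<^sup>2)"
    by (simp add: norm_vec_def L2_set_def sum_nonneg fourier_grad_def)
  also have "\<dots> = (\<Sum>j\<in>UNIV. (wavevector k $ j)\<^sup>2) * (norm (fourier f k))\<^sup>2"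
    by (simp add: norm_mult power_mult_distrib sum_distrib_right wavevector_def)
  also have "(\<Sum>j\<in>UNIV. (wavevector k $ j)\<^sup>2) = (wavenumber k)\<^sup>2"
    by (simp add: norm_vec_def L2_set_def sum_nonneg)
  finally show ?thesis .
qed

lemma toy_model_iff:
  "toy_model \<epsilon> \<mu> \<delta> J I \<zeta> \<psi> \<longleftrightarrow> (\<forall>k. mode_solution I (dispersion \<mu> k) (coupling \<delta> J k)
     (\<lambda>t. \<epsilon>\<^sup>2 * alpha \<mu> (\<psi> t)) (\<lambda>_. 0) (\<lambda>t. fourier (\<zeta> t) k) (\<lambda>t. fourier (\<psi> t) k))"
proof -
  have "- fourier (\<zeta> t) k + of_real (\<epsilon>\<^sup>2 * alpha \<mu> (\<psi> t)) * multiplier (\<lambda>\<xi>. (J (\<delta> * \<xi>))\<^sup>2 * \<xi>) (\<zeta> t) k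
      = (\<epsilon>\<^sup>2 * alpha \<mu> (\<psi> t) * coupling \<delta> J k - 1) *\<^sub>R fourier (\<zeta> t) k" for t k
    by (simp add: multiplier_def coupling_def scaleR_conv_of_real algebra_simps)
  moreover have "multiplier (G0 \<mu>) (\<psi> t) k = dispersion \<mu> k *\<^sub>R fourier (\<psi> t) k" for t k
    by (simp add: multiplier_def dispersion_def scaleR_conv_of_real)
  ultimately show ?thesis unfolding toy_model_def mode_solution_def by simp blast
qed

lemma alpha_eq: "alpha \<mu> \<psi> = (2 * pi) ^ CARD('d) * (\<Sum>\<^sub>\<infinity>k. (dispersion \<mu> k * norm (fourier \<psi> k))\<^sup>2)"
  for \<psi> :: "real^'d \<Rightarrow> real"
  by (simp add: alpha_def multiplier_def dispersion_def norm_mult power_mult_distrib)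

lemma mode_solution_cong:
  assumes "\<And>t. t \<in> I \<Longrightarrow> a t = a' t \<and> z t = z' t \<and> w t = w' t" and "mode_solution I g m a F z w"
  shows "mode_solution I g m a' F z' w'"
  unfolding mode_solution_def
proof (intro ballI conjI)
  fix t assume t: "t \<in> I"
  note sol = assms(2)[unfolded mode_solution_def, rule_format, OF t]
  have eq: "\<And>s. s \<in> I \<Longrightarrow> z' s = z s" "\<And>s. s \<in> I \<Longrightarrow> w' s = w s" using assms(1) by auto
  show "(z' has_vector_derivative g *\<^sub>R w' t) (at t within I)"
    using has_vector_derivative_transform[OF t eq(1) conjunct1[OF sol]] assms(1)[OF t] by simp
  show "(w' has_vector_derivative (a' t * m - 1) *\<^sub>R z' t + F t) (at t within I)"
    using has_vector_derivative_transform[OF t eq(2) conjunct2[OF sol]] assms(1)[OF t] by simp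
qed

lemma growth_rate_low:
  assumes "\<And>t. t \<in> I \<Longrightarrow> 0 \<le> a t \<and> a t \<le> A" "0 \<le> m" "0 \<le> g" "2 * (A * (m * sqrt g)) \<le> \<gamma>"
  shows "growth_rate I g m a \<gamma>"
  unfolding growth_rate_def
proof (intro exI[of _ "\<lambda>_. 0"] exI[of _ 0] conjI ballI)
  fix t assume t: "t \<in> I"
  have "\<bar>a t\<bar> * (m * sqrt g) \<le> A * (m * sqrt g)"
    using assms(1)[OF t] assms(2,3) by (intro mult_right_mono) auto
  then show "2 * (\<bar>a t - 0\<bar> * (m * sqrt g) + 0 * m) \<le> \<gamma>" using assms(4) by simp
qed auto

lemma growth_rate_high:
  assumes "\<And>t. t \<in> I \<Longrightarrow> 0 \<le> a t \<and> a t \<le> A" "0 \<le> m" "A * m \<le> 1/2" "2 * (L * m) \<le> \<gamma>" "0 \<le> L"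
    and "\<And>s t. s \<in> I \<Longrightarrow> t \<in> I \<Longrightarrow> \<bar>a s - a t\<bar> \<le> L * \<bar>s - t\<bar>"
  shows "growth_rate I g m a \<gamma>"
  unfolding growth_rate_def
proof (intro exI[of _ a] exI[of _ L] conjI ballI)
  fix t assume t: "t \<in> I"
  have "a t * m \<le> A * m" using assms(1)[OF t] assms(2) by (intro mult_right_mono) auto
  then show "a t * m \<le> 1/2" using assms(3) by simp
qed (use assms in auto)

text \<open>
  A majorant that does not depend on time lets the modewise continuity pass to the Sobolev norm.
\<close>

lemma continuous_in_sobolevI:
  fixes u :: "real \<Rightarrow> real^'d \<Rightarrow> real" and c :: "int^'d \<Rightarrow> real \<Rightarrow> complex"
  assumes u: "\<And>t. t \<in> I \<Longrightarrow> periodic (u t) \<and> set_integrable lborel cell (u t) \<and> fourier (u t) = (\<lambda>k. c k t)"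
    and bound: "\<And>k t. t \<in> I \<Longrightarrow> japanese k powr r * (norm (c k t))\<^sup>2 \<le> B k" and B: "B summable_on UNIV"
    and cont: "\<And>k. continuous_on I (c k)"
  shows "continuous_in_sobolev I r u"
  unfolding continuous_in_sobolev_def
proof (intro conjI ballI)
  fix t assume t: "t \<in> I"
  have "(\<lambda>k. japanese k powr r * (norm (c k t))\<^sup>2) summable_on UNIV"
    by (rule summable_on_comparison_test[OF B]) (use bound[OF t] in auto)
  then show "u t \<in> sobolev r" using u[OF t] by (simp add: sobolev_def)
  define h where "h k \<tau> = japanese k powr r * (norm (c k \<tau> - c k t))\<^sup>2" for k \<tau>
  have h_le: "norm (h k \<tau>) \<le> 4 * B k" if \<tau>: "\<tau> \<in> I" for k \<tau>
  proof -
    have "(norm (c k \<tau> - c k t))\<^sup>2 \<le> (norm (c k \<tau>) + norm (c k t))\<^sup>2"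
      by (intro power_mono norm_triangle_ineq4) simp
    also have "\<dots> \<le> 2 * (norm (c k \<tau>))\<^sup>2 + 2 * (norm (c k t))\<^sup>2"
      using sum_squares_bound[of "norm (c k \<tau>)" "norm (c k t)"] by (simp add: power2_sum)
    finally have "h k \<tau> \<le> japanese k powr r * (2 * (norm (c k \<tau>))\<^sup>2 + 2 * (norm (c k t))\<^sup>2)"
      unfolding h_def by (intro mult_left_mono) auto
    also have "\<dots> \<le> 4 * B k"
      using bound[OF t, of k] bound[OF \<tau>, of k] by (simp add: distrib_left)
    finally show ?thesis by (simp add: h_def)
  qed
  have "uniform_limit I (\<lambda>X \<tau>. \<Sum>k\<in>X. h k \<tau>) (\<lambda>\<tau>. \<Sum>\<^sub>\<infinity>k. h k \<tau>) (finite_subsets_at_top UNIV)"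
    by (rule Weierstrass_m_test_general[OF _ summable_on_cmult_right[OF B, of 4]]) (use h_le in auto)
  moreover have "continuous_on I (\<lambda>\<tau>. \<Sum>k\<in>X. h k \<tau>)" for X
    unfolding h_def
    by (intro continuous_on_sum continuous_on_power continuous_on_mult continuous_on_const continuous_on_norm
        continuous_on_diff cont)
  ultimately have "continuous_on I (\<lambda>\<tau>. \<Sum>\<^sub>\<infinity>k. h k \<tau>)"
    by (intro uniform_limit_theorem[OF always_eventually]) auto
  then have "((\<lambda>\<tau>. \<Sum>\<^sub>\<infinity>k. h k \<tau>) \<longlongrightarrow> (\<Sum>\<^sub>\<infinity>k. h k t)) (at t within I)"
    using t by (simp add: continuous_on_def)
  moreover have "(\<Sum>\<^sub>\<infinity>k. h k t) = 0" by (simp add: h_def)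
  ultimately have lim: "((\<lambda>\<tau>. sqrt (\<Sum>\<^sub>\<infinity>k. h k \<tau>)) \<longlongrightarrow> 0) (at t within I)"
    using tendsto_real_sqrt by fastforce
  have eq: "sqrt (\<Sum>\<^sub>\<infinity>k. h k \<tau>) = sobolev_norm r (fourier (\<lambda>x. u \<tau> x - u t x))" if "\<tau> \<in> I" for \<tau>
    using u[OF that] u[OF t] by (simp add: sobolev_norm_def h_def fourier_diff)
  show "((\<lambda>\<tau>. sobolev_norm r (fourier (\<lambda>x. u \<tau> x - u t x))) \<longlongrightarrow> 0) (at t within I)"
    by (rule Lim_transform_eventually[OF lim]) (auto simp: eventually_at_filter eq)
qed

text \<open>
  Near each time the square of the norm is at most \<open>2 + 2 N\<close>, where \<open>N\<close> is its value there; compactness does the rest.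
\<close>

lemma continuous_in_sobolev_bounded:
  fixes u :: "real \<Rightarrow> real^'d \<Rightarrow> real"
  assumes u: "continuous_in_sobolev I r u" and I: "compact I"
  shows "\<exists>R\<ge>0. \<forall>t\<in>I. (\<Sum>\<^sub>\<infinity>k. japanese k powr r * (norm (fourier (u t) k))\<^sup>2) \<le> R"
proof -
  define N where "N t = (\<Sum>\<^sub>\<infinity>k. japanese k powr r * (norm (fourier (u t) k))\<^sup>2)" for t
  have int: "set_integrable lborel cell (u t)"
    and sum: "(\<lambda>k. japanese k powr r * (norm (fourier (u t) k))\<^sup>2) summable_on UNIV" if "t \<in> I" for t
    using u that by (auto simp: continuous_in_sobolev_def sobolev_def)
  have near: "\<exists>d>0. \<forall>\<tau>\<in>I. dist \<tau> t < d \<longrightarrow> N \<tau> \<le> 2 + 2 * N t" if t: "t \<in> I" for t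
  proof -
    have "((\<lambda>\<tau>. sobolev_norm r (fourier (\<lambda>x. u \<tau> x - u t x))) \<longlongrightarrow> 0) (at t within I)"
      using u t by (simp add: continuous_in_sobolev_def)
    then have "\<forall>\<^sub>F \<tau> in at t within I. sobolev_norm r (fourier (\<lambda>x. u \<tau> x - u t x)) < 1"
      by (rule order_tendstoD) simp
    then obtain d where d: "d > 0"
      "\<And>\<tau>. \<tau> \<in> I \<Longrightarrow> \<tau> \<noteq> t \<Longrightarrow> dist \<tau> t < d \<Longrightarrow> sobolev_norm r (fourier (\<lambda>x. u \<tau> x - u t x)) < 1"
      unfolding eventually_at by auto
    have "N \<tau> \<le> 2 + 2 * N t" if \<tau>: "\<tau> \<in> I" "dist \<tau> t < d" for \<tau>
    proof (cases "\<tau> = t")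
      case True
      have "0 \<le> N t" unfolding N_def by (intro infsum_nonneg) simp
      then show ?thesis using True by simp
    next
      case False
      define h where "h k = japanese k powr r * (norm (fourier (u \<tau>) k - fourier (u t) k))\<^sup>2" for k
      have pt: "(norm x)\<^sup>2 \<le> 2 * (norm (x - y))\<^sup>2 + 2 * (norm y)\<^sup>2" for x y :: complex
      proof -
        have "(norm x)\<^sup>2 \<le> (norm (x - y) + norm y)\<^sup>2"
          using norm_triangle_ineq[of "x - y" y] by (intro power_mono) auto
        then show ?thesis
          using sum_squares_bound[of "norm (x - y)" "norm y"] by (simp add: power2_sum)
      qed
      have h_sum: "h summable_on UNIV"
      proof (rule summable_on_comparison_test)
        show "(\<lambda>k. 2 * (japanese k powr r * (norm (fourier (u \<tau>) k))\<^sup>2) + 2 * (japanese k powr r * (norm (fourier (u t) k))\<^sup>2)) summable_on UNIV"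
          by (intro summable_on_add summable_on_cmult_right sum \<tau>(1) t)
        fix k
        have "(norm (fourier (u \<tau>) k - fourier (u t) k))\<^sup>2 \<le> 2 * (norm (fourier (u \<tau>) k))\<^sup>2 + 2 * (norm (fourier (u t) k))\<^sup>2"
          using pt[of "fourier (u \<tau>) k - fourier (u t) k" "- fourier (u t) k"] by simp
        then have "h k \<le> japanese k powr r * (2 * (norm (fourier (u \<tau>) k))\<^sup>2 + 2 * (norm (fourier (u t) k))\<^sup>2)"
          unfolding h_def by (intro mult_left_mono) auto
        then show "h k \<le> 2 * (japanese k powr r * (norm (fourier (u \<tau>) k))\<^sup>2) + 2 * (japanese k powr r * (norm (fourier (u t) k))\<^sup>2)"
          by (simp add: algebra_simps)
      qed (simp add: h_def)
      have "sqrt (infsum h UNIV) < 1"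
        using d(2)[OF \<tau>(1) False \<tau>(2)] int[OF \<tau>(1)] int[OF t]
        by (simp add: sobolev_norm_def fourier_diff h_def[abs_def])
      then have h1: "infsum h UNIV \<le> 1" by simp
      have "N \<tau> \<le> (\<Sum>\<^sub>\<infinity>k. 2 * h k + 2 * (japanese k powr r * (norm (fourier (u t) k))\<^sup>2))"
        unfolding N_def
      proof (intro infsum_mono sum \<tau>(1) summable_on_add summable_on_cmult_right h_sum t)
        fix k
        have "japanese k powr r * (norm (fourier (u \<tau>) k))\<^sup>2 \<le>
            japanese k powr r * (2 * (norm (fourier (u \<tau>) k - fourier (u t) k))\<^sup>2 + 2 * (norm (fourier (u t) k))\<^sup>2)"
          by (intro mult_left_mono pt) simp
        then show "japanese k powr r * (norm (fourier (u \<tau>) k))\<^sup>2 \<le> 2 * h k + 2 * (japanese k powr r * (norm (fourier (u t) k))\<^sup>2)"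
          by (simp add: h_def algebra_simps)
      qed
      also have "\<dots> = 2 * infsum h UNIV + 2 * N t"
        unfolding N_def
        by (subst infsum_add) (auto intro!: summable_on_cmult_right h_sum sum t simp: infsum_cmult_right h_sum sum t)
      finally show ?thesis using h1 by linarith
    qed
    then show ?thesis using d(1) by blast
  qed
  then obtain d where d: "\<And>t. t \<in> I \<Longrightarrow> d t > 0"
    "\<And>t \<tau>. t \<in> I \<Longrightarrow> \<tau> \<in> I \<Longrightarrow> dist \<tau> t < d t \<Longrightarrow> N \<tau> \<le> 2 + 2 * N t" by metis
  have "I \<subseteq> (\<Union>t\<in>I. ball t (d t))" using d(1) by force
  then obtain C where C: "C \<subseteq> I" "finite C" "I \<subseteq> (\<Union>t\<in>C. ball t (d t))"
    using compactE_image[OF I, of I "\<lambda>t. ball t (d t)"] by blast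
  have N0: "0 \<le> N t" for t unfolding N_def by (intro infsum_nonneg) simp
  have "N \<tau> \<le> (\<Sum>t\<in>C. 2 + 2 * N t)" if \<tau>: "\<tau> \<in> I" for \<tau>
  proof -
    obtain t where t: "t \<in> C" "\<tau> \<in> ball t (d t)" using C(3) \<tau> by blast
    have "N \<tau> \<le> 2 + 2 * N t" using d(2)[of t \<tau>] t C(1) \<tau> by (auto simp: dist_commute)
    also have "\<dots> \<le> (\<Sum>t\<in>C. 2 + 2 * N t)"
      by (rule member_le_sum[OF t(1)]) (use C(2) N0 in \<open>auto simp: add_nonneg_nonneg\<close>)
    finally show ?thesis .
  qed
  moreover have "0 \<le> (\<Sum>t\<in>C. 2 + 2 * N t)" using N0 by (intro sum_nonneg) (simp add: add_nonneg_nonneg)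
  ultimately show ?thesis unfolding N_def by blast
qed

section \<open>The toy model for fixed data\<close>

lemma fourier_minus: "fourier f (- k) = cnj (fourier f k)"
proof -
  have "(LINT x:cell|lborel. complex_of_real (f x) * wave k x) =
      (LINT x:cell|lborel. cnj (complex_of_real (f x) * wave (- k) x))"
    by (simp add: cnj_wave)
  also have "\<dots> = cnj (LINT x:cell|lborel. complex_of_real (f x) * wave (- k) x)"
  proof -
    have "(\<lambda>x. indicator cell x *\<^sub>R cnj (complex_of_real (f x) * wave (- k) x)) =
        (\<lambda>x. cnj (indicator cell x *\<^sub>R (complex_of_real (f x) * wave (- k) x)))"
      by (simp only: complex_cnj_scaleR)
    then show ?thesis unfolding set_lebesgue_integral_def by (simp only: Bochner_Integration.integral_cnj)
  qed
  finally show ?thesis by (simp add: fourier_wave)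
qed

lemma fourier_cong_AE:
  fixes f g :: "real^'d \<Rightarrow> real"
  assumes f: "set_integrable lborel cell f" and g: "set_integrable lborel cell g"
    and eq: "AE x in lborel. f x = g x"
  shows "fourier f k = fourier g k"
proof -
  have "(LINT x:cell|lborel. complex_of_real (f x) * wave (- k) x) = (LINT x:cell|lborel. complex_of_real (g x) * wave (- k) x)"
    unfolding set_lebesgue_integral_def
    using set_integrable_fourier[OF f, of "- k"] set_integrable_fourier[OF g, of "- k"] eq
    by (intro integral_cong_AE) (auto simp: set_integrable_def elim: eventually_mono)
  then show ?thesis by (simp add: fourier_wave)
qed

text \<open>
  The flag \<open>lip\<close> distinguishes the two halves of the theorem. If it is set, the data lie in \<open>H\<^sup>3\<^sup>/\<^sup>4 \<times> H\<^sup>5\<^sup>/\<^sup>4\<close>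
  and the Lipschitz constant of \<open>a\<close> is available, while the coupling is merely
  bounded. Otherwise the data lie in \<open>H\<^sup>1\<^sup>/\<^sup>2 \<times> H\<^sup>1\<close> and the coupling gains half a derivative.
\<close>

locale toy_data =
  fixes \<epsilon> \<mu> \<delta> s mbar \<Lambda> :: real and J :: "real \<Rightarrow> real" and lip :: bool
    and \<zeta>0 \<psi>0 :: "real^'d \<Rightarrow> real"
  assumes \<epsilon>: "0 < \<epsilon>" and \<mu>: "1 \<le> \<mu>" and s: "(if lip then 3/4 else 1/2) \<le> s"
    and \<zeta>0: "\<zeta>0 \<in> sobolev s" and \<psi>0: "\<psi>0 \<in> sobolev (s + 1/2)"
    and mbar: "0 \<le> mbar" and \<Lambda>: "0 \<le> \<Lambda>"
    and coupling_le: "lip \<Longrightarrow> coupling \<delta> J (k :: int^'d) \<le> mbar"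
    and coupling_sqrt_le: "\<not> lip \<Longrightarrow> coupling \<delta> J (k :: int^'d) * sqrt (wavenumber k) \<le> \<Lambda>"
begin

definition g :: "int^'d \<Rightarrow> real" where "g k = dispersion \<mu> k"

definition m :: "int^'d \<Rightarrow> real" where "m k = coupling \<delta> J k"

definition P :: "int^'d \<Rightarrow> real" where "P k = g k * (if lip then 1 + sqrt (g k) else 1)"

definition D :: real where "D = \<epsilon>\<^sup>2 * (2 * pi) ^ CARD('d)"

abbreviation "z0 \<equiv> fourier \<zeta>0"

abbreviation "w0 \<equiv> fourier \<psi>0"

abbreviation "E0 k \<equiv> energy (g k) (z0 k) (w0 k)"

lemma g_nonneg: "0 \<le> g k" using \<mu> by (simp add: g_def dispersion_nonneg)

lemma m_nonneg: "0 \<le> m k" by (simp add: m_def coupling_nonneg)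

lemma D_pos: "0 < D" using \<epsilon> by (simp add: D_def)

lemma E0_nonneg: "0 \<le> E0 k" by (rule energy_nonneg[OF g_nonneg])

lemma g_le: "g k \<le> japanese k powr (1/2)" "(g k)\<^sup>2 \<le> (wavenumber k)\<^sup>2"
proof -
  have le: "g k \<le> wavenumber k" by (simp add: g_def dispersion_le)
  then show "g k \<le> japanese k powr (1/2)" using wavenumber_le_japanese by (rule order.trans)
  show "(g k)\<^sup>2 \<le> (wavenumber k)\<^sup>2" using le g_nonneg by (rule power_mono)
qed

lemma sqrt_g_le: "sqrt (g k) \<le> japanese k powr (1/4)"
proof -
  have "sqrt (g k) \<le> sqrt (wavenumber k)" by (simp add: g_def dispersion_le)
  then show ?thesis using sqrt_wavenumber_le_japanese by (rule order.trans)
qed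

lemma g_sqrt_g_le: "g k * sqrt (g k) \<le> japanese k powr (3/4)"
proof -
  have "g k * sqrt (g k) \<le> japanese k powr (1/2) * japanese k powr (1/4)"
    using g_nonneg by (intro mult_mono g_le sqrt_g_le) auto
  then show ?thesis by (simp add: powr_add[symmetric])
qed

text \<open>
  Compares weighted sums of the initial energies with the quantities that enter the smallness condition and the
  lifespan.
\<close>

lemma weighted_data:
  fixes W :: "int^'d \<Rightarrow> real"
  assumes W: "\<And>k. 0 \<le> W k" "\<And>k. W k \<le> japanese k powr r"
      "\<And>k. W k * g k \<le> japanese k powr (r - 1/2) * (wavenumber k)\<^sup>2"
    and r: "r \<le> s"
  shows "(\<lambda>k. W k * E0 k) summable_on UNIV"
    and "\<epsilon>\<^sup>2 * (\<Sum>\<^sub>\<infinity>k. W k * E0 k) \<le>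
      (\<epsilon> * sobolev_norm r (fourier \<zeta>0) + \<epsilon> * sobolev_norm (r - 1/2) (fourier_grad \<psi>0))\<^sup>2"
proof -
  define X where "X k = japanese k powr r * (norm (z0 k))\<^sup>2" for k
  define Y where "Y k = japanese k powr (r - 1/2) * (norm (fourier_grad \<psi>0 k))\<^sup>2" for k
  have X: "X summable_on UNIV"
  proof (rule summable_on_comparison_test)
    show "(\<lambda>k. japanese k powr s * (norm (z0 k))\<^sup>2) summable_on UNIV"
      using \<zeta>0 by (simp add: sobolev_def)
    show "X k \<le> japanese k powr s * (norm (z0 k))\<^sup>2" for k
      unfolding X_def by (intro mult_right_mono japanese_powr_mono r) simp
  qed (simp add: X_def)
  have Y: "Y summable_on UNIV"
  proof (rule summable_on_comparison_test)
    show "(\<lambda>k. japanese k powr (s + 1/2) * (norm (w0 k))\<^sup>2) summable_on UNIV"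
      using \<psi>0 by (simp add: sobolev_def)
    fix k :: "int^'d"
    have "japanese k powr (r - 1/2) * (wavenumber k)\<^sup>2 \<le> japanese k powr (r - 1/2) * japanese k powr 1"
      by (intro mult_left_mono) (auto simp: powr_one)
    also have "\<dots> = japanese k powr (r + 1/2)" by (simp only: powr_add[symmetric]) (simp add: add.commute)
    also have "\<dots> \<le> japanese k powr (s + 1/2)" using r by (intro japanese_powr_mono) simp
    finally have "japanese k powr (r - 1/2) * (wavenumber k)\<^sup>2 * (norm (w0 k))\<^sup>2 \<le> japanese k powr (s + 1/2) * (norm (w0 k))\<^sup>2"
      by (rule mult_right_mono) simp
    then show "Y k \<le> japanese k powr (s + 1/2) * (norm (w0 k))\<^sup>2"
      by (simp add: Y_def norm_fourier_grad mult.assoc)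
  qed (simp add: Y_def)
  have le: "W k * E0 k \<le> X k + Y k" for k
  proof -
    have "W k * E0 k = W k * (norm (z0 k))\<^sup>2 + (W k * g k) * (norm (w0 k))\<^sup>2"
      by (simp add: energy_def algebra_simps)
    also have "\<dots> \<le> X k + (japanese k powr (r - 1/2) * (wavenumber k)\<^sup>2) * (norm (w0 k))\<^sup>2"
      unfolding X_def by (intro add_mono mult_right_mono W) auto
    finally show ?thesis by (simp add: Y_def norm_fourier_grad mult.assoc)
  qed
  show sum: "(\<lambda>k. W k * E0 k) summable_on UNIV"
    by (rule summable_on_comparison_test[OF summable_on_add[OF X Y]])
       (use le W(1) E0_nonneg in auto)
  have "(\<Sum>\<^sub>\<infinity>k. W k * E0 k) \<le> (\<Sum>\<^sub>\<infinity>k. X k + Y k)"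
    by (rule infsum_mono[OF sum summable_on_add[OF X Y]]) (rule le)
  also have "\<dots> = infsum X UNIV + infsum Y UNIV" by (rule infsum_add[OF X Y])
  finally have "(\<Sum>\<^sub>\<infinity>k. W k * E0 k) \<le> infsum X UNIV + infsum Y UNIV" .
  then have "\<epsilon>\<^sup>2 * (\<Sum>\<^sub>\<infinity>k. W k * E0 k) \<le> \<epsilon>\<^sup>2 * (infsum X UNIV + infsum Y UNIV)"
    by (rule mult_left_mono) simp
  also have "\<dots> \<le> (\<epsilon> * sqrt (infsum X UNIV) + \<epsilon> * sqrt (infsum Y UNIV))\<^sup>2"
  proof -
    have X0: "0 \<le> infsum X UNIV" by (intro infsum_nonneg) (simp add: X_def)
    have Y0: "0 \<le> infsum Y UNIV" by (intro infsum_nonneg) (simp add: Y_def)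
    have "0 \<le> 2 * (\<epsilon> * sqrt (infsum X UNIV)) * (\<epsilon> * sqrt (infsum Y UNIV))"
      using \<epsilon> X0 Y0 by simp
    then show ?thesis using X0 Y0 by (simp add: power2_sum power_mult_distrib distrib_left)
  qed
  finally show "\<epsilon>\<^sup>2 * (\<Sum>\<^sub>\<infinity>k. W k * E0 k) \<le>
      (\<epsilon> * sobolev_norm r (fourier \<zeta>0) + \<epsilon> * sobolev_norm (r - 1/2) (fourier_grad \<psi>0))\<^sup>2"
    by (simp add: sobolev_norm_def X_def[abs_def] Y_def[abs_def])
qed

lemma s_ge: "1/2 \<le> s" using s by (auto split: if_splits)

lemma weighted_g:
  assumes "1/2 \<le> r" "r \<le> s"
  shows "(\<lambda>k. g k * E0 k) summable_on UNIV"
    and "\<epsilon>\<^sup>2 * (\<Sum>\<^sub>\<infinity>k. g k * E0 k) \<le>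
      (\<epsilon> * sobolev_norm r (fourier \<zeta>0) + \<epsilon> * sobolev_norm (r - 1/2) (fourier_grad \<psi>0))\<^sup>2"
proof -
  have 1: "g k \<le> japanese k powr r" for k
    using g_le(1)[of k] japanese_powr_mono[OF assms(1), of k] by linarith
  have 2: "g k * g k \<le> japanese k powr (r - 1/2) * (wavenumber k)\<^sup>2" for k
  proof -
    have "1 * (wavenumber k)\<^sup>2 \<le> japanese k powr (r - 1/2) * (wavenumber k)\<^sup>2"
      using assms(1) by (intro mult_right_mono ge_one_powr_ge_zero) auto
    then show ?thesis using g_le(2)[of k] by (simp add: power2_eq_square)
  qed
  show "(\<lambda>k. g k * E0 k) summable_on UNIV"
    and "\<epsilon>\<^sup>2 * (\<Sum>\<^sub>\<infinity>k. g k * E0 k) \<le>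
      (\<epsilon> * sobolev_norm r (fourier \<zeta>0) + \<epsilon> * sobolev_norm (r - 1/2) (fourier_grad \<psi>0))\<^sup>2"
    using weighted_data[OF g_nonneg 1 2 assms(2)] by auto
qed

lemma weighted_g_sqrt_g:
  assumes lip
  shows "(\<lambda>k. g k * sqrt (g k) * E0 k) summable_on UNIV"
    and "\<epsilon>\<^sup>2 * (\<Sum>\<^sub>\<infinity>k. g k * sqrt (g k) * E0 k) \<le>
      (\<epsilon> * sobolev_norm (3/4) (fourier \<zeta>0) + \<epsilon> * sobolev_norm (3/4 - 1/2) (fourier_grad \<psi>0))\<^sup>2"
proof -
  have 0: "0 \<le> g k * sqrt (g k)" for k using g_nonneg by simp
  have 2: "g k * sqrt (g k) * g k \<le> japanese k powr (3/4 - 1/2) * (wavenumber k)\<^sup>2" for k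
  proof -
    have "sqrt (g k) * (g k)\<^sup>2 \<le> japanese k powr (1/4) * (wavenumber k)\<^sup>2"
      using g_nonneg by (intro mult_mono g_le sqrt_g_le) auto
    then show ?thesis by (simp add: power2_eq_square mult_ac)
  qed
  have "3/4 \<le> s" using s assms by simp
  then show "(\<lambda>k. g k * sqrt (g k) * E0 k) summable_on UNIV"
    and "\<epsilon>\<^sup>2 * (\<Sum>\<^sub>\<infinity>k. g k * sqrt (g k) * E0 k) \<le>
      (\<epsilon> * sobolev_norm (3/4) (fourier \<zeta>0) + \<epsilon> * sobolev_norm (3/4 - 1/2) (fourier_grad \<psi>0))\<^sup>2"
    using weighted_data[OF 0 g_sqrt_g_le 2] by auto
qed

lemma oscillators:
  assumes "0 \<le> T" "0 \<le> \<gamma>"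
  shows "oscillators g m P D (mbar + \<Lambda>) T \<gamma> z0 w0"
proof
  fix k
  show "0 \<le> g k" "0 \<le> m k" "0 \<le> D" "0 \<le> T" "0 \<le> mbar + \<Lambda>" "0 \<le> \<gamma>"
    using g_nonneg m_nonneg D_pos assms mbar \<Lambda> by auto
  show gP: "g k \<le> P k"
    using mult_left_mono[of 1 "if lip then 1 + sqrt (g k) else 1" "g k"] g_nonneg[of k] by (simp add: P_def)
  show "g k * (m k * sqrt (g k)) \<le> (mbar + \<Lambda>) * P k"
  proof (cases lip)
    case True
    have "P k = g k + g k * sqrt (g k)" unfolding P_def using True by (simp add: algebra_simps)
    then have "g k * sqrt (g k) \<le> P k" using g_nonneg[of k] by simp
    moreover have "0 \<le> g k * sqrt (g k)" using g_nonneg[of k] by simp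
    moreover have "m k \<le> mbar + \<Lambda>" using coupling_le[OF True, of k] \<Lambda> by (simp add: m_def)
    ultimately have "g k * sqrt (g k) * m k \<le> P k * (mbar + \<Lambda>)"
      using m_nonneg[of k] by (intro mult_mono) auto
    then show ?thesis by (simp add: mult_ac)
  next
    case False
    have "m k * sqrt (g k) \<le> m k * sqrt (wavenumber k)"
      using m_nonneg by (intro mult_left_mono) (auto simp: g_def dispersion_le)
    then have "m k * sqrt (g k) \<le> mbar + \<Lambda>"
      using coupling_sqrt_le[OF False, of k] mbar by (simp add: m_def)
    then have "g k * (m k * sqrt (g k)) \<le> g k * (mbar + \<Lambda>)" using g_nonneg by (rule mult_left_mono)
    then show ?thesis unfolding P_def using False by (simp add: mult_ac)
  qed
next
  show "(\<lambda>k. P k * E0 k) summable_on UNIV"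
  proof (cases lip)
    case True
    have "(\<lambda>k. g k * E0 k + g k * sqrt (g k) * E0 k) summable_on UNIV"
      by (intro summable_on_add weighted_g(1)[OF order.refl s_ge] weighted_g_sqrt_g(1) True)
    then show ?thesis unfolding P_def using True by (simp add: algebra_simps)
  next
    case False
    then show ?thesis unfolding P_def using weighted_g(1)[OF order.refl s_ge] by simp
  qed
qed

text \<open>
  The scalar \<open>a\<close> that belongs to a solution.
\<close>

definition driver :: "(real \<Rightarrow> real^'d \<Rightarrow> real) \<Rightarrow> real \<Rightarrow> real" where
  "driver \<psi> t = \<epsilon>\<^sup>2 * alpha \<mu> (\<psi> t)"

lemma driver_eq:
  fixes T \<gamma> :: real
  assumes "0 \<le> T" "0 \<le> \<gamma>"
  shows "driver \<psi> t = oscillators.feedback g D (\<lambda>k t. fourier (\<psi> t) k) t"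
proof -
  interpret oscillators g m P D "mbar + \<Lambda>" T \<gamma> z0 w0 by (rule oscillators[OF assms])
  show ?thesis unfolding feedback_def by (simp add: driver_def alpha_eq D_def g_def)
qed

lemma solution_modes:
  assumes sol: "solution \<epsilon> \<mu> \<delta> J s I \<zeta>0 \<psi>0 \<zeta> \<psi>" and I: "0 \<in> I"
  shows "mode_solution I (g k) (m k) (driver \<psi>) (\<lambda>_. 0) (\<lambda>t. fourier (\<zeta> t) k) (\<lambda>t. fourier (\<psi> t) k)"
    and "fourier (\<zeta> 0) k = z0 k" and "fourier (\<psi> 0) k = w0 k"
proof -
  have "toy_model \<epsilon> \<mu> \<delta> J I \<zeta> \<psi>" using sol by (simp add: solution_def)
  then show "mode_solution I (g k) (m k) (driver \<psi>) (\<lambda>_. 0) (\<lambda>t. fourier (\<zeta> t) k) (\<lambda>t. fourier (\<psi> t) k)"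
    by (simp add: toy_model_iff driver_def[abs_def] g_def m_def)
  have "\<zeta> 0 \<in> sobolev s" "\<psi> 0 \<in> sobolev (s + 1/2)"
    using sol I by (auto simp: solution_def continuous_in_sobolev_def)
  moreover have "AE x in lborel. \<zeta> 0 x = \<zeta>0 x" "AE x in lborel. \<psi> 0 x = \<psi>0 x"
    using sol by (auto simp: solution_def elim: eventually_mono)
  ultimately show "fourier (\<zeta> 0) k = z0 k" "fourier (\<psi> 0) k = w0 k"
    using \<zeta>0 \<psi>0 by (auto intro!: fourier_cong_AE simp: sobolev_def)
qed

text \<open>
  A solution that is merely known to be continuous with values in \<open>H\<^sup>s \<times> H\<^sup>s\<^sup>+\<^sup>1\<^sup>/\<^sup>2\<close> is bounded there on
  compact time intervals. This suffices for the bounds on \<open>a\<close> that the energy estimates need.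
\<close>

lemma driver_bounds:
  assumes T: "0 \<le> T" and sol: "solution \<epsilon> \<mu> \<delta> J s {-T..T} \<zeta>0 \<psi>0 \<zeta> \<psi>"
  shows "\<exists>A L. 0 \<le> A \<and> 0 \<le> L \<and> (\<forall>t\<in>{-T..T}. 0 \<le> driver \<psi> t \<and> driver \<psi> t \<le> A) \<and>
    (lip \<longrightarrow> (\<forall>t\<in>{-T..T}. \<forall>u\<in>{-T..T}. \<bar>driver \<psi> t - driver \<psi> u\<bar> \<le> L * \<bar>t - u\<bar>))"
proof -
  interpret oscillators g m P D "mbar + \<Lambda>" T 0 z0 w0 by (rule oscillators[OF T]) simp
  let ?z = "\<lambda>k t. fourier (\<zeta> t) k" and ?w = "\<lambda>k t. fourier (\<psi> t) k"
  have zero: "0 \<in> I" using T by simp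
  note modes = solution_modes[OF sol zero]
  have cz: "continuous_in_sobolev I s \<zeta>" and cw: "continuous_in_sobolev I (s + 1/2) \<psi>"
    using sol by (auto simp: solution_def)
  obtain R1 where R1: "0 \<le> R1" "\<And>t. t \<in> I \<Longrightarrow> (\<Sum>\<^sub>\<infinity>k. japanese k powr s * (norm (?z k t))\<^sup>2) \<le> R1"
    using continuous_in_sobolev_bounded[OF cz] by auto
  obtain R2 where R2: "0 \<le> R2" "\<And>t. t \<in> I \<Longrightarrow> (\<Sum>\<^sub>\<infinity>k. japanese k powr (s + 1/2) * (norm (?w k t))\<^sup>2) \<le> R2"
    using continuous_in_sobolev_bounded[OF cw] by auto
  have sz: "(\<lambda>k. japanese k powr s * (norm (?z k t))\<^sup>2) summable_on UNIV"
    and sw: "(\<lambda>k. japanese k powr (s + 1/2) * (norm (?w k t))\<^sup>2) summable_on UNIV" if "t \<in> I" for t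
    using cz cw that by (auto simp: continuous_in_sobolev_def sobolev_def)
  have le: "(g k * norm (?w k t))\<^sup>2 \<le> japanese k powr (s + 1/2) * (norm (?w k t))\<^sup>2" for k t
  proof -
    have "(g k)\<^sup>2 \<le> japanese k powr 1" using g_le(2)[of k] by (simp add: powr_one)
    also have "\<dots> \<le> japanese k powr (s + 1/2)" using s_ge by (intro japanese_powr_mono) simp
    finally show ?thesis unfolding power_mult_distrib by (rule mult_right_mono) simp
  qed
  have sum: "(\<lambda>k. (g k * norm (?w k t))\<^sup>2) summable_on UNIV" if "t \<in> I" for t
    by (rule summable_on_comparison_test[OF sw[OF that]]) (use le in auto)
  define A where "A = D * R2"
  have A: "0 \<le> A" using D_pos R2(1) by (simp add: A_def)
  have fb: "driver \<psi> t = feedback ?w t" for t by (rule driver_eq[OF T order.refl])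
  have bnd: "0 \<le> driver \<psi> t \<and> driver \<psi> t \<le> A" if t: "t \<in> I" for t
  proof
    show "0 \<le> driver \<psi> t"
      unfolding fb feedback_def using D_pos by (intro mult_nonneg_nonneg infsum_nonneg) auto
    have "(\<Sum>\<^sub>\<infinity>k. (g k * norm (?w k t))\<^sup>2) \<le> (\<Sum>\<^sub>\<infinity>k. japanese k powr (s + 1/2) * (norm (?w k t))\<^sup>2)"
      by (intro infsum_mono sum[OF t] sw[OF t] le)
    then show "driver \<psi> t \<le> A"
      unfolding fb feedback_def A_def using R2(2)[OF t] D_pos by (intro mult_left_mono) auto
  qed
  define L where "L = D * ((1 + A * mbar) * (R1 + R2))"
  have L: "0 \<le> L" unfolding L_def using D_pos A mbar R1(1) R2(1) by simp
  have "\<bar>driver \<psi> t - driver \<psi> u\<bar> \<le> L * \<bar>t - u\<bar>" if lip: lip and tu: "t \<in> I" "u \<in> I" for t u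
    unfolding L_def fb
  proof (rule feedback_lipschitz[OF modes(1) sum _ _ tu])
    fix k :: "int^'d" and v assume v: "v \<in> I"
    have "driver \<psi> v * m k \<le> A * mbar"
      using bnd[OF v] coupling_le[OF lip, of k] m_nonneg[of k] A by (intro mult_mono) (auto simp: m_def)
    moreover have "0 \<le> driver \<psi> v * m k" using bnd[OF v] m_nonneg[of k] by simp
    ultimately show "\<bar>driver \<psi> v * m k - 1\<bar> \<le> 1 + A * mbar" by (simp add: abs_le_iff)
  next
    fix X :: "(int^'d) set" and v assume X: "finite X" and v: "v \<in> I"
    have s34: "3/4 \<le> s" using s lip by simp
    have "g k * sqrt (g k) * energy (g k) (?z k v) (?w k v) \<le>
        japanese k powr s * (norm (?z k v))\<^sup>2 + japanese k powr (s + 1/2) * (norm (?w k v))\<^sup>2" for k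
    proof -
      have 1: "g k * sqrt (g k) \<le> japanese k powr s"
        using g_sqrt_g_le[of k] japanese_powr_mono[OF s34, of k] by linarith
      have "g k * sqrt (g k) * g k \<le> japanese k powr s * japanese k powr (1/2)"
        using g_nonneg by (intro mult_mono 1 g_le) auto
      then have 2: "g k * sqrt (g k) * g k \<le> japanese k powr (s + 1/2)" by (simp add: powr_add)
      have "g k * sqrt (g k) * energy (g k) (?z k v) (?w k v) =
          g k * sqrt (g k) * (norm (?z k v))\<^sup>2 + (g k * sqrt (g k) * g k) * (norm (?w k v))\<^sup>2"
        by (simp add: energy_def algebra_simps)
      also have "\<dots> \<le> japanese k powr s * (norm (?z k v))\<^sup>2 + japanese k powr (s + 1/2) * (norm (?w k v))\<^sup>2"
        by (intro add_mono mult_right_mono 1 2) auto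
      finally show ?thesis .
    qed
    then have "(\<Sum>k\<in>X. g k * sqrt (g k) * energy (g k) (?z k v) (?w k v)) \<le>
        (\<Sum>k\<in>X. japanese k powr s * (norm (?z k v))\<^sup>2) + (\<Sum>k\<in>X. japanese k powr (s + 1/2) * (norm (?w k v))\<^sup>2)"
      unfolding sum.distrib[symmetric] by (intro sum_mono)
    also have "(\<Sum>k\<in>X. japanese k powr s * (norm (?z k v))\<^sup>2) \<le> R1"
      by (rule order.trans[OF finite_sum_le_infsum[OF sz[OF v] X] R1(2)[OF v]]) simp_all
    also have "(\<Sum>k\<in>X. japanese k powr (s + 1/2) * (norm (?w k v))\<^sup>2) \<le> R2"
      by (rule order.trans[OF finite_sum_le_infsum[OF sw[OF v] X] R2(2)[OF v]]) simp_all
    finally show "(\<Sum>k\<in>X. g k * sqrt (g k) * energy (g k) (?z k v) (?w k v)) \<le> R1 + R2" by simp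
  qed
  then show ?thesis using A L bnd by blast
qed

text \<open>
  For arbitrary bounds \<open>A\<close> and \<open>L\<close>, all but finitely many modes satisfy \<open>A m \<le> 1/2\<close>. Hence uniqueness
  holds on intervals of any length and without smallness of \<open>a\<close>.
\<close>

lemma common_growth_rate:
  assumes A: "0 \<le> A" and L: "0 \<le> L" and fin: "\<And>\<eta>. lip \<Longrightarrow> 0 < \<eta> \<Longrightarrow> finite {k. \<eta> < m k}"
  shows "\<exists>\<gamma>\<ge>0. \<forall>a k. (\<forall>t\<in>I. 0 \<le> a t \<and> a t \<le> A) \<longrightarrow>
    (lip \<longrightarrow> (\<forall>t\<in>I. \<forall>u\<in>I. \<bar>a t - a u\<bar> \<le> L * \<bar>t - u\<bar>)) \<longrightarrow> growth_rate I (g k) (m k) a \<gamma>"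
proof (cases lip)
  case False
  have "growth_rate I (g k) (m k) a (2 * (A * \<Lambda>))" if "\<forall>t\<in>I. 0 \<le> a t \<and> a t \<le> A" for a k
  proof (rule growth_rate_low[where A = A])
    have "m k * sqrt (g k) \<le> m k * sqrt (wavenumber k)"
      using m_nonneg by (intro mult_left_mono) (auto simp: g_def dispersion_le)
    then have "m k * sqrt (g k) \<le> \<Lambda>" using coupling_sqrt_le[OF False, of k] by (simp add: m_def)
    then show "2 * (A * (m k * sqrt (g k))) \<le> 2 * (A * \<Lambda>)" using A by (simp add: mult_left_mono)
  qed (use that m_nonneg g_nonneg in auto)
  moreover have "0 \<le> 2 * (A * \<Lambda>)" using A \<Lambda> by simp
  ultimately show ?thesis by blast
next
  case True
  define \<eta> where "\<eta> = 1 / (2 * (A + 1))"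
  have \<eta>: "0 < \<eta>" using A by (simp add: \<eta>_def)
  define H where "H = {k. \<eta> < m k}"
  have H: "finite H" unfolding H_def by (rule fin[OF True \<eta>])
  define \<Lambda>' where "\<Lambda>' = (\<Sum>k\<in>H. m k * sqrt (g k))"
  have nn: "0 \<le> m k * sqrt (g k)" for k using m_nonneg g_nonneg by simp
  have \<Lambda>': "0 \<le> \<Lambda>'" unfolding \<Lambda>'_def by (intro sum_nonneg nn)
  define \<gamma> where "\<gamma> = 2 * (A * \<Lambda>') + 2 * (L * mbar)"
  have "growth_rate I (g k) (m k) a \<gamma>"
    if a: "\<forall>t\<in>I. 0 \<le> a t \<and> a t \<le> A" and aL: "\<forall>t\<in>I. \<forall>u\<in>I. \<bar>a t - a u\<bar> \<le> L * \<bar>t - u\<bar>" for a k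
  proof (cases "k \<in> H")
    case k: True
    show ?thesis
    proof (rule growth_rate_low[where A = A])
      have "m k * sqrt (g k) \<le> \<Lambda>'"
        unfolding \<Lambda>'_def using H k nn by (intro member_le_sum) auto
      then have "A * (m k * sqrt (g k)) \<le> A * \<Lambda>'" using A by (rule mult_left_mono)
      moreover have "0 \<le> L * mbar" using L mbar by simp
      ultimately show "2 * (A * (m k * sqrt (g k))) \<le> \<gamma>" by (simp add: \<gamma>_def)
    qed (use a m_nonneg g_nonneg in auto)
  next
    case False
    show ?thesis
    proof (rule growth_rate_high[where A = A and L = L])
      have "m k \<le> \<eta>" using False by (simp add: H_def)
      then have "A * m k \<le> A * \<eta>" using A by (rule mult_left_mono)
      also have "\<dots> \<le> 1/2" using A by (simp add: \<eta>_def field_simps)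
      finally show "A * m k \<le> 1/2" .
      have "L * m k \<le> L * mbar" using coupling_le[OF True, of k] L by (simp add: m_def mult_left_mono)
      moreover have "0 \<le> A * \<Lambda>'" using A \<Lambda>' by simp
      ultimately show "2 * (L * m k) \<le> \<gamma>" by (simp add: \<gamma>_def)
    qed (use a aL m_nonneg L in auto)
  qed
  moreover have "0 \<le> \<gamma>" unfolding \<gamma>_def using A \<Lambda>' L mbar by simp
  ultimately show ?thesis using True by blast
qed

lemma solution_unique:
  assumes T: "0 \<le> T" and fin: "\<And>\<eta>. lip \<Longrightarrow> 0 < \<eta> \<Longrightarrow> finite {k. \<eta> < m k}"
    and sol: "solution \<epsilon> \<mu> \<delta> J s {-T..T} \<zeta>0 \<psi>0 \<zeta> \<psi>"
    and sol': "solution \<epsilon> \<mu> \<delta> J s {-T..T} \<zeta>0 \<psi>0 \<zeta>' \<psi>'" and t: "t \<in> {-T..T}"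
  shows "AE x in lborel. \<zeta>' t x = \<zeta> t x \<and> \<psi>' t x = \<psi> t x"
proof -
  let ?I = "{-T..T}"
  have zero: "0 \<in> ?I" using T by simp
  obtain A1 L1 where 1: "0 \<le> A1" "0 \<le> L1" "\<forall>t\<in>?I. 0 \<le> driver \<psi> t \<and> driver \<psi> t \<le> A1"
    "lip \<longrightarrow> (\<forall>t\<in>?I. \<forall>u\<in>?I. \<bar>driver \<psi> t - driver \<psi> u\<bar> \<le> L1 * \<bar>t - u\<bar>)"
    using driver_bounds[OF T sol] by blast
  obtain A2 L2 where 2: "0 \<le> A2" "0 \<le> L2" "\<forall>t\<in>?I. 0 \<le> driver \<psi>' t \<and> driver \<psi>' t \<le> A2"
    "lip \<longrightarrow> (\<forall>t\<in>?I. \<forall>u\<in>?I. \<bar>driver \<psi>' t - driver \<psi>' u\<bar> \<le> L2 * \<bar>t - u\<bar>)"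
    using driver_bounds[OF T sol'] by blast
  have widen: "x \<le> L * d \<Longrightarrow> L \<le> L' \<Longrightarrow> 0 \<le> d \<Longrightarrow> x \<le> L' * d" for x L L' d :: real
    by (meson mult_right_mono order.trans)
  have "0 \<le> max A1 A2" "0 \<le> max L1 L2" using 1 2 by auto
  from common_growth_rate[OF this fin, of ?I] obtain \<gamma> where \<gamma>: "0 \<le> \<gamma>"
    and rate: "\<And>a k. (\<forall>t\<in>?I. 0 \<le> a t \<and> a t \<le> max A1 A2) \<Longrightarrow>
      (lip \<longrightarrow> (\<forall>t\<in>?I. \<forall>u\<in>?I. \<bar>a t - a u\<bar> \<le> max L1 L2 * \<bar>t - u\<bar>)) \<Longrightarrow> growth_rate ?I (g k) (m k) a \<gamma>"
    by blast
  interpret oscillators g m P D "mbar + \<Lambda>" T \<gamma> z0 w0 by (rule oscillators[OF T \<gamma>])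
  have flow: "flow (driver \<psi>1) (\<lambda>k t. fourier (\<zeta>1 t) k) (\<lambda>k t. fourier (\<psi>1 t) k)"
    if sol1: "solution \<epsilon> \<mu> \<delta> J s ?I \<zeta>0 \<psi>0 \<zeta>1 \<psi>1" and le: "A' \<le> max A1 A2" "L' \<le> max L1 L2"
      and bnd: "\<forall>t\<in>?I. 0 \<le> driver \<psi>1 t \<and> driver \<psi>1 t \<le> A'"
      and lipb: "lip \<longrightarrow> (\<forall>t\<in>?I. \<forall>u\<in>?I. \<bar>driver \<psi>1 t - driver \<psi>1 u\<bar> \<le> L' * \<bar>t - u\<bar>)"
    for \<zeta>1 \<psi>1 A' L'
    unfolding flow_def
  proof (intro allI conjI solution_modes[OF sol1 zero] rate)
    show "\<forall>t\<in>?I. 0 \<le> driver \<psi>1 t \<and> driver \<psi>1 t \<le> max A1 A2" using bnd le(1) by fastforce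
    show "lip \<longrightarrow> (\<forall>t\<in>?I. \<forall>u\<in>?I. \<bar>driver \<psi>1 t - driver \<psi>1 u\<bar> \<le> max L1 L2 * \<bar>t - u\<bar>)"
      using lipb widen[OF _ le(2)] by simp
  qed
  have f1: "flow (driver \<psi>) (\<lambda>k t. fourier (\<zeta> t) k) (\<lambda>k t. fourier (\<psi> t) k)"
    by (rule flow[OF sol _ _ 1(3,4)]) simp_all
  have f2: "flow (driver \<psi>') (\<lambda>k t. fourier (\<zeta>' t) k) (\<lambda>k t. fourier (\<psi>' t) k)"
    by (rule flow[OF sol' _ _ 2(3,4)]) simp_all
  have eq: "fourier (\<zeta>' t) k = fourier (\<zeta> t) k \<and> fourier (\<psi>' t) k = fourier (\<psi> t) k" for k
    by (rule selfconsistent_flow_unique[OF f2 f1 driver_eq[OF T \<gamma>] driver_eq[OF T \<gamma>] t])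
  have mem: "\<zeta> t \<in> sobolev s" "\<psi> t \<in> sobolev (s + 1/2)" "\<zeta>' t \<in> sobolev s" "\<psi>' t \<in> sobolev (s + 1/2)"
    using sol sol' t by (auto simp: solution_def continuous_in_sobolev_def)
  have "AE x in lborel. \<zeta>' t x = \<zeta> t x" "AE x in lborel. \<psi>' t x = \<psi> t x"
    using mem eq by (auto intro!: fourier_unique simp: sobolev_def)
  then show ?thesis by eventually_elim simp
qed

text \<open>
  Reality of the functions amounts to \<open>z (- k) = cnj (z k)\<close>, which follows from uniqueness for a
  single mode since \<open>g\<close> and \<open>m\<close> are even in \<open>k\<close>. The modewise energy bound provides the majorants in \<open>H\<^sup>s\<close>;
  for \<open>w\<close> this uses \<open>g \<ge> tanh 1 |k|\<close>, valid for \<open>\<mu> \<ge> 1\<close> and \<open>k \<noteq> 0\<close>.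
\<close>

lemma modes_realise_solution:
  assumes T: "0 \<le> T"
    and sol: "\<And>k. mode_solution {-T..T} (g k) (m k) a (\<lambda>_. 0) (z k) (w k)"
    and init: "\<And>k. z k 0 = z0 k" "\<And>k. w k 0 = w0 k"
    and a: "continuous_on {-T..T} a" "\<And>t. t \<in> {-T..T} \<Longrightarrow> a t = D * (\<Sum>\<^sub>\<infinity>k. (g k * norm (w k t))\<^sup>2)"
    and en: "\<And>k t. t \<in> {-T..T} \<Longrightarrow> energy (g k) (z k t) (w k t) \<le> 4 * E0 k"
  shows "\<exists>\<zeta> \<psi>. solution \<epsilon> \<mu> \<delta> J s {-T..T} \<zeta>0 \<psi>0 \<zeta> \<psi>"
proof -
  let ?I = "{-T..T}"
  have zero: "0 \<in> ?I" using T by simp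
  have cont: "continuous_on ?I (z k)" "continuous_on ?I (w k)" for k
  proof -
    show "continuous_on ?I (z k)"
      by (rule continuous_on_vector_derivative[where f' = "\<lambda>t. g k *\<^sub>R w k t"])
        (use sol[of k] in \<open>auto simp: mode_solution_def\<close>)
    show "continuous_on ?I (w k)"
      by (rule continuous_on_vector_derivative[where f' = "\<lambda>t. (a t * m k - 1) *\<^sub>R z k t"])
        (use sol[of k] in \<open>auto simp: mode_solution_def\<close>)
  qed
  have "bounded (a ` ?I)" by (intro compact_imp_bounded compact_continuous_image a) simp
  then obtain A where "\<forall>x\<in>a ` ?I. norm x \<le> A" unfolding bounded_iff by blast
  then have A: "\<bar>a t\<bar> \<le> A" if "t \<in> ?I" for t using that by auto
  have conj: "z (- k) t = cnj (z k t) \<and> w (- k) t = cnj (w k t)" if t: "t \<in> ?I" for k t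
  proof (rule mode_solution_unique[where g = "g k" and m = "m k" and a = a and A = A, OF _ _ g_nonneg m_nonneg A _ _ t])
    show "mode_solution ?I (g k) (m k) a (\<lambda>_. 0) (z (- k)) (w (- k))"
      using sol[of "- k"] by (simp add: g_def m_def dispersion_def coupling_def)
    show "mode_solution ?I (g k) (m k) a (\<lambda>_. 0) (\<lambda>t. cnj (z k t)) (\<lambda>t. cnj (w k t))"
      using sol[of k] bounded_linear.has_vector_derivative[OF bounded_linear_cnj]
      unfolding mode_solution_def by (fastforce simp: complex_cnj_scaleR)
    show "z (- k) 0 = cnj (z k 0)" "w (- k) 0 = cnj (w k 0)"
      by (simp_all add: init fourier_minus)
  qed
  define B where "B k = japanese k powr s * E0 k" for k
  have B: "B summable_on UNIV"
  proof (rule summable_on_comparison_test)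
    show "(\<lambda>k. japanese k powr s * (norm (z0 k))\<^sup>2 + japanese k powr (s + 1/2) * (norm (w0 k))\<^sup>2) summable_on UNIV"
      using \<zeta>0 \<psi>0 by (intro summable_on_add) (auto simp: sobolev_def)
    fix k :: "int^'d"
    have "japanese k powr s * g k \<le> japanese k powr s * japanese k powr (1/2)"
      by (intro mult_left_mono g_le) simp
    also have "\<dots> = japanese k powr (s + 1/2)" by (simp add: powr_add)
    finally have "japanese k powr s * g k * (norm (w0 k))\<^sup>2 \<le> japanese k powr (s + 1/2) * (norm (w0 k))\<^sup>2"
      by (rule mult_right_mono) simp
    then show "B k \<le> japanese k powr s * (norm (z0 k))\<^sup>2 + japanese k powr (s + 1/2) * (norm (w0 k))\<^sup>2"
      by (simp add: B_def energy_def algebra_simps)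
  qed (use E0_nonneg in \<open>simp add: B_def\<close>)
  have z_le: "japanese k powr s * (norm (z k t))\<^sup>2 \<le> 4 * B k" if t: "t \<in> ?I" for k t
  proof -
    have "(norm (z k t))\<^sup>2 \<le> energy (g k) (z k t) (w k t)" using g_nonneg by (simp add: energy_def)
    also have "\<dots> \<le> 4 * E0 k" by (rule en[OF t])
    finally have "japanese k powr s * (norm (z k t))\<^sup>2 \<le> japanese k powr s * (4 * E0 k)"
      by (rule mult_left_mono) simp
    then show ?thesis by (simp add: B_def mult_ac)
  qed
  \<comment> \<open>The energy does not control \<open>w\<close> in the zero mode, where \<open>g\<close> vanishes.\<close>
  have "bounded (w 0 ` ?I)" by (intro compact_imp_bounded compact_continuous_image cont) simp
  then obtain W0 where "\<forall>x\<in>w 0 ` ?I. norm x \<le> W0" unfolding bounded_iff by blast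
  then have W0: "norm (w 0 t) \<le> W0" if "t \<in> ?I" for t using that by auto
  define C where "C = sqrt 2 / tanh (1::real)"
  have C: "0 \<le> C" by (simp add: C_def)
  define B' where "B' k = (4 * C) * B k + (if k = 0 then W0\<^sup>2 else 0)" for k
  have B': "B' summable_on UNIV"
  proof -
    have "finite {k :: int^'d. (if k = 0 then W0\<^sup>2 else 0) \<noteq> 0}"
      by (rule finite_subset[of _ "{0}"]) auto
    then have "(\<lambda>k :: int^'d. if k = 0 then W0\<^sup>2 else 0) summable_on UNIV"
      by (intro finite_nonzero_values_imp_summable_on) simp
    then show ?thesis unfolding B'_def by (intro summable_on_add summable_on_cmult_right B)
  qed
  have w_le: "japanese k powr (s + 1/2) * (norm (w k t))\<^sup>2 \<le> B' k" if t: "t \<in> ?I" for k t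
  proof (cases "k = 0")
    case True
    have "(norm (w 0 t))\<^sup>2 \<le> W0\<^sup>2" using W0[OF t] by (rule power_mono) simp
    moreover have "0 \<le> (4 * C) * B 0" using C E0_nonneg[of 0] by (simp add: B_def)
    ultimately show ?thesis using True by (simp add: B'_def)
  next
    case False
    have "sqrt (japanese k) \<le> sqrt (2 * (wavenumber k)\<^sup>2)"
      using wavenumber_ge_1[OF False] power_mono[of 1 "wavenumber k" 2] by (intro real_sqrt_le_mono) simp
    then have "sqrt (japanese k) \<le> sqrt 2 * wavenumber k" by (simp add: real_sqrt_mult)
    also have "\<dots> = C * (tanh 1 * wavenumber k)" by (simp add: C_def)
    also have "\<dots> \<le> C * g k"
      unfolding g_def by (intro mult_left_mono dispersion_ge C \<mu> False)
    finally have le: "japanese k powr (1/2) \<le> C * g k" by (simp add: powr_half_sqrt)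
    have "japanese k powr (1/2) * (norm (w k t))\<^sup>2 \<le> C * g k * (norm (w k t))\<^sup>2"
      by (rule mult_right_mono[OF le]) simp
    also have "\<dots> = C * (g k * (norm (w k t))\<^sup>2)" by simp
    also have "\<dots> \<le> C * (4 * E0 k)"
    proof (rule mult_left_mono[OF _ C])
      have "g k * (norm (w k t))\<^sup>2 \<le> energy (g k) (z k t) (w k t)" by (simp add: energy_def)
      then show "g k * (norm (w k t))\<^sup>2 \<le> 4 * E0 k" using en[OF t, of k] by linarith
    qed
    finally have "japanese k powr s * (japanese k powr (1/2) * (norm (w k t))\<^sup>2) \<le> japanese k powr s * (C * (4 * E0 k))"
      by (rule mult_left_mono) simp
    then show ?thesis using False by (simp add: B'_def B_def powr_add mult_ac)
  qed
  have realise: "\<exists>f :: real^'d \<Rightarrow> real. periodic f \<and> set_integrable lborel cell f \<and> fourier f = c"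
    if c: "\<And>k. (norm (c k))\<^sup>2 \<le> b k" "b summable_on UNIV" "\<And>k. c (- k) = cnj (c k)" for c b
  proof (rule riesz_fischer[where c = c])
    show "(\<lambda>k. (norm (c k))\<^sup>2) summable_on UNIV"
      by (rule summable_on_comparison_test[OF c(2)]) (use c(1) in auto)
  qed (rule c(3))
  have one_le: "(norm x)\<^sup>2 \<le> japanese k powr r * (norm x)\<^sup>2" if "0 \<le> r" for k r and x :: complex
    using mult_right_mono[OF ge_one_powr_ge_zero[of "japanese k" r], of "(norm x)\<^sup>2"] that by simp
  have "\<exists>f. periodic f \<and> set_integrable lborel cell f \<and> fourier f = (\<lambda>k. z k t)" if t: "t \<in> ?I" for t
  proof (rule realise[OF _ summable_on_cmult_right[OF B, of 4]])
    show "(norm (z k t))\<^sup>2 \<le> 4 * B k" for k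
      using one_le[of s "z k t" k] z_le[OF t, of k] s_ge by linarith
  qed (use conj[OF t] in simp)
  then obtain \<zeta> where \<zeta>: "\<And>t. t \<in> ?I \<Longrightarrow> periodic (\<zeta> t) \<and> set_integrable lborel cell (\<zeta> t) \<and> fourier (\<zeta> t) = (\<lambda>k. z k t)"
    by metis
  have "\<exists>f. periodic f \<and> set_integrable lborel cell f \<and> fourier f = (\<lambda>k. w k t)" if t: "t \<in> ?I" for t
  proof (rule realise[OF _ B'])
    show "(norm (w k t))\<^sup>2 \<le> B' k" for k
      using one_le[of "s + 1/2" "w k t" k] w_le[OF t, of k] s_ge by linarith
  qed (use conj[OF t] in simp)
  then obtain \<psi> where \<psi>: "\<And>t. t \<in> ?I \<Longrightarrow> periodic (\<psi> t) \<and> set_integrable lborel cell (\<psi> t) \<and> fourier (\<psi> t) = (\<lambda>k. w k t)"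
    by metis
  have "solution \<epsilon> \<mu> \<delta> J s ?I \<zeta>0 \<psi>0 \<zeta> \<psi>"
    unfolding solution_def
  proof (intro conjI)
    show "continuous_in_sobolev ?I s \<zeta>"
      by (rule continuous_in_sobolevI[OF \<zeta> z_le summable_on_cmult_right[OF B] cont(1)])
    show "continuous_in_sobolev ?I (s + 1/2) \<psi>"
      by (rule continuous_in_sobolevI[OF \<psi> w_le B' cont(2)])
    show "toy_model \<epsilon> \<mu> \<delta> J ?I \<zeta> \<psi>"
      unfolding toy_model_iff
    proof (intro allI, rule mode_solution_cong[OF _ sol[unfolded g_def m_def]], intro conjI)
      fix k t assume t: "t \<in> ?I"
      show "a t = \<epsilon>\<^sup>2 * alpha \<mu> (\<psi> t)"
        using a(2)[OF t] \<psi>[OF t] by (simp add: alpha_eq D_def g_def)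
      show "z k t = fourier (\<zeta> t) k" "w k t = fourier (\<psi> t) k" using \<zeta>[OF t] \<psi>[OF t] by auto
    qed
    have "AE x in lborel. \<zeta> 0 x = \<zeta>0 x"
      using \<zeta>0 \<zeta>[OF zero] init(1) by (intro fourier_unique) (auto simp: sobolev_def)
    moreover have "AE x in lborel. \<psi> 0 x = \<psi>0 x"
      using \<psi>0 \<psi>[OF zero] init(2) by (intro fourier_unique) (auto simp: sobolev_def)
    ultimately show "AE x in lborel. \<zeta> 0 x = \<zeta>0 x \<and> \<psi> 0 x = \<psi>0 x" by eventually_elim simp
  qed
  then show ?thesis by blast
qed

text \<open>
  The admissible functions \<open>a\<close> take values in \<open>[0, A]\<close> and, in the case \<open>lip\<close>, have Lipschitz constant \<open>L\<close>.
  Since \<open>\<gamma> T \<le> ln 2\<close>, the energies at most quadruple, and the hypotheses on \<open>A\<close> and \<open>L\<close> say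
  precisely that the feedback of such a flow is admissible again.
\<close>

lemma solution_exists:
  assumes T: "0 \<le> T" and \<gamma>_nonneg: "0 \<le> \<gamma>" and \<gamma>_small: "\<gamma> * T \<le> ln 2" and L: "0 \<le> L"
    and A: "D * (4 * (\<Sum>\<^sub>\<infinity>k. g k * E0 k)) \<le> A"
    and AL: "lip \<Longrightarrow> D * ((1 + A * mbar) * (4 * (\<Sum>\<^sub>\<infinity>k. g k * sqrt (g k) * E0 k))) \<le> L"
    and rate: "\<And>k. 2 * (A * (m k * sqrt (g k))) \<le> \<gamma> \<or> (lip \<and> A * m k \<le> 1/2 \<and> 2 * (L * m k) \<le> \<gamma>)"
  shows "\<exists>\<zeta> \<psi>. solution \<epsilon> \<mu> \<delta> J s {-T..T} \<zeta>0 \<psi>0 \<zeta> \<psi>"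
proof -
  interpret oscillators g m P D "mbar + \<Lambda>" T \<gamma> z0 w0 by (rule oscillators[OF T \<gamma>_nonneg])
  have growth: "exp (\<gamma> * T) \<le> 2" using \<gamma>_small by (metis exp_le_cancel_iff exp_ln zero_less_numeral)
  have S0: "0 \<le> (\<Sum>\<^sub>\<infinity>k. g k * E0 k)" by (intro infsum_nonneg mult_nonneg_nonneg g_nonneg E0_nonneg)
  have A0: "0 \<le> A"
  proof -
    have "0 \<le> D * (4 * (\<Sum>\<^sub>\<infinity>k. g k * E0 k))" using D_pos S0 by simp
    then show ?thesis using A by linarith
  qed
  have en: "energy (g k) (z k t) (w k t) \<le> 4 * E0 k" if "flow a z w" "t \<in> I" for a z w k t
    using flow_energy[OF that, of k] mult_right_mono[OF growth E0_nonneg[of k]] by linarith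
  define Adm where "Adm a \<longleftrightarrow> continuous_on I a \<and> (\<forall>t\<in>I. 0 \<le> a t \<and> a t \<le> A) \<and>
    (lip \<longrightarrow> (\<forall>t\<in>I. \<forall>u\<in>I. \<bar>a t - a u\<bar> \<le> L * \<bar>t - u\<bar>))" for a
  have "\<exists>a z w. Adm a \<and> flow a z w \<and> (\<forall>t\<in>I. a t = feedback w t)"
  proof (rule selfconsistent_flow_exists)
    show "continuous_on I a" if "Adm a" for a using that by (simp add: Adm_def)
    show "0 \<le> a t \<and> a t \<le> A" if "Adm a" "t \<in> I" for a t using that by (simp add: Adm_def)
    show "Adm (\<lambda>_. 0)" using A0 L by (simp add: Adm_def)
    show "growth_rate I (g k) (m k) a \<gamma>" if a: "Adm a" for a k
      using rate[of k]
    proof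
      assume "2 * (A * (m k * sqrt (g k))) \<le> \<gamma>"
      then show ?thesis
        using a by (intro growth_rate_low[where A = A] m_nonneg g_nonneg) (auto simp: Adm_def)
    next
      assume "lip \<and> A * m k \<le> 1/2 \<and> 2 * (L * m k) \<le> \<gamma>"
      then show ?thesis
        using a L by (intro growth_rate_high[where A = A and L = L] m_nonneg) (auto simp: Adm_def)
    qed
  next
    fix a z w assume a: "Adm a" and f: "flow a z w"
    have bnd: "0 \<le> feedback w t \<and> feedback w t \<le> A" if t: "t \<in> I" for t
    proof -
      have "2 * exp (\<gamma> * T) * (\<Sum>\<^sub>\<infinity>k. g k * E0 k) \<le> 4 * (\<Sum>\<^sub>\<infinity>k. g k * E0 k)"
        using growth S0 by (intro mult_right_mono) auto
      then have "D * (2 * exp (\<gamma> * T) * (\<Sum>\<^sub>\<infinity>k. g k * E0 k)) \<le> D * (4 * (\<Sum>\<^sub>\<infinity>k. g k * E0 k))"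
        using D_pos by (intro mult_left_mono) auto
      then show ?thesis using feedback_bounds[OF f t] A by linarith
    qed
    have "\<bar>feedback w t - feedback w u\<bar> \<le> L * \<bar>t - u\<bar>" if lip: lip and tu: "t \<in> I" "u \<in> I" for t u
    proof -
      note sumW = weighted_g_sqrt_g(1)[OF lip]
      have W0: "0 \<le> g k * sqrt (g k)" for k using g_nonneg by simp
      have "\<bar>feedback w t - feedback w u\<bar> \<le>
          D * ((1 + A * mbar) * (4 * (\<Sum>\<^sub>\<infinity>k. g k * sqrt (g k) * E0 k))) * \<bar>t - u\<bar>"
      proof (rule feedback_lipschitz[OF _ sum_feedback[OF f] _ _ tu])
        show "mode_solution I (g k) (m k) a (\<lambda>_. 0) (z k) (w k)" for k using f by (simp add: flow_def)
        fix k v assume v: "v \<in> I"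
        have av: "0 \<le> a v" "a v \<le> A" using a v by (auto simp: Adm_def)
        have "a v * m k \<le> A * mbar"
          using av coupling_le[OF lip, of k] m_nonneg[of k] A0 by (intro mult_mono) (auto simp: m_def)
        moreover have "0 \<le> a v * m k" using av m_nonneg[of k] by simp
        ultimately show "\<bar>a v * m k - 1\<bar> \<le> 1 + A * mbar" by (simp add: abs_le_iff)
      next
        fix X :: "(int^'d) set" and v assume X: "finite X" and v: "v \<in> I"
        have "(\<Sum>k\<in>X. g k * sqrt (g k) * energy (g k) (z k v) (w k v)) \<le> (\<Sum>k\<in>X. 4 * (g k * sqrt (g k) * E0 k))"
        proof (rule sum_mono)
          fix k
          show "g k * sqrt (g k) * energy (g k) (z k v) (w k v) \<le> 4 * (g k * sqrt (g k) * E0 k)"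
            using mult_left_mono[OF en[OF f v, of k] W0[of k]] by (simp add: mult_ac)
        qed
        also have "\<dots> = 4 * (\<Sum>k\<in>X. g k * sqrt (g k) * E0 k)" by (simp add: sum_distrib_left)
        also have "\<dots> \<le> 4 * (\<Sum>\<^sub>\<infinity>k. g k * sqrt (g k) * E0 k)"
          using finite_sum_le_infsum[OF sumW X] W0 E0_nonneg by simp
        finally show "(\<Sum>k\<in>X. g k * sqrt (g k) * energy (g k) (z k v) (w k v)) \<le> 4 * (\<Sum>\<^sub>\<infinity>k. g k * sqrt (g k) * E0 k)" .
      qed
      also have "\<dots> \<le> L * \<bar>t - u\<bar>" by (intro mult_right_mono AL lip) simp
      finally show ?thesis .
    qed
    then show "Adm (feedback w)"
      unfolding Adm_def using bnd feedback_continuous[OF f] by blast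
  next
    fix a and b :: "nat \<Rightarrow> real \<Rightarrow> real"
    assume b: "\<And>n. Adm (b n)" and a: "continuous_on I a" and lim: "\<And>t. t \<in> I \<Longrightarrow> (\<lambda>n. b n t) \<longlonglongrightarrow> a t"
    have "0 \<le> a t \<and> a t \<le> A" if t: "t \<in> I" for t
      using b t by (intro conjI LIMSEQ_le_const[OF lim[OF t]] LIMSEQ_le_const2[OF lim[OF t]]) (auto simp: Adm_def)
    moreover have "\<bar>a t - a u\<bar> \<le> L * \<bar>t - u\<bar>" if lip and "t \<in> I" "u \<in> I" for t u
    proof (rule LIMSEQ_le_const2)
      show "(\<lambda>n. \<bar>b n t - b n u\<bar>) \<longlonglongrightarrow> \<bar>a t - a u\<bar>" by (intro tendsto_intros lim that)
      show "\<exists>N. \<forall>n\<ge>N. \<bar>b n t - b n u\<bar> \<le> L * \<bar>t - u\<bar>" using b that by (auto simp: Adm_def)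
    qed
    ultimately show "Adm a" using a by (simp add: Adm_def)
  qed
  then obtain a z w where "Adm a" and f: "flow a z w" and fb: "\<And>t. t \<in> I \<Longrightarrow> a t = feedback w t" by blast
  show ?thesis
    by (rule modes_realise_solution[OF T, of a z w])
      (use f fb en[OF f] \<open>Adm a\<close> in \<open>auto simp: flow_def feedback_def Adm_def\<close>)
qed

end

section \<open>Lifespans\<close>

lemma finite_wavenumber_le: "finite {k :: int^'d. wavenumber k \<le> R}"
proof -
  define n where "n = \<lceil>R\<rceil>"
  have "vec_nth ` {k :: int^'d. wavenumber k \<le> R} \<subseteq> PiE UNIV (\<lambda>_. {- n .. n})"
  proof (intro image_subsetI PiE_I)
    fix k :: "int^'d" and i assume k: "k \<in> {k. wavenumber k \<le> R}"
    have "\<bar>real_of_int (k $ i)\<bar> \<le> wavenumber k"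
      using component_le_norm_cart[of "wavevector k" i] by (simp add: wavevector_def)
    then have "\<bar>real_of_int (k $ i)\<bar> \<le> R" using k by simp
    also have "R \<le> of_int n" by (simp add: n_def)
    finally show "k $ i \<in> {- n .. n}" by simp linarith
  qed simp
  then have "finite (vec_nth ` {k :: int^'d. wavenumber k \<le> R})"
    by (rule finite_subset) (intro finite_PiE; simp)
  then show ?thesis by (rule finite_imageD) (auto simp: inj_on_def vec_eq_iff)
qed

lemma coupling_finite:
  assumes J: "((\<lambda>k. k * (J k)\<^sup>2) \<longlongrightarrow> 0) at_top" and \<delta>: "0 < \<delta>" and \<eta>: "0 < \<eta>"
  shows "finite {k :: int^'d. \<eta> < coupling \<delta> J k}"
proof -
  have "\<forall>\<^sub>F x in at_top. x * (J x)\<^sup>2 < \<delta> * \<eta>"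
    using J \<delta> \<eta> by (intro order_tendstoD) auto
  then obtain R where R: "\<And>x. R \<le> x \<Longrightarrow> x * (J x)\<^sup>2 < \<delta> * \<eta>"
    by (auto simp: eventually_at_top_linorder)
  have "wavenumber k \<le> R / \<delta>" if "\<eta> < coupling \<delta> J k" for k :: "int^'d"
  proof (rule ccontr)
    assume "\<not> wavenumber k \<le> R / \<delta>"
    then have "R \<le> \<delta> * wavenumber k" using \<delta> by (simp add: field_simps)
    from R[OF this] have "\<delta> * coupling \<delta> J k < \<delta> * \<eta>" by (simp add: coupling_def mult_ac)
    then show False using that \<delta> by simp
  qed
  then show ?thesis by (intro finite_subset[OF _ finite_wavenumber_le[of "R / \<delta>"]]) auto
qed

lemma solution_subset:
  assumes "solution \<epsilon> \<mu> \<delta> J s I \<zeta>0 \<psi>0 \<zeta> \<psi>" "I' \<subseteq> I"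
  shows "solution \<epsilon> \<mu> \<delta> J s I' \<zeta>0 \<psi>0 \<zeta> \<psi>"
proof -
  have "continuous_in_sobolev I' r u" if "continuous_in_sobolev I r u" for r and u :: "real \<Rightarrow> real^'a \<Rightarrow> real"
    using that assms(2) unfolding continuous_in_sobolev_def by (meson subsetD tendsto_within_subset)
  moreover have "toy_model \<epsilon> \<mu> \<delta> J I' \<zeta> \<psi>"
    using assms unfolding solution_def toy_model_iff by (auto intro: mode_solution_subset)
  ultimately show ?thesis using assms(1) by (simp add: solution_def)
qed

lemma solution_stationary:
  fixes \<zeta>0 \<psi>0 :: "real^'d \<Rightarrow> real"
  assumes mem: "\<zeta>0 \<in> sobolev s" "\<psi>0 \<in> sobolev (s + 1/2)" and \<mu>: "0 < \<mu>"
    and zero: "\<And>k. energy (dispersion \<mu> k) (fourier \<zeta>0 k) (fourier \<psi>0 k) = 0"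
  shows "solution \<epsilon> \<mu> \<delta> J s I \<zeta>0 \<psi>0 (\<lambda>_. \<zeta>0) (\<lambda>_. \<psi>0)"
proof -
  have diff0: "fourier (\<lambda>x::real^'d. 0) k = 0" for k by (simp add: fourier_def)
  have const: "continuous_in_sobolev I r (\<lambda>_. f)" if "f \<in> sobolev r" for r and f :: "real^'d \<Rightarrow> real"
    unfolding continuous_in_sobolev_def using that by (simp add: sobolev_norm_def diff0)
  have "toy_model \<epsilon> \<mu> \<delta> J I (\<lambda>_. \<zeta>0) (\<lambda>_. \<psi>0)"
    unfolding toy_model_iff mode_solution_def
  proof (intro allI ballI conjI)
    fix k t
    have z: "fourier \<zeta>0 k = 0"
      using zero[of k] dispersion_nonneg[OF \<mu>, of k] unfolding energy_def
      by (metis add_nonneg_eq_0_iff mult_nonneg_nonneg norm_eq_zero power_eq_0_iff zero_le_power2)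
    then have "dispersion \<mu> k * (norm (fourier \<psi>0 k))\<^sup>2 = 0" using zero[of k] by (simp add: energy_def)
    then have w: "dispersion \<mu> k *\<^sub>R fourier \<psi>0 k = 0" by auto
    show "((\<lambda>t. fourier \<zeta>0 k) has_vector_derivative dispersion \<mu> k *\<^sub>R fourier \<psi>0 k) (at t within I)"
      unfolding w by (rule has_vector_derivative_const)
    show "((\<lambda>t. fourier \<psi>0 k) has_vector_derivative
        (\<epsilon>\<^sup>2 * alpha \<mu> \<psi>0 * coupling \<delta> J k - 1) *\<^sub>R fourier \<zeta>0 k + 0) (at t within I)"
      unfolding z by simp
  qed
  then show ?thesis using const mem by (simp add: solution_def)
qed

text \<open>
  The modes are split into those with \<open>m \<surd>|k| \<le> \<Lambda>\<close> and, in the case \<open>lip\<close>, those with \<open>m \<le> \<eta>\<close>.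
  The scalar \<open>a\<close> is bounded by \<open>V M\<^sup>2\<close> and by \<open>V n\<^sup>2\<close>. The first bound gives \<open>a m \<le> 1/2\<close> for the
  high modes, the second makes all growth rates proportional to \<open>n\<^sup>2\<close>.
\<close>

theorem wellposed:
  fixes J :: "real \<Rightarrow> real" and lip :: bool and V :: real
  assumes V_def: "V = 4 * (2 * pi) ^ CARD('d)"
    and J: "((\<lambda>k. k * (J k)\<^sup>2) \<longlongrightarrow> 0) at_top" and \<delta>: "0 < \<delta>" and c: "0 < c"
    and \<Lambda>: "0 \<le> \<Lambda>" and \<eta>: "0 \<le> \<eta>" and mbar: "0 \<le> mbar"
    and coupling_le: "\<And>k :: int^'d. lip \<Longrightarrow> coupling \<delta> J k \<le> mbar"
    and split: "\<And>k :: int^'d. coupling \<delta> J k * sqrt (wavenumber k) \<le> \<Lambda> \<or> (lip \<and> coupling \<delta> J k \<le> \<eta>)"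
    and \<eta>_small: "V * M\<^sup>2 * \<eta> \<le> 1/2"
    and c_low: "2 * (V * \<Lambda>) * c \<le> ln 2"
    and c_high: "lip \<Longrightarrow> 2 * (V * (1 + V * M\<^sup>2 * mbar) * \<eta>) * c \<le> ln 2"
  shows "wellposed_with_lifespan TYPE('d) \<delta> J M (if lip then 3/4 else 1/2) c"
proof -
  define \<sigma> :: real where "\<sigma> = (if lip then 3/4 else 1/2)"
  have V: "0 < V" by (simp add: V_def)
  have "wellposed_with_lifespan TYPE('d) \<delta> J M \<sigma> c"
    unfolding wellposed_with_lifespan_def
  proof (intro allI impI)
    fix \<epsilon> \<mu> s :: real and \<zeta>0 \<psi>0 :: "real^'d \<Rightarrow> real"
    assume \<epsilon>: "0 < \<epsilon>" and \<mu>: "1 \<le> \<mu>" and s_ge_\<sigma>: "\<sigma> \<le> s"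
      and mem: "\<zeta>0 \<in> sobolev s" "\<psi>0 \<in> sobolev (s + 1/2)"
      and M: "\<epsilon> * sobolev_norm (1/2) (fourier \<zeta>0) + \<epsilon> * sobolev_norm 0 (fourier_grad \<psi>0) \<le> M"
    define n where "n = \<epsilon> * sobolev_norm \<sigma> (fourier \<zeta>0) + \<epsilon> * sobolev_norm (\<sigma> - 1/2) (fourier_grad \<psi>0)"
    interpret toy_data \<epsilon> \<mu> \<delta> s mbar \<Lambda> J lip \<zeta>0 \<psi>0
      by standard (use \<epsilon> \<mu> s_ge_\<sigma> mem mbar \<Lambda> coupling_le split in \<open>auto simp: \<sigma>_def\<close>)
    have fin: "finite {k. \<eta>' < m k}" if "0 < \<eta>'" for \<eta>'
      unfolding m_def by (rule coupling_finite[OF J \<delta> that])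
    have M_nonneg: "0 \<le> \<epsilon> * sobolev_norm (1/2) (fourier \<zeta>0) + \<epsilon> * sobolev_norm 0 (fourier_grad \<psi>0)"
      using \<epsilon> by (simp add: sobolev_norm_def infsum_nonneg)
    have \<sigma>: "1/2 \<le> \<sigma>" by (simp add: \<sigma>_def)
    define S where "S = \<epsilon>\<^sup>2 * (\<Sum>\<^sub>\<infinity>k. g k * E0 k)"
    have S0: "0 \<le> S"
      unfolding S_def by (intro mult_nonneg_nonneg infsum_nonneg g_nonneg E0_nonneg) simp
    have SM: "S \<le> M\<^sup>2"
    proof -
      have "S \<le> (\<epsilon> * sobolev_norm (1/2) (fourier \<zeta>0) + \<epsilon> * sobolev_norm 0 (fourier_grad \<psi>0))\<^sup>2"
        using weighted_g(2)[OF order.refl s_ge] by (simp add: S_def)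
      also have "\<dots> \<le> M\<^sup>2" using M M_nonneg by (intro power_mono)
      finally show ?thesis .
    qed
    have Sn: "S \<le> n\<^sup>2" using weighted_g(2)[OF \<sigma> s_ge_\<sigma>] by (simp add: S_def n_def)
    show "exists_unique_solution \<epsilon> \<mu> \<delta> J s (time_interval c
        (\<epsilon> * sobolev_norm \<sigma> (fourier \<zeta>0) + \<epsilon> * sobolev_norm (\<sigma> - 1/2) (fourier_grad \<psi>0))) \<zeta>0 \<psi>0"
      unfolding n_def[symmetric]
    proof (cases "n = 0")
      case False
      define T where "T = c / n\<^sup>2"
      have T: "0 \<le> T" using c by (simp add: T_def)
      have nT: "n\<^sup>2 * T = c" using False by (simp add: T_def)
      define A where "A = V * S"
      have A: "0 \<le> A" "A \<le> V * M\<^sup>2" "A \<le> V * n\<^sup>2"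
        using V S0 SM Sn by (auto simp: A_def intro!: mult_left_mono)
      define L where "L = V * (1 + V * M\<^sup>2 * mbar) * n\<^sup>2"
      have L: "0 \<le> L" using V mbar by (simp add: L_def)
      define \<gamma> where "\<gamma> = max (2 * (A * \<Lambda>)) (if lip then 2 * (L * \<eta>) else 0)"
      have \<gamma>: "0 \<le> \<gamma>" using A \<Lambda> by (simp add: \<gamma>_def le_max_iff_disj)
      have "\<exists>\<zeta> \<psi>. solution \<epsilon> \<mu> \<delta> J s {-T..T} \<zeta>0 \<psi>0 \<zeta> \<psi>"
      proof (rule solution_exists[OF T \<gamma> _ L, where A = A])
        have "2 * (A * \<Lambda>) * T \<le> ln 2"
        proof -
          have "A * (\<Lambda> * T) \<le> V * n\<^sup>2 * (\<Lambda> * T)" using A(3) \<Lambda> T by (intro mult_right_mono) auto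
          also have "\<dots> = V * \<Lambda> * c" unfolding nT[symmetric] by (simp add: mult_ac)
          finally show ?thesis using c_low by (simp add: mult_ac)
        qed
        moreover have "2 * (L * \<eta>) * T \<le> ln 2" if lip
        proof -
          have "2 * (L * \<eta>) * T = 2 * (V * (1 + V * M\<^sup>2 * mbar) * \<eta>) * (n\<^sup>2 * T)"
            by (simp add: L_def mult_ac)
          then show ?thesis using c_high[OF that] by (simp only: nT)
        qed
        ultimately show "\<gamma> * T \<le> ln 2" by (auto simp: \<gamma>_def max_def)
        show "D * (4 * (\<Sum>\<^sub>\<infinity>k. g k * E0 k)) \<le> A" by (simp add: A_def S_def V_def D_def)
        show "D * ((1 + A * mbar) * (4 * (\<Sum>\<^sub>\<infinity>k. g k * sqrt (g k) * E0 k))) \<le> L" if lip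
        proof -
          define Q where "Q = \<epsilon>\<^sup>2 * (\<Sum>\<^sub>\<infinity>k. g k * sqrt (g k) * E0 k)"
          have Q0: "0 \<le> Q"
            unfolding Q_def
            by (intro mult_nonneg_nonneg infsum_nonneg) (auto simp: g_nonneg E0_nonneg)
          have Qn: "Q \<le> n\<^sup>2"
            using weighted_g_sqrt_g(2)[OF that] that by (simp add: Q_def n_def \<sigma>_def)
          have "D * ((1 + A * mbar) * (4 * (\<Sum>\<^sub>\<infinity>k. g k * sqrt (g k) * E0 k))) = V * (1 + A * mbar) * Q"
            by (simp add: Q_def V_def D_def)
          also have "\<dots> \<le> V * (1 + V * M\<^sup>2 * mbar) * n\<^sup>2"
            using A V mbar Q0 Qn by (intro mult_mono mult_left_mono add_left_mono mult_right_mono) auto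
          finally show ?thesis by (simp add: L_def)
        qed
        fix k
        show "2 * (A * (m k * sqrt (g k))) \<le> \<gamma> \<or> (lip \<and> A * m k \<le> 1/2 \<and> 2 * (L * m k) \<le> \<gamma>)"
          using split[of k]
        proof
          assume low: "coupling \<delta> J k * sqrt (wavenumber k) \<le> \<Lambda>"
          have "m k * sqrt (g k) \<le> m k * sqrt (wavenumber k)"
            using m_nonneg by (intro mult_left_mono) (auto simp: g_def dispersion_le)
          then have "A * (m k * sqrt (g k)) \<le> A * \<Lambda>"
            using low A(1) by (intro mult_left_mono) (auto simp: m_def)
          then have "2 * (A * (m k * sqrt (g k))) \<le> 2 * (A * \<Lambda>)" by simp
          also have "\<dots> \<le> \<gamma>" unfolding \<gamma>_def by (rule max.cobounded1)
          finally show ?thesis by (rule disjI1)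
        next
          assume high: "lip \<and> coupling \<delta> J k \<le> \<eta>"
          then have mk: "m k \<le> \<eta>" by (simp add: m_def)
          have "A * m k \<le> V * M\<^sup>2 * \<eta>" using A(1,2) mk m_nonneg V by (intro mult_mono) auto
          then have "A * m k \<le> 1/2" using \<eta>_small by linarith
          moreover have "L * m k \<le> L * \<eta>" using mk L by (rule mult_left_mono)
          then have "2 * (L * m k) \<le> \<gamma>" using high by (simp add: \<gamma>_def)
          ultimately show ?thesis using high by simp
        qed
      qed
      then obtain \<zeta> \<psi> where sol: "solution \<epsilon> \<mu> \<delta> J s {-T..T} \<zeta>0 \<psi>0 \<zeta> \<psi>" by blast
      have "time_interval c n = {-T..T}" using False by (simp add: time_interval_def T_def)
      then show "exists_unique_solution \<epsilon> \<mu> \<delta> J s (time_interval c n) \<zeta>0 \<psi>0"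
        unfolding exists_unique_solution_def using sol solution_unique[OF T fin sol] by metis
    next
      case True
      have 1: "1 \<le> japanese k powr \<sigma>" "1 * g k \<le> japanese k powr (\<sigma> - 1/2) * (wavenumber k)\<^sup>2" for k :: "int^'d"
      proof -
        show "1 \<le> japanese k powr \<sigma>" using \<sigma> by (intro ge_one_powr_ge_zero) auto
        have "g k \<le> 1 * (wavenumber k)\<^sup>2"
        proof (cases "k = 0")
          case False
          have "1 * wavenumber k \<le> wavenumber k * wavenumber k"
            using wavenumber_ge_1[OF False] by (intro mult_right_mono) auto
          then show ?thesis
            using dispersion_le[of \<mu> k] by (simp add: g_def power2_eq_square)
        qed (simp add: g_def dispersion_def G0_def)
        also have "\<dots> \<le> japanese k powr (\<sigma> - 1/2) * (wavenumber k)\<^sup>2"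
          using \<sigma> by (intro mult_right_mono ge_one_powr_ge_zero) auto
        finally show "1 * g k \<le> japanese k powr (\<sigma> - 1/2) * (wavenumber k)\<^sup>2" by simp
      qed
      note total = weighted_data[of "\<lambda>_. 1", OF _ 1 s_ge_\<sigma>]
      have zero: "E0 k = 0" for k
      proof -
        have sum: "E0 summable_on UNIV" using total(1) by simp
        have "\<epsilon>\<^sup>2 * infsum E0 UNIV \<le> 0" using total(2) True by (simp add: n_def)
        then have "infsum E0 UNIV \<le> 0" using \<epsilon> by (simp add: mult_le_0_iff)
        moreover have "E0 k \<le> infsum E0 UNIV"
          using finite_sum_le_infsum[OF sum, of "{k}"] E0_nonneg by simp
        ultimately show ?thesis using E0_nonneg[of k] by linarith
      qed
      have sol: "solution \<epsilon> \<mu> \<delta> J s UNIV \<zeta>0 \<psi>0 (\<lambda>_. \<zeta>0) (\<lambda>_. \<psi>0)"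
        using solution_stationary[OF mem] \<mu> zero by (simp add: g_def)
      have "AE x in lborel. \<zeta>' t x = \<zeta>0 x \<and> \<psi>' t x = \<psi>0 x"
        if sol': "solution \<epsilon> \<mu> \<delta> J s UNIV \<zeta>0 \<psi>0 \<zeta>' \<psi>'" for \<zeta>' \<psi>' t
        by (rule solution_unique[OF _ fin solution_subset[OF sol] solution_subset[OF sol'], of "\<bar>t\<bar>"]) auto
      then show "exists_unique_solution \<epsilon> \<mu> \<delta> J s (time_interval c n) \<zeta>0 \<psi>0"
        unfolding exists_unique_solution_def time_interval_def using True sol
        by (intro exI[of _ "\<lambda>_. \<zeta>0"] exI[of _ "\<lambda>_. \<psi>0"]) auto
    qed
  qed
  then show ?thesis by (simp only: \<sigma>_def)
qed

text \<open>
  Since \<open>m \<rightarrow> 0\<close>, only finitely many modes exceed the threshold \<open>\<eta>\<close> dictated by \<open>M\<close>.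
  The maximal growth rate of these enters the constant \<open>c\<close>, which therefore depends on \<open>\<delta>\<close> and \<open>J\<close>.
\<close>

lemma wellposed_rough:
  assumes J: "((\<lambda>k. k * (J k)\<^sup>2) \<longlongrightarrow> 0) at_top" and \<delta>: "0 < \<delta>"
  shows "\<exists>c>0. wellposed_with_lifespan TYPE('d::finite) \<delta> J M (3/4) c"
proof -
  define V :: real where "V = 4 * (2 * pi) ^ CARD('d)"
  have V: "0 < V" by (simp add: V_def)
  define \<eta> where "\<eta> = 1 / (2 * (V * M\<^sup>2 + 1))"
  have VM: "0 \<le> V * M\<^sup>2" using V by simp
  have \<eta>: "0 < \<eta>" using VM by (simp add: \<eta>_def)
  have \<eta>_small: "V * M\<^sup>2 * \<eta> \<le> 1/2" using VM by (simp add: \<eta>_def field_simps)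
  define m where "m k = coupling \<delta> J k" for k :: "int^'d"
  have m: "0 \<le> m k" for k by (simp add: m_def coupling_nonneg)
  define H where "H = {k. \<eta> < m k}"
  have H: "finite H" unfolding H_def m_def by (rule coupling_finite[OF J \<delta> \<eta>])
  define mbar where "mbar = \<eta> + (\<Sum>k\<in>H. m k)"
  define \<Lambda> where "\<Lambda> = (\<Sum>k\<in>H. m k * sqrt (wavenumber k))"
  have sums: "0 \<le> (\<Sum>k\<in>H. m k)" "0 \<le> \<Lambda>" unfolding \<Lambda>_def by (auto intro!: sum_nonneg mult_nonneg_nonneg m)
  have mbar: "0 \<le> mbar" using sums \<eta> by (simp add: mbar_def)
  define Q where "Q = 2 * (V * \<Lambda>) + 2 * (V * (1 + V * M\<^sup>2 * mbar) * \<eta>)"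
  have pos: "0 \<le> 2 * (V * \<Lambda>)" "0 \<le> 2 * (V * (1 + V * M\<^sup>2 * mbar) * \<eta>)"
    using V VM sums \<eta> mbar by auto
  define c where "c = ln 2 / (Q + 1)"
  have Q: "0 \<le> Q" using pos by (simp add: Q_def)
  have c: "0 < c" using Q by (simp add: c_def)
  have Qc: "x * c \<le> ln 2" if "x \<le> Q" for x
  proof -
    have "x * c \<le> (Q + 1) * c" using that c by (intro mult_right_mono) auto
    also have "\<dots> = ln 2" using Q by (simp add: c_def)
    finally show ?thesis .
  qed
  have "wellposed_with_lifespan TYPE('d) \<delta> J M (if True then 3/4 else 1/2) c"
  proof (rule wellposed[OF V_def J \<delta> c sums(2) less_imp_le[OF \<eta>] mbar])
    fix k :: "int^'d"
    show "coupling \<delta> J k \<le> mbar"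
    proof (cases "k \<in> H")
      case True
      then have "m k \<le> (\<Sum>k\<in>H. m k)" using H m by (intro member_le_sum) auto
      then show ?thesis using \<eta> by (simp add: mbar_def m_def)
    next
      case False
      then show ?thesis using sums(1) by (simp add: H_def m_def mbar_def)
    qed
    show "coupling \<delta> J k * sqrt (wavenumber k) \<le> \<Lambda> \<or> (True \<and> coupling \<delta> J k \<le> \<eta>)"
    proof (cases "k \<in> H")
      case True
      then have "m k * sqrt (wavenumber k) \<le> \<Lambda>"
        unfolding \<Lambda>_def using H m by (intro member_le_sum) auto
      then show ?thesis by (simp add: m_def)
    qed (simp add: H_def m_def)
  qed (use \<eta>_small Qc pos in \<open>auto simp: Q_def\<close>)
  then show ?thesis using c by auto
qed

text \<open>
  All modes are low: by scaling, \<open>m \<surd>|k| = (\<delta>|k|)\<^sup>3\<^sup>/\<^sup>2 J(\<delta>|k|)\<^sup>2 / \<delta>\<^sup>3\<^sup>/\<^sup>2\<close>.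
\<close>

lemma wellposed_regularised:
  assumes J: "((\<lambda>k. k * (J k)\<^sup>2) \<longlongrightarrow> 0) at_top" and \<delta>: "0 < \<delta>" and T0: "0 < T0"
    and bdd: "bdd_above ((\<lambda>k. k powr (3/2) * (J k)\<^sup>2) ` {0..})"
    and small: "8 * (2 * pi) ^ CARD('d) * (SUP k\<in>{0..}. k powr (3/2) * (J k)\<^sup>2) * T0 \<le> ln 2"
  shows "wellposed_with_lifespan TYPE('d::finite) \<delta> J M (1/2) (T0 * \<delta> powr (3/2))"
proof -
  define K where "K = (SUP k\<in>{0..}. k powr (3/2) * (J k)\<^sup>2)"
  have K: "k powr (3/2) * (J k)\<^sup>2 \<le> K" if "0 \<le> k" for k
    unfolding K_def by (rule cSUP_upper[OF _ bdd]) (use that in simp)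
  have K0: "0 \<le> K" using K[of 0] by simp
  define \<Lambda> where "\<Lambda> = K / \<delta> powr (3/2)"
  have \<delta>p: "0 < \<delta> powr (3/2)" using \<delta> by simp
  have \<Lambda>: "0 \<le> \<Lambda>" using K0 \<delta>p by (simp add: \<Lambda>_def)
  have le: "coupling \<delta> J k * sqrt (wavenumber k) \<le> \<Lambda>" for k :: "int^'d"
  proof -
    have "x * sqrt x = x powr (3/2)" if "0 \<le> x" for x :: real
    proof (cases "x = 0")
      case False
      then have "x powr (1 + 1/2) = x * sqrt x" using that by (simp only: powr_add powr_half_sqrt) simp
      then show ?thesis by simp
    qed simp
    then have "\<delta> powr (3/2) * (coupling \<delta> J k * sqrt (wavenumber k)) =
        \<delta> powr (3/2) * wavenumber k powr (3/2) * (J (\<delta> * wavenumber k))\<^sup>2"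
      by (simp add: coupling_def mult_ac)
    also have "\<dots> = (\<delta> * wavenumber k) powr (3/2) * (J (\<delta> * wavenumber k))\<^sup>2"
      using \<delta> by (simp add: powr_mult)
    also have "\<dots> \<le> K" using \<delta> by (intro K) simp
    finally show ?thesis using \<delta>p by (simp add: \<Lambda>_def field_simps)
  qed
  have "wellposed_with_lifespan TYPE('d) \<delta> J M (if False then 3/4 else 1/2) (T0 * \<delta> powr (3/2))"
  proof (rule wellposed[OF refl J \<delta> _ \<Lambda> order.refl order.refl])
    have eq: "2 * (4 * (2 * pi) ^ CARD('d) * \<Lambda>) * (T0 * \<delta> powr (3/2)) = 8 * (2 * pi) ^ CARD('d) * K * T0"
      using \<delta>p by (simp add: \<Lambda>_def)
    show "2 * (4 * (2 * pi) ^ CARD('d) * \<Lambda>) * (T0 * \<delta> powr (3/2)) \<le> ln 2"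
      unfolding eq K_def by (rule small)
  qed (use le T0 \<delta>p in auto)
  then show ?thesis by simp
qed

theorem propositionB1:
  shows
    "(\<forall>(J :: real \<Rightarrow> real) M \<delta>.
        ((\<lambda>k. k * (J k)\<^sup>2) \<longlongrightarrow> 0) at_top \<longrightarrow> M \<ge> 0 \<longrightarrow> \<delta> > 0 \<longrightarrow>
          (\<exists>T\<delta>>0. wellposed_with_lifespan TYPE(1) \<delta> J M (3/4) T\<delta>) \<and>
          (\<exists>T\<delta>>0. wellposed_with_lifespan TYPE(2) \<delta> J M (3/4) T\<delta>))
     \<and>
     (\<forall>M\<ge>0. \<forall>K. \<exists>T0>0. \<forall>(J :: real \<Rightarrow> real) \<delta>.
        ((\<lambda>k. k * (J k)\<^sup>2) \<longlongrightarrow> 0) at_top \<longrightarrow> \<delta> > 0 \<longrightarrow>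
        bdd_above ((\<lambda>k. k powr (3/2) * (J k)\<^sup>2) ` {0..}) \<longrightarrow>
        (SUP k\<in>{0..}. k powr (3/2) * (J k)\<^sup>2) = K \<longrightarrow>
          wellposed_with_lifespan TYPE(1) \<delta> J M (1/2) (T0 * \<delta> powr (3/2)) \<and>
          wellposed_with_lifespan TYPE(2) \<delta> J M (1/2) (T0 * \<delta> powr (3/2)))"
proof (intro conjI allI impI)
  fix J :: "real \<Rightarrow> real" and M \<delta> :: real
  assume "((\<lambda>k. k * (J k)\<^sup>2) \<longlongrightarrow> 0) at_top" "0 < \<delta>"
  then show "\<exists>T\<delta>>0. wellposed_with_lifespan TYPE(1) \<delta> J M (3/4) T\<delta>"
    "\<exists>T\<delta>>0. wellposed_with_lifespan TYPE(2) \<delta> J M (3/4) T\<delta>"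
    by (rule wellposed_rough)+
next
  fix M K :: real
  define T0 where "T0 = ln 2 / (8 * (2 * pi)\<^sup>2 * (\<bar>K\<bar> + 1))"
  have T0: "0 < T0" unfolding T0_def by (intro divide_pos_pos mult_pos_pos) auto
  have small: "8 * V * K * T0 \<le> ln 2" if "0 \<le> V" "V \<le> (2 * pi)\<^sup>2" for V
  proof -
    have "V * K \<le> (2 * pi)\<^sup>2 * (\<bar>K\<bar> + 1)"
      using that by (intro order.trans[OF mult_left_mono[of K "\<bar>K\<bar> + 1"] mult_right_mono]) auto
    then have "8 * V * K * T0 \<le> 8 * (2 * pi)\<^sup>2 * (\<bar>K\<bar> + 1) * T0"
      using T0 by (intro mult_right_mono) (auto simp only: mult.assoc mult_le_cancel_left_pos[of 8] zero_less_numeral)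
    also have "\<dots> = ln 2" by (simp add: T0_def)
    finally show ?thesis .
  qed
  have "2 * pi \<le> (2 * pi)\<^sup>2" using pi_ge_two by (simp add: power2_eq_square)
  then have "8 * (2 * pi) ^ CARD(1) * K * T0 \<le> ln 2" by (intro small) simp_all
  moreover have "8 * (2 * pi) ^ CARD(2) * K * T0 \<le> ln 2" by (rule small) simp_all
  ultimately show "\<exists>T0>0. \<forall>(J :: real \<Rightarrow> real) \<delta>.
        ((\<lambda>k. k * (J k)\<^sup>2) \<longlongrightarrow> 0) at_top \<longrightarrow> \<delta> > 0 \<longrightarrow>
        bdd_above ((\<lambda>k. k powr (3/2) * (J k)\<^sup>2) ` {0..}) \<longrightarrow>
        (SUP k\<in>{0..}. k powr (3/2) * (J k)\<^sup>2) = K \<longrightarrow>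
          wellposed_with_lifespan TYPE(1) \<delta> J M (1/2) (T0 * \<delta> powr (3/2)) \<and>
          wellposed_with_lifespan TYPE(2) \<delta> J M (1/2) (T0 * \<delta> powr (3/2))"
    using T0 by (intro exI[of _ T0]) (auto intro!: wellposed_regularised)
qed

end
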